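(* Let $j,\ell$ be integers with $1\le j\le\ell$ and $\gcd(j,\ell)=1$. Then, as $x\to\infty$, $$\sum_{\substack{2\le n\le x\\ p_1(n)\equiv j\ (\mathrm{mod}\ \ell)}}\mu(n)\omega(n)^2\left[\frac{x}{n}\right]\ll\frac{x(\log\log x)^3}{\log x}.$$
   Context: $\mu$ is the Möbius function, $\omega(n)$ the number of distinct prime factors of $n$, $p_1(n)$ the smallest prime factor of $n\ge2$, and $[w]$ the integer part of the real number $w$. Implied constants may depend on $\ell$. *)

theory Defs
  imports
    Complex_Main
    "HOL-Library.Landau_Symbols"
    "HOL-Computational_Algebra.Squarefree"
    "HOL-Number_Theory.Cong"
begin

definition omega :: "nat \<Rightarrow> nat" where
  "omega n = card (prime_factors n)"

definition moebius_mu :: "nat \<Rightarrow> int" where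
  "moebius_mu n = (if squarefree n then (- 1) ^ omega n else 0)"

(* Only meaningful for n \<ge> 2; for n \<le> 1 the set prime_factors n is empty and Min is unspecified. *)
definition least_prime_factor :: "nat \<Rightarrow> nat" where
  "least_prime_factor n = Min (prime_factors n)"

end

theory Submission
  imports
    Defs
    "HOL-Number_Theory.Prime_Powers"
    "HOL-Number_Theory.Residues"
    "HOL-Library.Discrete_Functions"
    "HOL-Analysis.Complex_Transcendental"
    "HOL-Real_Asymp.Real_Asymp"
begin

text \<open>
  Since \<open>[x/n]\<close> counts the multiples of \<open>n\<close>, the sum is \<open>\<Sum>m\<le>x. f m\<close>, where \<open>f m\<close> is the sum of
  \<open>\<mu>(n) \<omega>(n)\<^sup>2\<close> over the divisors \<open>n\<close> of \<open>m\<close> with \<open>p\<^sub>1(n) \<equiv> j\<close>. Only squarefree \<open>n\<close> matter, and the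
  alternating sums over sets of primes collapse (Alladi's duality):
  \<open>f m = - [P\<^sub>1 \<equiv> j] + 3 [P\<^sub>2 \<equiv> j] - 2 [P\<^sub>3 \<equiv> j]\<close> with \<open>P\<^sub>1 > P\<^sub>2 > P\<^sub>3\<close> the largest primes of \<open>m\<close>.
  As \<open>- 1 + 3 - 2 = 0\<close>, each indicator may be replaced by its deviation \<open>c(p) = [p \<equiv> j] - \<kappa>\<close> from the mean.

  The prime number theorem is not needed; Mertens' theorem for residue classes suffices, that is,
  \<open>\<Sum>p\<le>x. c(p) ln p / p = O(1)\<close>. For \<open>P\<^sub>1\<close>, numbers without a prime above \<open>y = x\<^bsup>1/(4 ln ln x)\<^esup>\<close> are
  negligible (Rankin). The number of \<open>q\<close>-smooth cofactors of a prime \<open>q > y\<close> is a Moebius sum over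
  \<open>q\<close>-rough \<open>d\<close>; the rounding errors add up to at most the number of \<open>y\<close>-rough integers, which is
  \<open>O(x / ln y)\<close>, and partial summation over \<open>q\<close> bounds the main term. This gives \<open>O(x ln ln x / ln x)\<close>.
  Stripping off the largest prime costs one further factor \<open>ln ln x\<close> by Chebyshev's bound, so that
  \<open>P\<^sub>2\<close> and \<open>P\<^sub>3\<close> contribute \<open>O(x (ln ln x)\<^sup>2 / ln x)\<close> and \<open>O(x (ln ln x)\<^sup>3 / ln x)\<close>.

  Mertens' theorem for residue classes is proved with Dirichlet characters in the manner of Shapiro;
  \<open>L(1, \<xi>) \<noteq> 0\<close> for real \<open>\<xi>\<close> is Monsky's argument with Lambert series.
\<close>

section \<open>Chebyshev and Mertens estimates\<close>

text \<open>Every estimate must hold for all N at once: removing a prime p leads to sums up to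
  \<open>N div p\<close>, which takes all sizes down to 1. Hence the shape
  \<open>real N * lam N ^ A / ln (real N + 2)\<close> with shifted logarithms. Mertens' theorem
  bounds the tail of sum c(p) / p beyond t only by O(1 / ln t). This is enough because c(q) / q is
  multiplied by a bounded Moebius sum M(q) whose variation over a dyadic block at X is O(1 / ln X),
  apart from a single jump at N. Together the two logarithms make the blocks add up to O(1 / ln y),
  where one logarithm alone would give a divergent harmonic series. The duality formula concerns
  distinct primes, while division by the largest prime removes just one copy of it. Integers with a
  repeated first or second prime, or with fewer than three prime factors, therefore have to be
  estimated separately.\<close>

lemma sum_divisors_swap:
  fixes f :: "nat \<Rightarrow> nat \<Rightarrow> 'a::comm_monoid_add"
  shows "(\<Sum>n=1..N. \<Sum>d | d dvd n. f d (n div d)) = (\<Sum>d=1..N. \<Sum>m=1..N div d. f d m)"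
proof -
  have "(\<Sum>n=1..N. \<Sum>d | d dvd n. f d (n div d)) = (\<Sum>(n,d)\<in>(SIGMA n:{1..N}. {d. d dvd n}). f d (n div d))"
    by (subst sum.Sigma) auto
  also have "\<dots> = (\<Sum>(d,m)\<in>(SIGMA d:{1..N}. {1..N div d}). f d m)"
  proof (rule sum.reindex_bij_witness[where i = "\<lambda>(d,m). (d*m,d)" and j = "\<lambda>(n,d). (d, n div d)"], goal_cases)
    case (2 a)
    then show ?case
      by (force simp: dvd_div_eq_0_iff Suc_le_eq intro: div_le_mono dest: dvd_imp_le)
  next
    case (4 b)
    then obtain d m where b: "b = (d,m)" "1 \<le> d" "d \<le> N" "1 \<le> m" "m \<le> N div d" by auto
    then have "d * m \<le> N" using mult_le_mono2[of m "N div d" d] times_div_less_eq_dividend[of d N] by linarith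
    then show ?case using b by auto
  qed auto
  also have "\<dots> = (\<Sum>d=1..N. \<Sum>m=1..N div d. f d m)"
    by (subst sum.Sigma) auto
  finally show ?thesis .
qed

lemma ln2_ge_half: "ln (2::real) \<ge> 1/2"
proof -
  have "exp (1::real) \<le> 2 ^ 2" using exp_le by simp
  then have "ln (exp (1::real)) \<le> ln (2 ^ 2)" by (subst ln_le_cancel_iff) auto
  then show ?thesis using ln_realpow[of 2 2] by simp
qed

lemma real_div_minus_one_le: "real N / real d - 1 \<le> real (N div d)"
  using floor_divide_of_nat_eq[of N d, where ?'a = real] by linarith

lemma ln_fact_eq_sum: "ln (fact N) = (\<Sum>n=1..N. ln (real n))"
  by (induction N) (auto simp: ln_mult add.commute)

lemma ln_fact_mangoldt: "ln (fact N) = (\<Sum>d=1..N. mangoldt d * real (N div d))"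
proof -
  have "ln (fact N) = (\<Sum>n=1..N. \<Sum>d | d dvd n. (mangoldt d :: real))"
    unfolding ln_fact_eq_sum by (intro sum.cong refl, subst mangoldt_sum) auto
  also have "\<dots> = (\<Sum>d=1..N. \<Sum>m=1..N div d. mangoldt d)"
    by (rule sum_divisors_swap)
  finally show ?thesis by (simp add: mult.commute)
qed

lemma ln_fact_ge: "real N * ln (real N) - real N \<le> ln (fact N)"
proof (induction N)
  case (Suc N)
  show ?case
  proof (cases "N = 0")
    case False
    have "real N * (ln (real (Suc N)) - ln (real N)) \<le> 1"
    proof -
      have "ln (real (Suc N)) - ln (real N) = ln (1 + 1 / real N)"
        using False by (subst ln_divide_pos [symmetric]) (auto simp: field_simps)
      also have "\<dots> \<le> 1 / real N" by (rule ln_add_one_self_le_self) auto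
      finally show ?thesis using False by (simp add: field_simps)
    qed
    moreover have "ln (fact (Suc N)) = ln (real (Suc N)) + ln (fact N)"
      by (subst fact_Suc, subst ln_mult) (auto simp del: of_nat_Suc)
    ultimately show ?thesis using Suc by (simp add: algebra_simps)
  qed auto
qed auto

lemma ln_fact_le: "ln (fact N) \<le> real N * ln (real N)"
proof -
  have "(\<Sum>n=1..N. ln (real n)) \<le> (\<Sum>n=1..N. ln (real N))"
    by (intro sum_mono) auto
  then show ?thesis by (simp add: ln_fact_eq_sum)
qed

definition psi :: "nat \<Rightarrow> real" where
  "psi N = (\<Sum>d=1..N. mangoldt d)"

text \<open>The weight \<open>2*M div d - 2 * (M div d)\<close> is never negative and equals 1 for M
  < d <= 2M, so the difference is dominated by the Mangoldt expansion of ln of the central binomial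
  coefficient, which is at most 4^M.\<close>

lemma psi_double: "psi (2 * M) - psi M \<le> 2 * real M * ln 2"
proof -
  have "psi (2*M) - psi M = (\<Sum>d\<in>{Suc M..2*M}. mangoldt d)"
    unfolding psi_def by (subst sum.ub_add_nat[of 1 M _ M, unfolded mult_2[symmetric]]) (auto simp: mult_2)
  also have "\<dots> \<le> (\<Sum>d\<in>{Suc M..2*M}. mangoldt d * (real (2*M div d) - 2 * real (M div d)))"
  proof (intro sum_mono)
    fix d assume d: "d \<in> {Suc M..2*M}"
    then have "2 * M div d = 1" by (intro Euclidean_Rings.div_nat_eqI) auto
    then show "mangoldt d \<le> mangoldt d * (real (2*M div d) - 2 * real (M div d))" using d by auto
  qed
  also have "\<dots> \<le> (\<Sum>d\<in>{1..2*M}. mangoldt d * (real (2*M div d) - 2 * real (M div d)))"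
  proof (intro sum_mono2)
    fix d assume d: "d \<in> {1..2*M} - {Suc M..2*M}"
    then have "2 * (M div d) \<le> 2 * M div d" by (simp add: less_eq_div_iff_mult_less_eq mult.assoc)
    then have "real (2 * (M div d)) \<le> real (2 * M div d)" by (simp only: of_nat_le_iff)
    then show "0 \<le> mangoldt d * (real (2*M div d) - 2 * real (M div d))"
      by (intro mult_nonneg_nonneg mangoldt_nonneg) auto
  qed auto
  also have "\<dots> = ln (fact (2*M)) - 2 * (\<Sum>d=1..2*M. mangoldt d * real (M div d))"
    unfolding ln_fact_mangoldt by (simp add: sum_subtractf sum_distrib_left algebra_simps)
  also have "(\<Sum>d=1..2*M. mangoldt d * real (M div d)) = ln (fact M)"
    unfolding ln_fact_mangoldt by (rule sum.mono_neutral_right) auto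
  also have "ln (fact (2*M)) - 2 * ln (fact M) = ln (fact (2*M) / (fact M * fact M) :: real)"
    by (subst ln_divide_pos) (auto simp: ln_mult)
  also have "fact (2*M) / (fact M * fact M) = real ((2*M) choose M)"
    by (simp add: binomial_fact mult_2)
  also have "ln \<dots> \<le> ln (2 ^ (2*M))"
  proof (subst ln_le_cancel_iff)
    show "real (2*M choose M) \<le> 2 ^ (2*M)"
      using binomial_le_pow2[of "2*M" M] by (metis of_nat_le_iff of_nat_numeral of_nat_power)
  qed (auto)
  also have "\<dots> = 2 * real M * ln 2" by (simp add: ln_realpow)
  finally show ?thesis .
qed

lemma psi_le: "psi N \<le> 4 * real N"
proof (induction N rule: less_induct)
  case (less N)
  show ?case
  proof (cases "N = 0")
    case False
    define M where "M = N div 2"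
    have M: "M < N" using False by (auto simp: M_def)
    have l2: "ln (2::real) \<le> 1" using ln_2_less_1 by simp
    \<comment> \<open>The 2 * M left between this bound and 4 * (2 * M) pays for the extra Mangoldt
      term when N is odd.\<close>
    have 1: "psi (2*M) \<le> 6 * real M"
      using psi_double[of M] less[OF M] mult_left_mono[OF l2, of "2 * real M"] by auto
    show ?thesis
    proof (cases "even N")
      case True
      then have "N = 2 * M" by (auto simp: M_def)
      then show ?thesis using 1 by auto
    next
      case False
      then have N: "N = Suc (2 * M)" by (auto simp: M_def)
      have "psi N = psi (2*M) + mangoldt (Suc (2*M))"
        by (simp add: N psi_def)
      also have "mangoldt (Suc (2*M)) \<le> ln (real (Suc (2*M)))" by (rule mangoldt_le) auto
      also have "\<dots> \<le> 2 * real M" using ln_add_one_self_le_self[of "2 * real M"] by (simp add: add.commute)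
      finally show ?thesis using 1 by (simp add: N)
    qed
  qed (auto simp: psi_def)
qed

text \<open>Replacing \<open>N div d\<close> by N / d in the Mangoldt expansion of ln N! costs at
  most \<open>psi N\<close>, hence at most 4 N. Comparison with ln N! = N ln N + O(N) and division
  by N leave O(1).\<close>

lemma mertens_mangoldt: "\<bar>(\<Sum>n=1..N. mangoldt n / real n) - ln (real N)\<bar> \<le> 4"
proof (cases "N = 0")
  case False
  let ?S = "\<Sum>n=1..N. mangoldt n / real n"
  have "ln (fact N) \<le> (\<Sum>d=1..N. mangoldt d * (real N / real d))"
    unfolding ln_fact_mangoldt
    by (intro sum_mono mult_left_mono mangoldt_nonneg) (simp add: of_nat_div_le_of_nat)
  then have 1: "ln (fact N) \<le> real N * ?S" by (simp add: sum_distrib_left algebra_simps)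
  have "(\<Sum>d=1..N. mangoldt d * (real N / real d) - mangoldt d) \<le> ln (fact N)"
    unfolding ln_fact_mangoldt
  proof (intro sum_mono)
    fix d assume d: "d \<in> {1..N}"
    from mult_left_mono[OF real_div_minus_one_le mangoldt_nonneg[of d]] show "mangoldt d * (real N / real d) - mangoldt d \<le> mangoldt d * real (N div d)"
      by (simp add: algebra_simps)
  qed
  then have 2: "real N * ?S - psi N \<le> ln (fact N)"
    by (simp add: sum_distrib_left algebra_simps sum_subtractf psi_def)
  have "real N * (?S - ln (real N)) \<le> real N * 4"
    using 2 psi_le[of N] ln_fact_le[of N] by (simp add: algebra_simps)
  moreover have "real N * (-4) \<le> real N * (?S - ln (real N))"
    using 1 ln_fact_ge[of N] by (simp add: algebra_simps)
  ultimately have "?S - ln (real N) \<le> 4" "-4 \<le> ?S - ln (real N)"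
    using False by (simp_all only: mult_le_cancel_left_pos of_nat_0_less_iff)
  then show ?thesis by (simp add: abs_le_iff)
qed auto

text \<open>The powers p^(k+2) form a geometric series of size at most 2 ln p / p^2. Then ln n <= 2
  sqrt n makes the sum over n comparable with the differences of 1 / sqrt n, which telescope; 8 is
  the factor of that comparison.\<close>

lemma sum_mangoldt_not_prime_le:
  "(\<Sum>n | n \<in> {1..N} \<and> \<not>prime n. mangoldt n / real n) \<le> 8"
proof -
  define A where "A = {n\<in>{1..N}. \<not>prime n \<and> primepow n}"
  define h :: "nat \<Rightarrow> real" where "h = (\<lambda>p. ln (real p) / real p ^ 2)"
  have sub: "A \<subseteq> (\<lambda>(p,k). p ^ (k+2)) ` ({p. prime p \<and> p \<le> N} \<times> {..<N})"
  proof
    fix n assume n: "n \<in> A"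
    then obtain p k where pk: "prime p" "k > 0" "n = p ^ k" by (auto simp: A_def primepow_def)
    have "k \<noteq> 1" using n pk by (auto simp: A_def)
    then have k2: "Suc (Suc (k - 2)) = k" using pk by simp
    have "p \<le> n" "k < n"
    proof -
      show "p \<le> n" using pk by (metis dvd_power dvd_imp_le zero_less_power prime_gt_0_nat)
      have "k < 2 ^ k" by simp
      also have "\<dots> \<le> p ^ k" using pk prime_ge_2_nat by (intro power_mono) auto
      finally show "k < n" using pk by simp
    qed
    then show "n \<in> (\<lambda>(p,k). p ^ (k+2)) ` ({p. prime p \<and> p \<le> N} \<times> {..<N})"
      using n pk \<open>k \<noteq> 1\<close> k2
      by (intro image_eqI[of _ _ "(p,k-2)"]) (auto simp: A_def simp flip: power_add power_Suc)
  qed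
  have "(\<Sum>n | n \<in> {1..N} \<and> \<not>prime n. mangoldt n / real n) = (\<Sum>n\<in>A. mangoldt n / real n)"
    by (rule sum.mono_neutral_right) (auto simp: A_def mangoldt_def)
  also have "\<dots> \<le> (\<Sum>n\<in>(\<lambda>(p,k). p ^ (k+2)) ` ({p. prime p \<and> p \<le> N} \<times> {..<N}). mangoldt n / real n)"
    by (intro sum_mono2 sub) (auto intro!: divide_nonneg_nonneg mangoldt_nonneg)
  also have "\<dots> \<le> (\<Sum>(p,k)\<in>{p. prime p \<and> p \<le> N} \<times> {..<N}. mangoldt (p ^ (k+2)) / real (p ^ (k+2)))"
    by (rule order.trans[OF sum_image_le]) (auto simp: case_prod_unfold o_def intro!: divide_nonneg_nonneg mangoldt_nonneg)
  also have "\<dots> = (\<Sum>p | prime p \<and> p \<le> N. \<Sum>k<N. ln (real p) / real p ^ 2 * (1 / real p) ^ k)"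
  proof (subst sum.cartesian_product[symmetric], intro sum.cong refl)
    fix p k assume "p \<in> {p. prime p \<and> p \<le> N}"
    then show "mangoldt (p ^ (k + 2)) / real (p ^ (k + 2)) = ln (real p) / real p ^ 2 * (1 / real p) ^ k"
      by (subst mangoldt_primepow) (auto simp: power_add power_divide power2_eq_square)
  qed
  also have "\<dots> \<le> (\<Sum>p | prime p \<and> p \<le> N. ln (real p) / real p ^ 2 * 2)"
  proof (intro sum_mono, unfold sum_distrib_left[symmetric], intro mult_left_mono)
    fix p assume p: "p \<in> {p. prime p \<and> p \<le> N}"
    then have p2: "real p \<ge> 2" using prime_ge_2_nat by force
    have "(\<Sum>k<N. (1 / real p) ^ k) \<le> (\<Sum>k<N. (1 / 2) ^ k)"
      using p2 by (intro sum_mono power_mono) (auto simp: field_simps)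
    also have "\<dots> \<le> 2" by (subst sum_gp_strict) (auto simp: field_simps)
    finally show "(\<Sum>k<N. (1 / real p) ^ k) \<le> 2" .
  qed (auto intro!: divide_nonneg_nonneg ln_ge_zero simp: Suc_le_eq prime_gt_0_nat)
  also have "\<dots> \<le> (\<Sum>n=2..N. ln (real n) / real n ^ 2 * 2)"
    by (intro sum_mono2) (auto dest: prime_ge_2_nat)
  also have "\<dots> \<le> (\<Sum>n=2..N. 8 * (1 / sqrt (real (n - 1)) - 1 / sqrt (real n)))"
  proof (intro sum_mono)
    fix n assume n: "n \<in> {2..N}"
    define s where "s = sqrt (real n)"
    define r where "r = sqrt (real (n - 1))"
    have s: "s > 0" "s ^ 2 = real n" and r: "r > 0" "r ^ 2 = real n - 1" "r \<le> s"
      using n by (auto simp: s_def r_def of_nat_diff)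
    have "ln (real n) = 2 * ln s" using s ln_realpow[of s 2] by simp
    also have "\<dots> \<le> 2 * s" using ln_bound[of s] s by auto
    finally have 1: "ln (real n) / real n ^ 2 * 2 \<le> 4 / s ^ 3"
      using s by (simp add: s(2)[symmetric] field_simps eval_nat_numeral)
    have "(s - r) * (s + r) = 1" using s r by (simp add: algebra_simps power2_eq_square)
    then have "1 \<le> (s - r) * (2 * s)" using r s
      by (metis add_left_mono diff_ge_0_iff_ge mult_2 mult_left_mono)
    then have "4 * r * 1 \<le> 4 * r * ((s - r) * (2 * s))" using r by (intro mult_left_mono) auto
    then have "4 * r \<le> 8 * (s - r) * s * r" by (simp add: mult_ac)
    also have "\<dots> \<le> 8 * (s - r) * s * s" using r s by (intro mult_left_mono) auto
    finally have "4 * r / (r * s ^ 3) \<le> 8 * (s - r) * s * s / (r * s ^ 3)"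
      using s r by (intro divide_right_mono) auto
    then have "4 / s ^ 3 \<le> 8 * (1 / r - 1 / s)"
      using s(1) r(1) by (simp add: diff_frac_eq eval_nat_numeral)
    with 1 show "ln (real n) / real n ^ 2 * 2 \<le> 8 * (1 / sqrt (real (n - 1)) - 1 / sqrt (real n))"
      by (simp add: s_def r_def)
  qed
  also have "\<dots> \<le> 8"
  proof -
    have "(\<Sum>n=2..N. (1 / sqrt (real (n - 1)) - 1 / sqrt (real n))) \<le> 1 - (if N = 0 then 0 else 1 / sqrt (real N))"
      by (induction N) (auto simp: not_less_eq_eq)
    also have "\<dots> \<le> 1" by auto
    finally show ?thesis by (simp only: sum_distrib_left[symmetric])
  qed
  finally show ?thesis .
qed

lemma mertens_primes: "\<bar>(\<Sum>n=1..N. if prime n then ln (real n) / real n else 0) - ln (real N)\<bar> \<le> 12"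
proof -
  have "(\<Sum>n=1..N. mangoldt n / real n) =
      (\<Sum>n=1..N. if prime n then ln (real n) / real n else 0) + (\<Sum>n=1..N. if prime n then 0 else mangoldt n / real n)"
    unfolding sum.distrib[symmetric] by (intro sum.cong) auto
  moreover have "(\<Sum>n=1..N. if prime n then 0 else mangoldt n / real n) = (\<Sum>n | n \<in> {1..N} \<and> \<not>prime n. mangoldt n / real n)"
    by (rule sum.mono_neutral_cong_right) auto
  moreover have "0 \<le> (\<Sum>n | n \<in> {1..N} \<and> \<not>prime n. mangoldt n / real n)"
    by (intro sum_nonneg divide_nonneg_nonneg mangoldt_nonneg) auto
  ultimately show ?thesis using sum_mangoldt_not_prime_le[of N] mertens_mangoldt[of N] by linarith
qed

text \<open>Primes up to sqrt N are counted trivially, and each larger one contributes at least (ln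
  N) / 2 to \<open>psi N\<close>. Together they give 10 N / ln N, doubled because ln (N + 2) <= 2 ln
  N. The shift by 2 keeps the bound meaningful for N = 0 and N = 1.\<close>

lemma card_primes_le: "real (card {p. prime p \<and> p \<le> N}) \<le> 20 * real N / ln (real N + 2)"
proof (cases "N \<ge> 2")
  case True
  define A where "A = {p. prime p \<and> p \<le> N \<and> real p > sqrt (real N)}"
  have fin: "finite {p. prime p \<and> p \<le> N}" by simp
  have lnN: "ln (real N) > 0" using True by simp
  have lnN': "ln (real N) \<le> 2 * sqrt (real N)"
    using ln_bound[of "sqrt (real N)"] True by (simp add: ln_sqrt)
  have "{p. prime p \<and> p \<le> N} \<subseteq> {1..nat \<lfloor>sqrt (real N)\<rfloor>} \<union> A"
    by (auto simp: A_def le_nat_iff le_floor_iff Suc_le_eq prime_gt_0_nat)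
  then have "card {p. prime p \<and> p \<le> N} \<le> card ({1..nat \<lfloor>sqrt (real N)\<rfloor>} \<union> A)"
    by (intro card_mono) (auto simp: A_def)
  also have "\<dots> \<le> nat \<lfloor>sqrt (real N)\<rfloor> + card A"
    using card_Un_le[of "{1..nat \<lfloor>sqrt (real N)\<rfloor>}" A] by simp
  finally have "real (card {p. prime p \<and> p \<le> N}) \<le> real (nat \<lfloor>sqrt (real N)\<rfloor> + card A)"
    by (simp only: of_nat_le_iff)
  then have 1: "real (card {p. prime p \<and> p \<le> N}) \<le> sqrt (real N) + real (card A)"
    using of_int_floor_le[of "sqrt (real N)"] by (simp, linarith)
  have "real (card A) * (ln (real N) / 2) = (\<Sum>p\<in>A. ln (real N) / 2)" by simp
  also have "\<dots> \<le> (\<Sum>p\<in>A. mangoldt p)"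
  proof (intro sum_mono)
    fix p assume p: "p \<in> A"
    have "ln (real N) / 2 = ln (sqrt (real N))" using True by (simp add: ln_sqrt)
    also have "\<dots> \<le> ln (real p)" using p True by (subst ln_le_cancel_iff) (auto simp: A_def prime_gt_0_nat)
    finally show "ln (real N) / 2 \<le> mangoldt p" using p by (simp add: A_def)
  qed
  also have "\<dots> \<le> psi N"
    unfolding psi_def by (intro sum_mono2 mangoldt_nonneg) (auto simp: A_def Suc_le_eq prime_gt_0_nat)
  also have "\<dots> \<le> 4 * real N" by (rule psi_le)
  finally have 2: "real (card A) * ln (real N) \<le> 8 * real N" by simp
  have "sqrt (real N) * ln (real N) \<le> sqrt (real N) * (2 * sqrt (real N))"
    using lnN' by (intro mult_left_mono) auto
  also have "\<dots> = 2 * real N" by simp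
  finally have "sqrt (real N) * ln (real N) \<le> 2 * real N" .
  with 1 2 have "real (card {p. prime p \<and> p \<le> N}) * ln (real N) \<le> 10 * real N"
    using mult_right_mono[OF 1, of "ln (real N)"] lnN by (auto simp: algebra_simps)
  moreover have "ln (real N + 2) \<le> 2 * ln (real N)"
  proof -
    have "real N + 2 \<le> real N * real N" using True mult_right_mono[of 2 "real N" "real N"] by linarith
    then have "ln (real N + 2) \<le> ln (real N * real N)" using True by (subst ln_le_cancel_iff) auto
    then show ?thesis using True by (simp add: ln_mult)
  qed
  ultimately have "real (card {p. prime p \<and> p \<le> N}) * ln (real N + 2) \<le> 20 * real N"
    using mult_left_mono[of "ln (real N + 2)" "2 * ln (real N)" "real (card {p. prime p \<and> p \<le> N})"] by linarith
  then show ?thesis by (simp add: pos_le_divide_eq)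
next
  case False
  then have eq: "{p. prime p \<and> p \<le> N} = {}" by (auto dest: prime_ge_2_nat)
  show ?thesis unfolding eq by simp
qed

section \<open>Partial summation and sums over primes\<close>

lemma abel_summation_bound:
  fixes a :: "nat \<Rightarrow> 'a::real_normed_vector" and f :: "nat \<Rightarrow> real"
  assumes A: "\<And>N. N \<ge> M \<Longrightarrow> norm (\<Sum>n\<in>{M<..N}. a n) \<le> B"
    and decr: "\<And>n. n > M \<Longrightarrow> f (Suc n) \<le> f n" and nonneg: "\<And>n. n > M \<Longrightarrow> f n \<ge> 0"
  shows "norm (\<Sum>n\<in>{M<..N}. f n *\<^sub>R a n) \<le> B * f (Suc M)"
proof (cases "N \<ge> M")
  case True
  define S where "S = (\<lambda>N. \<Sum>n\<in>{M<..N}. a n)"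
  have ins: "{M<..Suc n} = insert (Suc n) {M<..n}" if "n \<ge> M" for n using that by auto
  have eq: "(\<Sum>n\<in>{M<..N}. f n *\<^sub>R a n) = f (Suc N) *\<^sub>R S N + (\<Sum>n\<in>{M<..N}. (f n - f (Suc n)) *\<^sub>R S n)"
    using True
  proof (induction N rule: dec_induct)
    case (step n)
    have "S (Suc n) = S n + a (Suc n)" using step by (simp add: S_def ins)
    then show ?case using step by (simp add: ins algebra_simps)
  qed (auto simp: S_def)
  have "norm (\<Sum>n\<in>{M<..N}. f n *\<^sub>R a n) \<le> norm (f (Suc N) *\<^sub>R S N) + (\<Sum>n\<in>{M<..N}. norm ((f n - f (Suc n)) *\<^sub>R S n))"
    unfolding eq by (intro order.trans[OF norm_triangle_ineq] add_left_mono norm_sum)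
  also have "\<dots> \<le> f (Suc N) * B + (\<Sum>n\<in>{M<..N}. (f n - f (Suc n)) * B)"
    using A decr nonneg True by (intro add_mono sum_mono) (auto simp: S_def intro!: mult_left_mono)
  also have "\<dots> = B * f (Suc M)" using True
    by (induction N rule: dec_induct) (auto simp: ins algebra_simps)
  finally show ?thesis .
next
  case False
  have "0 \<le> B" using A[of M] by simp
  then show ?thesis using False nonneg[of "Suc M"] by simp
qed

lemma sum_div_ln_bound:
  fixes a :: "nat \<Rightarrow> real"
  assumes K: "\<And>N. \<bar>\<Sum>n=1..N. a n\<bar> \<le> K" and M: "M \<ge> 2"
  shows "\<bar>\<Sum>n\<in>{M<..N}. a n / ln (real n)\<bar> \<le> 2 * K / ln (real M)"
proof -
  have "norm (\<Sum>n\<in>{M<..N}. (1 / ln (real n)) *\<^sub>R a n) \<le> (2 * K) * (1 / ln (real (Suc M)))"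
  proof (rule abel_summation_bound)
    fix N assume "M \<le> N"
    then have "{1..N} = {1..M} \<union> {M<..N}" by auto
    then have "(\<Sum>n=1..N. a n) = (\<Sum>n=1..M. a n) + (\<Sum>n\<in>{M<..N}. a n)"
      by (simp only:) (subst sum.union_disjoint, auto)
    then show "norm (\<Sum>n\<in>{M<..N}. a n) \<le> 2 * K" using K[of N] K[of M] by auto
  qed (use M in \<open>auto intro!: divide_left_mono mult_pos_pos\<close>)
  also have "\<dots> \<le> (2 * K) * (1 / ln (real M))"
    using M K[of 0] by (intro mult_left_mono divide_left_mono mult_pos_pos) auto
  finally show ?thesis by simp
qed

text \<open>By Mertens, ln p / p on the primes is modelled by ln n - ln (n - 1) with bounded error
  sums. After division by ln n the model is at most ln ln n - ln ln (n - 1) and telescopes. The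
  constant is 2 * 12 / (1/2), where 1/2 bounds ln y from below.\<close>

lemma sum_inverse_primes_le:
  assumes y: "2 \<le> y" "y \<le> x"
  shows "(\<Sum>p | prime p \<and> y < p \<and> p \<le> x. 1 / real p) \<le> ln (ln (real x)) - ln (ln (real y)) + 48"
proof -
  define a where "a = (\<lambda>n. (if prime n then ln (real n) / real n else 0) - (ln (real n) - ln (real (n - 1))))"
  \<comment> \<open>The term n = 1 involves \<open>ln 0\<close>, which is 0, so the telescope is
    exact.\<close>
  have "(\<Sum>n=1..N. ln (real n) - ln (real (n - 1))) = ln (real N)" for N
    by (induction N) auto
  then have K: "\<bar>\<Sum>n=1..N. a n\<bar> \<le> 12" for N
    using mertens_primes[of N] by (simp add: a_def sum_subtractf)
  have ln2: "ln (real y) \<ge> 1/2"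
    using y ln2_ge_half ln_le_cancel_iff[of 2 "real y"] by linarith
  have "(\<Sum>n\<in>{y<..x}. a n / ln (real n)) \<le> 2 * 12 / ln (real y)"
    using sum_div_ln_bound[OF K y(1), of x] by linarith
  also have "\<dots> \<le> 48" using ln2 by (simp add: field_simps)
  finally have 1: "(\<Sum>n\<in>{y<..x}. a n / ln (real n)) \<le> 48" .
  have "(\<Sum>p | prime p \<and> y < p \<and> p \<le> x. 1 / real p) = (\<Sum>n\<in>{y<..x}. if prime n then 1 / real n else 0)"
    by (rule sum.mono_neutral_cong_left) auto
  also have "\<dots> = (\<Sum>n\<in>{y<..x}. a n / ln (real n)) + (\<Sum>n\<in>{y<..x}. (ln (real n) - ln (real (n - 1))) / ln (real n))"
    unfolding sum.distrib[symmetric] using y by (intro sum.cong) (auto simp: a_def field_simps)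
  also have "(\<Sum>n\<in>{y<..x}. (ln (real n) - ln (real (n - 1))) / ln (real n)) \<le> (\<Sum>n\<in>{y<..x}. ln (ln (real n)) - ln (ln (real (n - 1))))"
  proof (intro sum_mono)
    fix n assume n: "n \<in> {y<..x}"
    then have pos: "ln (real n) > 0" "ln (real (n - 1)) > 0" using y by auto
    have "ln (ln (real (n - 1)) / ln (real n)) \<le> ln (real (n - 1)) / ln (real n) - 1"
      using pos by (intro ln_le_minus_one) auto
    then show "(ln (real n) - ln (real (n - 1))) / ln (real n) \<le> ln (ln (real n)) - ln (ln (real (n - 1)))"
      using pos by (simp add: ln_div diff_divide_distrib)
  qed
  also have "\<dots> = ln (ln (real x)) - ln (ln (real y))"
    using y(2)
  proof (induction x rule: dec_induct)
    case (step n)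
    then have "{y<..Suc n} = insert (Suc n) {y<..n}" by auto
    then show ?case using step by simp
  qed auto
  finally show ?thesis using 1 by simp
qed

text \<open>With ln X = k ln 2 the blocks contribute about 1 / k^2, whose tail is of order 1 / k:
  the second logarithm is what makes the dyadic sum converge. The induction passes from X to 2 X,
  towards n.\<close>

lemma sum_div_ln_dyadic_le:
  fixes a :: "nat \<Rightarrow> real"
  assumes block: "\<And>X. X \<ge> Y \<Longrightarrow> (\<Sum>t\<in>{X..<2*X}. a t) \<le> B / ln (real X)"
    and nonneg: "\<And>t. a t \<ge> 0" and Y: "Y \<ge> 2"
  shows "(\<Sum>t\<in>{Y..<n}. a t / ln (real t)) \<le> 4 * B / ln (real Y)"
proof -
  have B: "B \<ge> 0"
  proof -
    have "0 \<le> B / ln (real Y)" using block[of Y] sum_nonneg[of "{Y..<2*Y}" a] nonneg by fastforce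
    then show ?thesis using Y by (simp add: zero_le_divide_iff)
  qed
  have "(\<Sum>t\<in>{X..<n}. a t / ln (real t)) \<le> 4 * B / ln (real X)" if "X \<ge> Y" for X
    using that
  proof (induction "n - X" arbitrary: X rule: less_induct)
    case less
    show ?case
    proof (cases "X < n")
      case False
      then show ?thesis using B less.prems Y by auto
    next
      case True
      have X: "X \<ge> 2" using less Y by simp
      define v where "v = ln (real X)"
      define l where "l = ln (2::real)"
      have l: "l \<ge> 1/2" unfolding l_def by (rule ln2_ge_half)
      have v: "v \<ge> l" unfolding v_def l_def using X by simp
      have "(\<Sum>t\<in>{X..<n}. a t / ln (real t)) \<le> (\<Sum>t\<in>{X..<2*X} \<union> {2*X..<n}. a t / ln (real t))"
        using X by (intro sum_mono2) (auto intro!: divide_nonneg_nonneg nonneg)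
      also have "\<dots> = (\<Sum>t\<in>{X..<2*X}. a t / ln (real t)) + (\<Sum>t\<in>{2*X..<n}. a t / ln (real t))"
        by (rule sum.union_disjoint) auto
      also have "(\<Sum>t\<in>{2*X..<n}. a t / ln (real t)) \<le> 4 * B / ln (real (2 * X))"
        using less.prems X True by (intro less.hyps) auto
      also have "ln (real (2 * X)) = v + l" using X by (simp add: v_def l_def ln_mult)
      also have "(\<Sum>t\<in>{X..<2*X}. a t / ln (real t)) \<le> (\<Sum>t\<in>{X..<2*X}. a t / v)"
        using X unfolding v_def by (intro sum_mono divide_left_mono nonneg mult_pos_pos) auto
      also have "\<dots> \<le> B / v / v"
        unfolding sum_divide_distrib[symmetric] using block[OF less.prems] v l
        by (intro divide_right_mono) (auto simp: v_def)
      \<comment> \<open>The induction closes if v + l <= 4 l v, which holds since both ln X and ln 2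
        are at least 1/2.\<close>
      also have "B / v / v + 4 * B / (v + l) \<le> 4 * B / v"
      proof -
        have "v + l \<le> 4 * (l * v)" using mult_right_mono[of "1/2" l v] l v by linarith
        then have "B * (v + l) \<le> B * (4 * (l * v))" using B by (rule mult_left_mono)
        then have "B / (v * v) \<le> B * (4 * l) / (v * (v + l))"
          using l v by (simp add: divide_simps)
        also have "\<dots> = 4 * B / v - 4 * B / (v + l)" using l v by (simp add: field_simps)
        finally show ?thesis by simp
      qed
      finally show ?thesis by (simp add: v_def)
    qed
  qed
  then show ?thesis by simp
qed

text \<open>A stand-in for ln ln N that is at least 1 and increasing for N >= 1, so that higher
  powers only weaken a bound and \<open>lam (N div p)\<close> can be replaced by
  \<open>lam N\<close>.\<close>

definition lam :: "nat \<Rightarrow> real" where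
  "lam N = 1 + ln (ln (real N + 2))"

lemma ln_add_2_gt_1: "ln (real N + 2) > 1" if "N \<ge> 1"
proof -
  have "exp (1::real) < 3" using e_less_272 by simp
  also have "3 \<le> real N + 2" using that by simp
  finally have "ln (exp 1) < ln (real N + 2)" by (subst ln_less_cancel_iff) auto
  then show ?thesis by simp
qed

lemma lam_ge_1: "N \<ge> 1 \<Longrightarrow> lam N \<ge> 1"
  using ln_add_2_gt_1[of N] by (simp add: lam_def)

lemma lam_mono: "M \<ge> 1 \<Longrightarrow> M \<le> N \<Longrightarrow> lam M \<le> lam N"
  using ln_add_2_gt_1[of M] ln_add_2_gt_1[of N] by (simp add: lam_def)

text \<open>This is the price of stripping a prime. If \<open>N div p\<close> is about 2^j, then p
  is at most N / 2^j, and Chebyshev leaves O(N / 2^j / (J - j + 1)) such primes, each with a term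
  O(2^j / (j + 1)). The powers of 2 cancel, and partial fractions turn the rest into 1 / ln N times
  harmonic sums of length about ln N, hence one factor ln ln N.\<close>

lemma sum_primes_div_ln_le:
  "(\<Sum>p | prime p \<and> p \<le> N. real (N div p) / ln (real (N div p) + 2)) \<le> 3840 * (real N * lam N / ln (real N + 2))"
proof (cases "N \<ge> 1")
  case True
  define J where "J = floor_log N"
  have J: "2 ^ J \<le> N" "N < 2 * 2 ^ J" unfolding J_def
    using floor_log_exp2_le[of N] floor_log_exp2_gt[of N] True by auto
  define P where "P = {p. prime p \<and> p \<le> N}"
  define g where "g = (\<lambda>p. floor_log (N div p))"
  have g: "2 ^ g p \<le> N div p \<and> N div p < 2 * 2 ^ g p" if "p \<in> P" for p
    using that floor_log_exp2_le[of "N div p"] floor_log_exp2_gt[of "N div p"]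
    by (auto simp: g_def P_def div_greater_zero_iff prime_gt_0_nat)
  have gJ: "g ` P \<subseteq> {..J}"
    by (auto simp: g_def J_def intro!: floor_log_le_iff)
  have lnpow: "real (j + 1) / 4 \<le> ln (real m + 2)" if "2 ^ j \<le> m" for j m :: nat
  proof -
    have l: "ln (2::real) \<ge> 1/2" by (rule ln2_ge_half)
    have "real j * ln 2 = ln (2 ^ j)" by (simp add: ln_realpow)
    also have "\<dots> \<le> ln (real m + 2)"
      using that by (subst ln_le_cancel_iff) (auto simp: add_pos_nonneg intro: order.trans[of _ "real m"] simp flip: of_nat_le_iff)
    finally have 1: "real j * ln 2 \<le> ln (real m + 2)" .
    have 2: "ln 2 \<le> ln (real m + 2)" by (subst ln_le_cancel_iff) auto
    have "real (j + 1) / 4 \<le> (real j * ln 2 + ln 2) / 2"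
      using mult_left_mono[OF l, of "real j + 1"] by (simp add: algebra_simps)
    also have "\<dots> \<le> ln (real m + 2)" using add_mono[OF 1 2] by simp
    finally show ?thesis .
  qed
  have lnN: "ln (real N + 2) \<le> real (J + 2)"
  proof -
    have "real N + 2 \<le> real (2 ^ (J + 2))"
    proof -
      have "(1::nat) \<le> 2 ^ J" by simp
      then have "N + 2 \<le> 2 ^ (J + 2)" using J(2) by simp
      then have "real (N + 2) \<le> real (2 ^ (J + 2))" by (simp only: of_nat_le_iff)
      then show ?thesis by simp
    qed
    then have "ln (real N + 2) \<le> ln (2 ^ (J + 2))" by (subst ln_le_cancel_iff) auto
    also have "\<dots> = real (J + 2) * ln 2" by (rule ln_realpow)
    also have "\<dots> \<le> real (J + 2) * 1" using ln_2_less_1 by (intro mult_left_mono) auto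
    finally show ?thesis by simp
  qed
  have harm: "(\<Sum>j\<le>J. 1 / real (j + 1)) \<le> 3 * lam N"
  proof -
    have "(\<Sum>j\<le>J. 1 / real (j + 1)) \<le> 1 + ln (real (J + 1))"
    proof (induction J)
      case (Suc J)
      have "ln (real (J + 1) / real (J + 2)) \<le> real (J + 1) / real (J + 2) - 1"
        by (intro ln_le_minus_one) auto
      also have "\<dots> = - 1 / real (J + 2)" by (simp add: field_simps)
      finally show ?case using Suc by (simp add: ln_div add.commute)
    qed auto
    also have "1 + ln (real (J + 1)) \<le> 1 + ln (4 * ln (real N + 2))"
      using lnpow[OF J(1)] by (intro add_left_mono, subst ln_le_cancel_iff) auto
    also have "\<dots> = 1 + (ln 4 + ln (ln (real N + 2)))" using ln_add_2_gt_1[OF True] by (subst ln_mult) auto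
    also have "ln 4 = 2 * ln (2::real)" using ln_realpow[of 2 2] by simp
    finally have "(\<Sum>j\<le>J. 1 / real (j + 1)) \<le> 1 + (2 * ln 2 + ln (ln (real N + 2)))" .
    moreover have "0 \<le> ln (ln (real N + 2))" using ln_add_2_gt_1[OF True] by simp
    moreover have "S \<le> 3 * (1 + L)" if "S \<le> 1 + (2 * c + L)" "0 \<le> L" "c < 1" for S L c :: real
      using that by argo
    ultimately show ?thesis using ln_2_less_1 unfolding lam_def by blast
  qed
  have "(\<Sum>p\<in>P. real (N div p) / ln (real (N div p) + 2)) =
        (\<Sum>j\<le>J. \<Sum>p | p \<in> P \<and> g p = j. real (N div p) / ln (real (N div p) + 2))"
    using gJ by (subst sum.group) (auto simp: P_def)
  also have "\<dots> \<le> (\<Sum>j\<le>J. 640 * real N / (real (j + 1) * real (J - j + 1)))"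
  proof (intro sum_mono)
    fix j assume j: "j \<in> {..J}"
    have "(\<Sum>p | p \<in> P \<and> g p = j. real (N div p) / ln (real (N div p) + 2)) \<le> (\<Sum>p | p \<in> P \<and> g p = j. 8 * 2 ^ j / real (j + 1))"
    proof (intro sum_mono)
      fix p assume p: "p \<in> {p \<in> P. g p = j}"
      have "real (N div p) \<le> real (2 * 2 ^ j)" using g[of p] p by (subst of_nat_le_iff) auto
      moreover have "real (j + 1) / 4 \<le> ln (real (N div p) + 2)" using g[of p] p by (intro lnpow) auto
      ultimately have "real (N div p) / ln (real (N div p) + 2) \<le> real (2 * 2 ^ j) / (real (j + 1) / 4)"
        by (intro frac_le) auto
      then show "real (N div p) / ln (real (N div p) + 2) \<le> 8 * 2 ^ j / real (j + 1)" by simp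
    qed
    also have "\<dots> = real (card {p\<in>P. g p = j}) * (8 * 2 ^ j / real (j + 1))" by simp
    also have "real (card {p\<in>P. g p = j}) * (8 * 2 ^ j / real (j + 1)) \<le> 80 * (real N / 2 ^ j) / real (J - j + 1) * (8 * 2 ^ j / real (j + 1))"
    proof (intro mult_right_mono)
      have "{p\<in>P. g p = j} \<subseteq> {p. prime p \<and> p \<le> N div 2 ^ j}"
      proof safe
        fix p assume p: "p \<in> P"
        have "p * 2 ^ g p \<le> p * (N div p)" using g[OF p] by simp
        also have "\<dots> \<le> N" by simp
        finally show "p \<le> N div 2 ^ g p" by (simp add: less_eq_div_iff_mult_less_eq)
      qed (auto simp: P_def)
      then have "real (card {p\<in>P. g p = j}) \<le> real (card {p. prime p \<and> p \<le> N div 2 ^ j})"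
        by (subst of_nat_le_iff, intro card_mono) auto
      also have "\<dots> \<le> 20 * real (N div 2 ^ j) / ln (real (N div 2 ^ j) + 2)" by (rule card_primes_le)
      also have "\<dots> \<le> 20 * (real N / 2 ^ j) / (real (J - j + 1) / 4)"
      proof (intro frac_le mult_left_mono)
        show "real (N div 2 ^ j) \<le> real N / 2 ^ j" using of_nat_div_le_of_nat[of N "2 ^ j", where ?'a = real] by simp
        have "2 ^ (J - j) * 2 ^ j \<le> N" using J(1) j by (simp flip: power_add)
        then have "2 ^ (J - j) \<le> N div 2 ^ j" by (simp add: less_eq_div_iff_mult_less_eq)
        then show "real (J - j + 1) / 4 \<le> ln (real (N div 2 ^ j) + 2)" by (rule lnpow)
      qed auto
      finally show "real (card {p\<in>P. g p = j}) \<le> 80 * (real N / 2 ^ j) / real (J - j + 1)" by simp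
    qed simp
    also have "80 * (real N / 2 ^ j) / real (J - j + 1) * (8 * 2 ^ j / real (j + 1)) = 640 * real N / (real (j + 1) * real (J - j + 1))"
      by simp
    finally show "(\<Sum>p | p \<in> P \<and> g p = j. real (N div p) / ln (real (N div p) + 2)) \<le> 640 * real N / (real (j + 1) * real (J - j + 1))" .
  qed
  also have "\<dots> = (\<Sum>j\<le>J. 640 * real N / real (J + 2) * (1 / real (j + 1) + 1 / real (J - j + 1)))"
  proof (intro sum.cong refl)
    fix j assume j: "j \<in> {..J}"
    have "real (J + 2) = real (j+1) + real (J-j+1)" using j by (simp add: of_nat_diff)
    moreover have "M / (x*y) = M / (x+y) * (1/x + 1/y)" if "x>0" "y>0" for M x y :: real
      using that by (simp add: divide_simps)
    ultimately show "640 * real N / (real (j + 1) * real (J - j + 1)) =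
        640 * real N / real (J + 2) * (1 / real (j + 1) + 1 / real (J - j + 1))"
      by (simp only:)
  qed
  also have "\<dots> = 640 * real N / real (J + 2) * ((\<Sum>j\<le>J. 1 / real (j + 1)) + (\<Sum>j\<le>J. 1 / real (J - j + 1)))"
    by (simp only: sum_distrib_left[symmetric] sum.distrib distrib_left)
  also have "(\<Sum>j\<le>J. 1 / real (J - j + 1)) = (\<Sum>j\<le>J. 1 / real (j + 1))"
    by (rule sum.reindex_bij_witness[where i = "\<lambda>j. J - j" and j = "\<lambda>j. J - j"]) auto
  also have "640 * real N / real (J + 2) * ((\<Sum>j\<le>J. 1 / real (j + 1)) + (\<Sum>j\<le>J. 1 / real (j + 1)))
     \<le> 640 * real N / ln (real N + 2) * (3 * lam N + 3 * lam N)"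
  proof (intro mult_mono divide_left_mono add_mono harm)
    show "ln (real N + 2) \<le> real (J + 2)" by (rule lnN)
    show "0 < real (J + 2) * ln (real N + 2)" "0 \<le> 640 * real N / ln (real N + 2)"
      using ln_add_2_gt_1[OF True] by auto
    show "0 \<le> (\<Sum>j\<le>J. 1 / real (j + 1)) + (\<Sum>j\<le>J. 1 / real (j + 1))"
      by (intro add_nonneg_nonneg sum_nonneg) auto
  qed auto
  also have "\<dots> = 3840 * (real N * lam N / ln (real N + 2))" by simp
  finally show ?thesis unfolding P_def .
next
  case False
  then have eq: "{p. prime p \<and> p \<le> N} = {}" by (auto dest: prime_gt_0_nat)
  from False have "N = 0" by simp
  then show ?thesis unfolding eq by simp
qed

section \<open>Moebius sums over divisors\<close>

lemma sum_Pow_insert: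
  assumes "finite A" "p \<notin> A"
  shows "(\<Sum>T\<in>Pow (insert p A). f T) = (\<Sum>T\<in>Pow A. f T) + (\<Sum>T\<in>Pow A. f (insert p T))"
proof -
  have "inj_on (insert p) (Pow A)" using assms(2) by (auto simp: inj_on_def)
  then show ?thesis unfolding Pow_insert
    using assms by (subst sum.union_disjoint) (auto simp: sum.reindex)
qed

text \<open>Pairing T with \<open>insert p T\<close> replaces f by a finite difference. If f is a
  polynomial in \<open>card T\<close>, each further element lowers its degree by one, which is the
  cause of the later collapses.\<close>

lemma sum_alternating_insert:
  fixes f :: "'b set \<Rightarrow> 'a::comm_ring_1"
  assumes "finite A" "p \<notin> A"
  shows "(\<Sum>T\<in>Pow (insert p A). (-1) ^ card T * f T) = (\<Sum>T\<in>Pow A. (-1) ^ card T * (f T - f (insert p T)))"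
proof -
  have "(\<Sum>T\<in>Pow A. (-1) ^ card (insert p T) * f (insert p T)) = (\<Sum>T\<in>Pow A. - ((-1) ^ card T * f (insert p T)))"
  proof (intro sum.cong refl)
    fix T assume "T \<in> Pow A"
    then have "finite T" "p \<notin> T" using assms by (auto intro: finite_subset)
    then show "(-1) ^ card (insert p T) * f (insert p T) = - ((-1) ^ card T * f (insert p T))" by simp
  qed
  then show ?thesis
    by (simp add: sum_Pow_insert[OF assms] sum_negf right_diff_distrib sum_subtractf)
qed

lemma sum_alternating:
  assumes "finite A"
  shows "(\<Sum>T\<in>Pow A. (-1) ^ card T) = (if A = {} then 1 else (0::'a::comm_ring_1))"
proof (cases "A = {}")
  case False
  then obtain p B where "A = insert p B" "p \<notin> B" "finite B" using assms by (metis finite.cases finite_insert insert_absorb mk_disjoint_insert)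
  then show ?thesis using sum_alternating_insert[of B p "\<lambda>_. 1 :: 'a"] by simp
qed auto

lemma prod_prime_factors_squarefree:
  assumes "squarefree (n::nat)"
  shows "\<Prod>(prime_factors n) = n"
proof -
  have n: "n > 0" using assms by (auto intro: Nat.gr0I)
  have "n = (\<Prod>p\<in>prime_factors n. p ^ multiplicity p n)" using n by (simp add: prime_factorization_nat)
  also have "\<dots> = (\<Prod>p\<in>prime_factors n. p)"
  proof (intro prod.cong refl)
    fix p assume "p \<in> prime_factors n"
    then have "multiplicity p n = 1"
      using assms n by (auto simp: squarefree_factorial_semiring'' prime_factors_multiplicity le_Suc_eq)
    then show "p ^ multiplicity p n = p" by simp
  qed
  finally show ?thesis by simp
qed

lemma
  assumes "T \<subseteq> prime_factors (n::nat)"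
  shows prime_factors_prod_primes: "prime_factors (\<Prod>T) = T"
    and squarefree_prod_primes: "squarefree (\<Prod>T)"
    and prod_primes_dvd: "\<Prod>T dvd n"
proof -
  have fin: "finite T" using assms by (rule finite_subset) simp
  have pr: "prime p" if "p \<in> T" for p using that assms by auto
  show "prime_factors (\<Prod>T) = T"
    using fin pr by (subst prime_factors_prod) (auto simp: prime_prime_factors dest: prime_gt_0_nat)
  show "squarefree (\<Prod>T)"
    using pr by (intro squarefree_prod_coprime) (auto simp: primes_coprime squarefree_prime)
  show "\<Prod>T dvd n"
  proof (cases "n = 0")
    case False
    have "\<Prod>T dvd \<Prod>(prime_factors n)" using assms by (intro prod_dvd_prod_subset) auto
    also have "\<dots> dvd (\<Prod>p\<in>prime_factors n. p ^ multiplicity p n)"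
      by (intro prod_dvd_prod) (auto simp: prime_factors_multiplicity)
    also have "\<dots> = n" using False by (simp add: prime_factorization_nat[symmetric])
    finally show ?thesis .
  qed auto
qed

text \<open>Only squarefree divisors count, and these correspond to the sets of primes of n. All
  Moebius identities below become alternating sums over subsets in this way.\<close>

lemma sum_moebius_divisors:
  fixes h :: "nat \<Rightarrow> 'a::comm_ring_1"
  assumes n: "n > 0"
  shows "(\<Sum>d | d dvd n. of_int (moebius_mu d) * h d) = (\<Sum>T\<in>Pow (prime_factors n). (-1) ^ card T * h (\<Prod>T))"
proof -
  have "(\<Sum>d | d dvd n. of_int (moebius_mu d) * h d) = (\<Sum>d | d dvd n \<and> squarefree d. of_int (moebius_mu d) * h d)"
    using n by (intro sum.mono_neutral_right) (auto simp: moebius_mu_def)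
  also have "\<dots> = (\<Sum>T\<in>Pow (prime_factors n). (-1) ^ card T * h (\<Prod>T))"
  proof (rule sum.reindex_bij_witness[where i = "\<lambda>T. \<Prod>T" and j = prime_factors], goal_cases)
    case (2 d)
    then show ?case using n by (auto intro: dvd_prime_factors[THEN subsetD])
  qed (use n in \<open>auto simp: prod_prime_factors_squarefree prime_factors_prod_primes squarefree_prod_primes
           prod_primes_dvd moebius_mu_def omega_def\<close>)
  finally show ?thesis .
qed

lemma sum_moebius:
  assumes "n > 0"
  shows "(\<Sum>d | d dvd n. of_int (moebius_mu d)) = (if n = 1 then 1 else (0::'a::comm_ring_1))"
  using sum_moebius_divisors[OF assms, of "\<lambda>_. 1 :: 'a"] assms
  by (simp add: sum_alternating prime_factorization_empty_iff)

lemma mangoldt_prime_factors: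
  assumes n: "n > 0"
  shows "mangoldt n = (if is_singleton (prime_factors n) then ln (real (the_elem (prime_factors n))) else 0)"
proof (cases "primepow n")
  case True
  then obtain p k where pk: "prime p" "k > 0" "n = p ^ k" by (auto simp: primepow_def)
  then have "prime_factors n = {p}" by (simp add: prime_factors_power prime_prime_factors)
  then show ?thesis using pk by (simp add: is_singleton_def)
next
  case False
  have "\<not>is_singleton (prime_factors n)"
  proof
    assume "is_singleton (prime_factors n)"
    then obtain p where p: "prime_factors n = {p}" by (auto simp: is_singleton_def)
    have "n = (\<Prod>p\<in>prime_factors n. p ^ multiplicity p n)" using n by (simp add: prime_factorization_nat)
    then have "n = p ^ multiplicity p n" by (simp add: p)
    moreover have "prime p" "multiplicity p n > 0" using p by (auto simp: prime_factors_multiplicity set_eq_iff)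
    ultimately show False using False by (metis primepow_prime_power)
  qed
  then show ?thesis using False by (simp add: mangoldt_def)
qed

text \<open>Adding p to T changes ln of the product by the constant ln p, so pairing leaves - ln p
  times an alternating sum over the subsets of the other primes. It vanishes unless p is the only
  prime of n.\<close>

lemma sum_moebius_ln:
  assumes n: "n > 0"
  shows "(\<Sum>d | d dvd n. of_int (moebius_mu d) * ln (real d)) = - mangoldt n"
proof -
  have "(\<Sum>d | d dvd n. of_int (moebius_mu d) * ln (real d)) = (\<Sum>T\<in>Pow (prime_factors n). (-1) ^ card T * ln (real (\<Prod>T)))"
    by (rule sum_moebius_divisors[OF n])
  also have "\<dots> = - mangoldt n"
  proof (cases "prime_factors n = {}")
    case True
    then show ?thesis using n by (simp add: mangoldt_prime_factors is_singleton_def)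
  next
    case False
    then obtain p B where B: "prime_factors n = insert p B" "p \<notin> B" "finite B"
      by (metis finite_set_mset finite.cases finite_insert insert_absorb mk_disjoint_insert)
    have "ln (real (\<Prod>T)) - ln (real (\<Prod>(insert p T))) = - ln (real p)" if "T \<in> Pow B" for T
    proof -
      have T: "T \<subseteq> prime_factors n" "p \<notin> T" "finite T" "prime p" using that B by (auto intro: finite_subset)
      have "\<Prod>T > 0" proof (intro prod_pos)
        fix q assume "q \<in> T"
        then have "prime q" using T(1) by auto
        then show "0 < q" by (rule prime_gt_0_nat)
      qed
      moreover have "0 \<notin> T" using T(1) by auto
      ultimately show ?thesis using T by (simp add: ln_mult prime_gt_0_nat)
    qed
    then have "(\<Sum>T\<in>Pow (prime_factors n). (-1) ^ card T * ln (real (\<Prod>T))) = (\<Sum>T\<in>Pow B. (-1) ^ card T * - ln (real p))"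
      unfolding B(1) by (subst sum_alternating_insert) (use B in \<open>auto intro!: sum.cong\<close>)
    also have "\<dots> = (\<Sum>T\<in>Pow B. (-1) ^ card T) * - ln (real p)" by (simp only: sum_distrib_right)
    also have "\<dots> = - mangoldt n"
      using B by (auto simp: sum_alternating mangoldt_prime_factors[OF n] is_singleton_def)
    finally show ?thesis .
  qed
  finally show ?thesis .
qed

section \<open>Dirichlet characters\<close>

text \<open>Characters live on nat instead of the unit group, extended by 0. The support condition
  excludes the zero function and forces the value 1 at 1.\<close>

definition dcharacter :: "nat \<Rightarrow> (nat \<Rightarrow> complex) \<Rightarrow> bool" where
  "dcharacter l \<xi> \<longleftrightarrow> (\<forall>m n. \<xi> (m * n) = \<xi> m * \<xi> n) \<and> (\<forall>m n. [m = n] (mod l) \<longrightarrow> \<xi> m = \<xi> n) \<and>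
     (\<forall>n. \<xi> n \<noteq> 0 \<longleftrightarrow> coprime n l)"

definition principal_character :: "nat \<Rightarrow> nat \<Rightarrow> complex" where
  "principal_character l n = (if coprime n l then 1 else 0)"

text \<open>
  Characters arise as joint eigenfunctions of the maps \<open>f \<mapsto> f (g * _)\<close>. Averaging over the powers of
  \<open>g\<close> against roots of unity writes \<open>f\<close> as a sum of eigenfunctions for \<open>g\<close>, one of which must still
  separate \<open>a\<close> from \<open>1\<close>.
\<close>
lemma ex_joint_eigenfunction:
  assumes "finite S" and "\<And>g. g \<in> S \<Longrightarrow> coprime g l" and l: "l > 0" and a: "\<not> [a = 1] (mod l)"
  shows "\<exists>f::nat \<Rightarrow> complex. (\<forall>m n. [m = n] (mod l) \<longrightarrow> f m = f n) \<and> (\<forall>n. f n \<noteq> 0 \<longrightarrow> coprime n l) \<and>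
           f a \<noteq> f 1 \<and> (\<forall>g\<in>S. \<exists>z. \<forall>n. f (g * n) = z * f n)"
  using assms(1,2)
proof (induction S)
  case empty
  \<comment> \<open>Before any map is diagonalised, the indicator of the residue class of 1
    separates a from 1.\<close>
  let ?f = "\<lambda>n. if [n = 1] (mod l) then 1 else (0::complex)"
  have "coprime n l" if "[n = 1] (mod l)" for n
    using that cong_imp_coprime[OF cong_sym[OF that]] by simp
  moreover have "?f m = ?f n" if "[m = n] (mod l)" for m n
    using that by (auto intro: cong_trans cong_sym)
  ultimately show ?case using a by (intro exI[of _ ?f]) (auto split: if_splits)
next
  case (insert g S)
  from insert.IH[OF insert.prems[OF insertI2]] obtain f :: "nat \<Rightarrow> complex" where f:
      "\<forall>m n. [m = n] (mod l) \<longrightarrow> f m = f n" "\<forall>n. f n \<noteq> 0 \<longrightarrow> coprime n l" "f a \<noteq> f 1"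
      "\<forall>h\<in>S. \<exists>z. \<forall>n. f (h * n) = z * f n" by blast
  note per = f(1)[rule_format] and supp = f(2)[rule_format] and fa = f(3) and eig = f(4)[rule_format]
  have g: "coprime g l" using insert by auto
  \<comment> \<open>By Euler's theorem the k-th power of g acts trivially, so k-th roots of unity
    suffice as eigenvalues.\<close>
  define k where "k = totient l"
  have k: "k > 0" using l by (simp add: k_def)
  have gk: "f (g ^ k * n) = f n" for n
    using cong_mult[OF euler_theorem[OF g] cong_refl[of n]] by (intro per) (simp add: k_def)
  define x where "x = (\<lambda>i::nat. cis (2 * pi * real i / real k))"
  have xk: "x i ^ k = 1" for i
  proof -
    have "x i ^ k = cis (2 * pi * real i)" using k by (simp add: x_def Complex.DeMoivre)
    also have "\<dots> = 1" by (rule cis_multiple_2pi) auto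
    finally show ?thesis .
  qed
  have x0: "x i \<noteq> 0" for i by (simp add: x_def)
  have inj: "inj_on x {..<k}"
    using Complex.bij_betw_roots_unity[OF k] by (simp add: bij_betw_def x_def)
  have xsum: "(\<Sum>i<k. x i ^ s) = (if s = 0 then of_nat k else 0)" if "s < k" for s
  proof (cases "s = 0")
    case False
    have "x s \<noteq> x 0" using inj_onD[OF inj, of s 0] that False k by auto
    then have "x s \<noteq> 1" by (simp add: x_def)
    have "(\<Sum>i<k. x i ^ s) = (\<Sum>i<k. x s ^ i)"
      by (intro sum.cong) (auto simp: x_def Complex.DeMoivre mult_ac)
    also have "\<dots> = (x s ^ k - 1) / (x s - 1)" using \<open>x s \<noteq> 1\<close> by (rule geometric_sum)
    finally show ?thesis using False xk by simp
  qed auto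
  define F where "F = (\<lambda>i n. \<Sum>s<k. x i ^ s * f (g ^ s * n))"
  have Fsum: "(\<Sum>i<k. F i n) = of_nat k * f n" for n
  proof -
    have "(\<Sum>i<k. F i n) = (\<Sum>s<k. (\<Sum>i<k. x i ^ s) * f (g ^ s * n))"
      unfolding F_def by (subst sum.swap) (simp add: sum_distrib_right)
    also have "\<dots> = (\<Sum>s<k. if s = 0 then of_nat k * f n else 0)"
      by (intro sum.cong) (auto simp: xsum)
    finally show ?thesis using k by simp
  qed
  have "\<exists>i<k. F i a \<noteq> F i 1"
  proof (rule ccontr)
    assume "\<not>?thesis"
    then have "(\<Sum>i<k. F i a) = (\<Sum>i<k. F i 1)" by (intro sum.cong) auto
    then show False using fa k by (simp add: Fsum)
  qed
  then obtain i where i: "F i a \<noteq> F i 1" by auto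
  have "F i m = F i n" if "[m = n] (mod l)" for m n
    unfolding F_def using that by (intro sum.cong refl arg_cong2[where f = "(*)"] per cong_mult) auto
  moreover have "coprime n l" if "F i n \<noteq> 0" for n
  proof -
    from that obtain s where "f (g ^ s * n) \<noteq> 0" unfolding F_def by (metis (no_types, lifting) mult_zero_right sum.neutral)
    then show ?thesis using supp by fastforce
  qed
  moreover have "\<exists>z. \<forall>n. F i (h * n) = z * F i n" if "h \<in> insert g S" for h
  proof (cases "h = g")
    case True
    have "x i * F i (g * n) = F i n" for n
    proof -
      let ?t = "\<lambda>s. x i ^ s * f (g ^ s * n)"
      have "x i * F i (g * n) = (\<Sum>s<k. ?t (Suc s))"
        unfolding F_def sum_distrib_left by (intro sum.cong) (auto simp: mult_ac)
      also have "\<dots> = (\<Sum>s<Suc k. ?t s) - ?t 0"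
        by (subst sum.lessThan_Suc_shift) simp
      also have "\<dots> = (\<Sum>s<k. ?t s)" by (simp add: xk gk)
      finally show ?thesis by (simp add: F_def)
    qed
    then have "\<forall>n. F i (h * n) = inverse (x i) * F i n" using True x0 by (auto simp: field_simps)
    then show ?thesis by blast
  next
    case False
    with that obtain z where z: "\<And>n. f (h * n) = z * f n" using eig by auto
    have "f (g ^ s * (h * n)) = z * f (g ^ s * n)" for s n
      using z[of "g ^ s * n"] by (simp add: mult_ac)
    then have "\<forall>n. F i (h * n) = z * F i n" by (auto simp: F_def sum_distrib_left mult_ac intro!: sum.cong)
    then show ?thesis by blast
  qed
  ultimately show ?case using i by (intro exI[of _ "F i"]) auto
qed

text \<open>For a joint eigenfunction f of all units the eigenvalue of g is f g / f 1, so f / f 1 is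
  multiplicative. If f 1 were 0, then f a, being a multiple of it, could not differ from f
  1.\<close>

lemma ex_dcharacter_neq_1:
  assumes l: "l > 0" and a: "coprime a l" "\<not> [a = 1] (mod l)"
  shows "\<exists>\<xi>. dcharacter l \<xi> \<and> \<xi> a \<noteq> 1"
proof -
  define S where "S = {g. g < l \<and> coprime g l}"
  have "finite S" by (simp add: S_def)
  then obtain f :: "nat \<Rightarrow> complex" where f:
      "\<forall>m n. [m = n] (mod l) \<longrightarrow> f m = f n" "\<forall>n. f n \<noteq> 0 \<longrightarrow> coprime n l" "f a \<noteq> f 1"
      "\<forall>h\<in>S. \<exists>z. \<forall>n. f (h * n) = z * f n"
    using ex_joint_eigenfunction[OF _ _ l a(2), of S] unfolding S_def by blast
  note per = f(1)[rule_format] and supp = f(2)[rule_format] and fa = f(3) and eig = f(4)[rule_format]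
  have ex: "\<exists>z. \<forall>n. f (g * n) = z * f n" if "coprime g l" for g
  proof -
    have "g mod l \<in> S" using that l by (auto simp: S_def)
    from eig[OF this] obtain z where "\<And>n. f (g mod l * n) = z * f n" by auto
    moreover have "f (g mod l * n) = f (g * n)" for n
      by (intro per cong_mult) (auto simp: Cong.cong_def)
    ultimately show ?thesis by auto
  qed
  have mult: "f (g * n) * f 1 = f g * f n" if "coprime g l" for g n
  proof -
    from ex[OF that] obtain z where z: "\<And>n. f (g * n) = z * f n" by auto
    show ?thesis using z[of n] z[of 1] by simp
  qed
  have f1: "f 1 \<noteq> 0"
  proof
    assume f1: "f 1 = 0"
    from ex[OF a(1)] obtain z where "\<And>n. f (a * n) = z * f n" by auto
    from this[of 1] f1 fa show False by simp
  qed
  have nz: "f n \<noteq> 0 \<longleftrightarrow> coprime n l" for n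
  proof
    assume n: "coprime n l"
    then obtain m where "[n * m = 1] (mod l)" using cong_solve_coprime_nat by (metis One_nat_def)
    then have "f (n * m) = f 1" by (rule per)
    then show "f n \<noteq> 0" using mult[OF n, of m] f1 by auto
  qed (rule supp)
  define \<xi> where "\<xi> = (\<lambda>n. f n / f 1)"
  have "\<xi> (m * n) = \<xi> m * \<xi> n" for m n
  proof (cases "coprime m l")
    case True
    then show ?thesis using mult[OF True, of n] f1 by (simp add: \<xi>_def field_simps)
  next
    case False
    then have "f m = 0" "f (m * n) = 0" using nz[of m] nz[of "m * n"] by auto
    then show ?thesis by (simp add: \<xi>_def)
  qed
  moreover have "\<xi> m = \<xi> n" if "[m = n] (mod l)" for m n using per[OF that] by (simp add: \<xi>_def)
  moreover have "\<xi> n \<noteq> 0 \<longleftrightarrow> coprime n l" for n using nz[of n] f1 by (simp add: \<xi>_def)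
  ultimately have "dcharacter l \<xi>" unfolding dcharacter_def by blast
  moreover have "\<xi> a \<noteq> 1" using fa f1 by (simp add: \<xi>_def)
  ultimately show ?thesis by blast
qed

lemma dcharacter_mult: "dcharacter l \<xi> \<Longrightarrow> \<xi> (m * n) = \<xi> m * \<xi> n"
  and dcharacter_cong: "dcharacter l \<xi> \<Longrightarrow> [m = n] (mod l) \<Longrightarrow> \<xi> m = \<xi> n"
  and dcharacter_eq_0_iff: "dcharacter l \<xi> \<Longrightarrow> \<xi> n = 0 \<longleftrightarrow> \<not>coprime n l"
  by (auto simp: dcharacter_def)

lemma dcharacter_1: "dcharacter l \<xi> \<Longrightarrow> \<xi> 1 = 1"
  using dcharacter_mult[of l \<xi> 1 1] dcharacter_eq_0_iff[of l \<xi> 1] by simp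

lemma dcharacter_power: "dcharacter l \<xi> \<Longrightarrow> \<xi> (n ^ k) = \<xi> n ^ k"
  by (induction k) (use dcharacter_1 in \<open>auto simp: dcharacter_mult\<close>)

lemma dcharacter_root:
  assumes "dcharacter l \<xi>" "coprime n l"
  shows "\<xi> n ^ totient l = 1"
  using dcharacter_cong[OF assms(1) euler_theorem[OF assms(2)]] assms(1)
  by (simp add: dcharacter_power dcharacter_1[simplified])

lemma norm_dcharacter_le_1:
  assumes "l > 0" "dcharacter l \<xi>"
  shows "norm (\<xi> n) \<le> 1"
proof (cases "coprime n l")
  case True
  from dcharacter_root[OF assms(2) this] have "norm (\<xi> n) = 1 \<or> totient l = 0" by (rule power_eq_1_iff)
  then show ?thesis using assms(1) by simp
qed (use dcharacter_eq_0_iff[OF assms(2), of n] in auto)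

lemma dcharacter_principal: "dcharacter l (principal_character l)"
  by (auto simp: dcharacter_def principal_character_def dest: cong_imp_coprime cong_sym)

lemma finite_dcharacters:
  assumes "l > 0"
  shows "finite {\<xi>. dcharacter l \<xi>}"
proof -
  let ?E = "PiE {..<l} (\<lambda>_. insert 0 {z::complex. z ^ totient l = 1})"
  have "{\<xi>. dcharacter l \<xi>} \<subseteq> (\<lambda>f n. f (n mod l)) ` ?E"
  proof safe
    fix \<xi> assume c: "dcharacter l \<xi>"
    show "\<xi> \<in> (\<lambda>f n. f (n mod l)) ` ?E"
    proof (rule image_eqI)
      show "\<xi> = (\<lambda>n. restrict \<xi> {..<l} (n mod l))"
        using assms by (auto intro!: dcharacter_cong[OF c] simp: Cong.cong_def)
      show "restrict \<xi> {..<l} \<in> ?E"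
        using dcharacter_root[OF c] dcharacter_eq_0_iff[OF c] by auto
    qed
  qed
  moreover have "finite ?E" using assms by (intro finite_PiE) (auto intro!: finite_roots_unity simp: Suc_le_eq)
  ultimately show ?thesis by (blast intro: finite_subset)
qed

text \<open>Multiplication by a character that is not 1 at a permutes the characters; it multiplies
  the sum by that value and yet leaves it unchanged.\<close>

lemma sum_dcharacters:
  assumes l: "l > 0" and a: "coprime a l"
  shows "(\<Sum>\<xi> | dcharacter l \<xi>. \<xi> a) = (if [a = 1] (mod l) then of_nat (card {\<xi>. dcharacter l \<xi>}) else 0)"
proof (cases "[a = 1] (mod l)")
  case True
  then have "\<xi> a = 1" if "dcharacter l \<xi>" for \<xi>
    using dcharacter_cong[OF that True] dcharacter_1[OF that] by simp
  then have "(\<Sum>\<xi> | dcharacter l \<xi>. \<xi> a) = (\<Sum>\<xi> | dcharacter l \<xi>. 1)" by (intro sum.cong) auto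
  then show ?thesis using True by simp
next
  case False
  from ex_dcharacter_neq_1[OF l a False] obtain \<psi> where psi: "dcharacter l \<psi>" "\<psi> a \<noteq> 1" by auto
  let ?X = "{\<xi>. dcharacter l \<xi>}"
  have "inj_on (\<lambda>\<xi> n. \<psi> n * \<xi> n) ?X"
  proof (rule inj_onI, rule ext)
    fix \<xi> \<xi>' n assume *: "\<xi> \<in> ?X" "\<xi>' \<in> ?X" "(\<lambda>n. \<psi> n * \<xi> n) = (\<lambda>n. \<psi> n * \<xi>' n)"
    from fun_cong[OF *(3), of n] show "\<xi> n = \<xi>' n"
      using *(1,2) psi(1) dcharacter_eq_0_iff[of l \<xi> n] dcharacter_eq_0_iff[of l \<xi>' n] dcharacter_eq_0_iff[of l \<psi> n]
      by (cases "coprime n l") auto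
  qed
  moreover have sub: "(\<lambda>\<xi> n. \<psi> n * \<xi> n) ` ?X \<subseteq> ?X"
    using psi(1) by (auto simp: dcharacter_def)
  ultimately have bij: "bij_betw (\<lambda>\<xi> n. \<psi> n * \<xi> n) ?X ?X"
    using endo_inj_surj[OF finite_dcharacters[OF l] sub] by (simp add: bij_betw_def)
  have "(\<Sum>\<xi>\<in>?X. \<xi> a) = (\<Sum>\<xi>\<in>?X. \<psi> a * \<xi> a)"
    using sum.reindex_bij_betw[OF bij, of "\<lambda>\<xi>. \<xi> a"] by simp
  also have "\<dots> = \<psi> a * (\<Sum>\<xi>\<in>?X. \<xi> a)" by (rule sum_distrib_left[symmetric])
  finally have "(1 - \<psi> a) * (\<Sum>\<xi>\<in>?X. \<xi> a) = 0" by (simp add: left_diff_distrib)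
  then show ?thesis using psi False by simp
qed

context
  fixes l :: nat and \<xi> :: "nat \<Rightarrow> complex"
  assumes l: "l > 0" and chi: "dcharacter l \<xi>" and nonprincipal: "\<xi> \<noteq> principal_character l"
begin

lemma sum_dcharacter_period: "(\<Sum>n<l. \<xi> n) = 0"
proof -
  obtain a where a: "coprime a l" "\<xi> a \<noteq> 1"
    using nonprincipal chi by (auto simp: fun_eq_iff principal_character_def dcharacter_eq_0_iff split: if_splits)
  have inj: "inj_on (\<lambda>n. a * n mod l) {..<l}"
  proof (rule inj_onI)
    fix x y assume *: "x \<in> {..<l}" "y \<in> {..<l}" "a * x mod l = a * y mod l"
    then have "[a * x = a * y] (mod l)" by (simp add: Cong.cong_def)
    then have "[x = y] (mod l)" using a by (simp add: cong_mult_lcancel_nat)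
    then show "x = y" using * by (auto intro: cong_less_modulus_unique_nat)
  qed
  have sub: "(\<lambda>n. a * n mod l) ` {..<l} \<subseteq> {..<l}" using l by auto
  have bij: "bij_betw (\<lambda>n. a * n mod l) {..<l} {..<l}"
    using endo_inj_surj[OF _ sub inj] inj by (simp add: bij_betw_def)
  have "(\<Sum>n<l. \<xi> n) = (\<Sum>n<l. \<xi> (a * n mod l))"
    by (rule sum.reindex_bij_betw[OF bij, symmetric])
  also have "\<dots> = (\<Sum>n<l. \<xi> a * \<xi> n)"
  proof (intro sum.cong refl)
    fix n
    have "\<xi> (a * n mod l) = \<xi> (a * n)" by (rule dcharacter_cong[OF chi]) (simp add: Cong.cong_def)
    then show "\<xi> (a * n mod l) = \<xi> a * \<xi> n" using dcharacter_mult[OF chi] by simp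
  qed
  also have "\<dots> = \<xi> a * (\<Sum>n<l. \<xi> n)" by (rule sum_distrib_left[symmetric])
  finally have "(1 - \<xi> a) * (\<Sum>n<l. \<xi> n) = 0" by (simp add: left_diff_distrib)
  then show ?thesis using a by simp
qed

lemma norm_sum_dcharacter_less: "norm (\<Sum>n<N. \<xi> n) \<le> real l"
proof (induction N rule: less_induct)
  case (less N)
  show ?case
  proof (cases "N < l")
    case True
    have "norm (\<Sum>n<N. \<xi> n) \<le> (\<Sum>n<N. 1)"
      by (intro order.trans[OF norm_sum] sum_mono norm_dcharacter_le_1[OF l chi])
    then show ?thesis using True by simp
  next
    case False
    then obtain M where M: "N = l + M" using le_iff_add by (auto simp: not_less)
    have "(\<Sum>n<l+M. \<xi> n) = (\<Sum>n<l. \<xi> n) + (\<Sum>n<M. \<xi> n)"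
      by (induction M) (auto intro!: dcharacter_cong[OF chi] simp: Cong.cong_def)
    then show ?thesis using less[of M] M l by (simp add: sum_dcharacter_period)
  qed
qed

lemma norm_sum_dcharacter: "norm (\<Sum>n\<in>{M<..N}. \<xi> n) \<le> 2 * real l"
proof (cases "M \<le> N")
  case True
  then have eq: "{..<Suc N} = {..<Suc M} \<union> {M<..N}" by auto
  have "(\<Sum>n<Suc N. \<xi> n) = (\<Sum>n<Suc M. \<xi> n) + (\<Sum>n\<in>{M<..N}. \<xi> n)"
    unfolding eq by (rule sum.union_disjoint) auto
  then have "norm (\<Sum>n\<in>{M<..N}. \<xi> n) \<le> norm (\<Sum>n<Suc N. \<xi> n) + norm (\<Sum>n<Suc M. \<xi> n)"
    by (metis add_diff_cancel_left' norm_triangle_ineq4)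
  then show ?thesis using norm_sum_dcharacter_less[of "Suc N"] norm_sum_dcharacter_less[of "Suc M"] by linarith
qed auto

lemma norm_sum_dcharacter_weighted:
  assumes "\<And>n. n > M \<Longrightarrow> f (Suc n) \<le> f n" "\<And>n. n > M \<Longrightarrow> (f n :: real) \<ge> 0"
  shows "norm (\<Sum>n\<in>{M<..N}. f n *\<^sub>R \<xi> n) \<le> 2 * real l * f (Suc M)"
  by (rule abel_summation_bound) (use assms norm_sum_dcharacter in auto)

lemma norm_sum_dcharacter_div: "norm (\<Sum>n\<in>{M<..N}. \<xi> n / of_nat n) \<le> 2 * real l / real (Suc M)"
proof -
  have "norm (\<Sum>n\<in>{M<..N}. (1 / real n) *\<^sub>R \<xi> n) \<le> 2 * real l * (1 / real (Suc M))"
    by (rule norm_sum_dcharacter_weighted) (auto simp: frac_le)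
  then show ?thesis by (simp add: scaleR_conv_of_real)
qed

text \<open>L is the value L(1, xi). It comes with its rate of convergence, since later partial sums
  up to \<open>N div d\<close> are replaced by L and the error must be summed over d.\<close>

lemma ex_L_value: "\<exists>L. \<forall>N. norm ((\<Sum>n=1..N. \<xi> n / of_nat n) - L) \<le> 2 * real l / real (Suc N)"
proof -
  define X where "X = (\<lambda>N. \<Sum>n=1..N. \<xi> n / of_nat n)"
  have diff: "norm (X N - X M) \<le> 2 * real l / real (Suc M)" if "M \<le> N" for M N
  proof -
    have eq: "{1..N} = {1..M} \<union> {M<..N}" using that by auto
    have "X N = X M + (\<Sum>n\<in>{M<..N}. \<xi> n / of_nat n)"
      unfolding X_def eq by (rule sum.union_disjoint) auto
    then show ?thesis using norm_sum_dcharacter_div[of M N] by simp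
  qed
  have "Cauchy X"
  proof (rule CauchyI')
    fix e :: real assume e: "e > 0"
    obtain M where M: "2 * real l / e < real M" using reals_Archimedean2 by blast
    have "norm (X m - X n) < e" if "m \<ge> M" "n > m" for m n
    proof -
      have "norm (X m - X n) \<le> 2 * real l / real (Suc m)" using diff[of m n] that by (simp add: norm_minus_commute)
      also have "\<dots> < e" using M that(1) e by (simp add: field_simps) (smt (verit) mult_left_mono of_nat_le_iff)
      finally show ?thesis .
    qed
    then show "\<exists>M. \<forall>m\<ge>M. \<forall>n>m. dist (X m) (X n) < e" unfolding dist_norm by blast
  qed
  then obtain L where L: "X \<longlonglongrightarrow> L" using Cauchy_convergent convergent_def by blast
  have "norm (X M - L) \<le> 2 * real l / real (Suc M)" for M
  proof (rule tendsto_upperbound)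
    show "((\<lambda>N. norm (X M - X N)) \<longlongrightarrow> norm (X M - L)) sequentially" by (intro tendsto_intros L)
    show "eventually (\<lambda>N. norm (X M - X N) \<le> 2 * real l / real (Suc M)) sequentially"
      using eventually_ge_at_top[of M] by eventually_elim (subst norm_minus_commute, rule diff)
  qed auto
  then show ?thesis by (auto simp: X_def)
qed

lemma sum_dcharacter_ln_bounded: "\<exists>K. \<forall>N. norm (\<Sum>n=1..N. \<xi> n * of_real (ln (real n) / real n)) \<le> K"
proof (intro exI allI)
  fix N :: nat
  let ?f = "\<lambda>n. \<xi> n * of_real (ln (real n) / real n)"
  \<comment> \<open>The function ln t / t decreases only from e on, and e <= 3; the terms up to 3
    are bounded separately.\<close>
  have h1: "norm (\<Sum>n\<in>{3<..N}. ?f n) \<le> 2 * real l * (ln (real (Suc 3)) / real (Suc 3))"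
  proof -
    have e: "exp (1::real) \<le> 3" using exp_le by simp
    have "norm (\<Sum>n\<in>{3<..N}. (ln (real n) / real n) *\<^sub>R \<xi> n) \<le> 2 * real l * (ln (real (Suc 3)) / real (Suc 3))"
    proof (rule norm_sum_dcharacter_weighted)
      fix n :: nat assume "n > 3"
      then show "ln (real (Suc n)) / real (Suc n) \<le> ln (real n) / real n"
        using e by (intro ln_x_over_x_mono) auto
    qed auto
    then show ?thesis by (simp add: scaleR_conv_of_real mult.commute)
  qed
  have h2: "norm (\<Sum>n\<in>{1..N} \<inter> {..3}. ?f n) \<le> (\<Sum>n\<in>{1..3}. norm (?f n))"
    by (rule order.trans[OF norm_sum]) (intro sum_mono2, auto)
  have h3: "(\<Sum>n=1..N. ?f n) = (\<Sum>n\<in>{1..N} \<inter> {..3}. ?f n) + (\<Sum>n\<in>{3<..N}. ?f n)"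
  proof -
    have eq: "{1..N} = ({1..N} \<inter> {..3}) \<union> {3<..N}" by auto
    show ?thesis by (subst eq, rule sum.union_disjoint) auto
  qed
  show "norm (\<Sum>n=1..N. ?f n) \<le> (\<Sum>n\<in>{1..3}. norm (?f n)) + 2 * real l * (ln (real (Suc 3)) / real (Suc 3))"
    unfolding h3 by (intro norm_triangle_le add_mono h1 h2)
qed

context
  fixes L assumes L: "\<And>N. norm ((\<Sum>n=1..N. \<xi> n / of_nat n) - L) \<le> 2 * real l / real (Suc N)"
begin

text \<open>Because d * (N div d + 1) exceeds N, the error of the partial sum up to
  \<open>N div d\<close>, weighted by 1 / d, is O(1 / N) uniformly in d. Summed against
  \<open>mangoldt\<close> it becomes O(psi N / N) = O(1).\<close>

lemma div_Suc_div_le: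
  assumes "d \<in> {1..N}"
  shows "1 / real d * (2 * real l / real (Suc (N div d))) \<le> 2 * real l / real N"
proof -
  have "N < d * Suc (N div d)" using assms by (simp add: dividend_less_times_div)
  then have "real N \<le> real d * real (Suc (N div d))" by (metis less_imp_le of_nat_le_iff of_nat_mult)
  then have "2 * real l / (real d * real (Suc (N div d))) \<le> 2 * real l / real N"
    using assms by (intro divide_left_mono) auto
  then show ?thesis by simp
qed

text \<open>With ln written as a divisor sum of \<open>mangoldt\<close>, the bounded sum of xi(n) ln
  n / n turns into the sum of xi(d) mangoldt(d) / d times partial sums of L(1, xi), which are close
  to L. The factor \<open>norm L\<close> stays on the left, so that L = 0 is covered; dividing by it
  is the point where non-vanishing enters.\<close>

lemma sum_dcharacter_mangoldt_bounded:
  "\<exists>K. \<forall>N. norm L * norm (\<Sum>n=1..N. \<xi> n * of_real (mangoldt n / real n)) \<le> K"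
proof -
  obtain K where K: "\<And>N. norm (\<Sum>n=1..N. \<xi> n * of_real (ln (real n) / real n)) \<le> K"
    using sum_dcharacter_ln_bounded by blast
  have "norm L * norm (\<Sum>n=1..N. \<xi> n * of_real (mangoldt n / real n)) \<le> K + 8 * real l" for N
  proof -
    let ?g = "\<lambda>d. \<xi> d * of_real (mangoldt d / real d)"
    let ?S = "\<lambda>M. \<Sum>m=1..M. \<xi> m / of_nat m"
    have "(\<Sum>n=1..N. \<xi> n * of_real (ln (real n) / real n)) = (\<Sum>n=1..N. \<Sum>d | d dvd n. ?g d * (\<xi> (n div d) / of_nat (n div d)))"
    proof (intro sum.cong refl)
      fix n assume n: "n \<in> {1..N}"
      have "(\<Sum>d | d dvd n. ?g d * (\<xi> (n div d) / of_nat (n div d))) = (\<Sum>d | d dvd n. \<xi> n / of_nat n * mangoldt d)"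
      proof (intro sum.cong refl)
        fix d assume "d \<in> {d. d dvd n}"
        then obtain m where m: "n = d * m" by auto
        then have "d \<noteq> 0" using n by auto
        then show "?g d * (\<xi> (n div d) / of_nat (n div d)) = \<xi> n / of_nat n * mangoldt d"
          using m dcharacter_mult[OF chi, of d m] by simp
      qed
      also have "\<dots> = \<xi> n / of_nat n * of_real (ln (real n))"
        using n by (simp only: sum_distrib_left[symmetric], subst mangoldt_sum) auto
      finally show "\<xi> n * of_real (ln (real n) / real n) = (\<Sum>d | d dvd n. ?g d * (\<xi> (n div d) / of_nat (n div d)))"
        by simp
    qed
    also have "\<dots> = (\<Sum>d=1..N. ?g d * ?S (N div d))"
      unfolding sum_distrib_left by (rule sum_divisors_swap)
    finally have eq: "(\<Sum>n=1..N. \<xi> n * of_real (ln (real n) / real n)) = (\<Sum>d=1..N. ?g d * ?S (N div d))" .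
    have "L * (\<Sum>n=1..N. ?g n) = (\<Sum>d=1..N. ?g d * ?S (N div d)) - (\<Sum>d=1..N. ?g d * (?S (N div d) - L))"
      by (simp add: sum_subtractf[symmetric] sum_distrib_left algebra_simps)
    then have "norm (L * (\<Sum>n=1..N. ?g n)) \<le> norm (\<Sum>d=1..N. ?g d * ?S (N div d)) + norm (\<Sum>d=1..N. ?g d * (?S (N div d) - L))"
      by (simp only: norm_triangle_ineq4)
    also have "norm (\<Sum>d=1..N. ?g d * ?S (N div d)) \<le> K" using K[of N] by (simp only: eq)
    also have "norm (\<Sum>d=1..N. ?g d * (?S (N div d) - L)) \<le> (\<Sum>d=1..N. mangoldt d * (2 * real l / real N))"
    proof (intro order.trans[OF norm_sum] sum_mono)
      fix d assume d: "d \<in> {1..N}"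
      have "norm (?g d * (?S (N div d) - L)) = norm (\<xi> d) * (mangoldt d / real d) * norm (?S (N div d) - L)"
        by (simp add: norm_mult norm_divide)
      also have "\<dots> \<le> 1 * (mangoldt d / real d) * (2 * real l / real (Suc (N div d)))"
        using norm_dcharacter_le_1[OF l chi, of d] L[of "N div d"]
        by (intro mult_mono) (auto intro!: mult_nonneg_nonneg divide_nonneg_nonneg mangoldt_nonneg)
      also have "\<dots> = mangoldt d * (1 / real d * (2 * real l / real (Suc (N div d))))" by simp
      also have "\<dots> \<le> mangoldt d * (2 * real l / real N)"
        using d by (intro mult_left_mono div_Suc_div_le mangoldt_nonneg)
      finally show "norm (?g d * (?S (N div d) - L)) \<le> mangoldt d * (2 * real l / real N)" .
    qed
    also have "(\<Sum>d=1..N. mangoldt d * (2 * real l / real N)) = psi N * (2 * real l / real N)"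
      by (simp only: psi_def sum_distrib_right)
    also have "\<dots> \<le> 4 * real N * (2 * real l / real N)"
      by (intro mult_right_mono psi_le) auto
    also have "\<dots> \<le> 8 * real l" by simp
    finally show ?thesis by (simp add: norm_mult)
  qed
  then show ?thesis by blast
qed

text \<open>
  Rests on the identity \<open>\<Sum>d|n. \<mu>(d) ln (N/d) = \<Lambda>(n) + [n = 1] ln N\<close>.
\<close>
lemma sum_dcharacter_mangoldt_zero:
  assumes "L = 0" "N \<ge> 1"
  shows "norm ((\<Sum>n=1..N. \<xi> n * of_real (mangoldt n / real n)) + of_real (ln (real N))) \<le> 2 * real l"
proof -
  let ?g = "\<lambda>d. \<xi> d * of_real (moebius_mu d * (ln (real N) - ln (real d)) / real d)"
  let ?S = "\<lambda>M. \<Sum>m=1..M. \<xi> m / of_nat m"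
  have "(\<Sum>n=1..N. \<xi> n * of_real (mangoldt n / real n)) + of_real (ln (real N)) =
      (\<Sum>n=1..N. \<xi> n * of_real (mangoldt n / real n) + (if n = 1 then of_real (ln (real N)) else 0))"
    using assms(2) by (simp add: sum.distrib)
  also have "\<dots> = (\<Sum>n=1..N. \<Sum>d | d dvd n. ?g d * (\<xi> (n div d) / of_nat (n div d)))"
  proof (intro sum.cong refl)
    fix n assume n: "n \<in> {1..N}"
    have "(\<Sum>d | d dvd n. ?g d * (\<xi> (n div d) / of_nat (n div d))) =
      (\<Sum>d | d dvd n. \<xi> n / of_nat n * of_real (of_int (moebius_mu d) * ln (real N) - of_int (moebius_mu d) * ln (real d)))"
    proof (intro sum.cong refl)
      fix d assume "d \<in> {d. d dvd n}"
      then obtain m where m: "n = d * m" by auto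
      then have "d \<noteq> 0" "m \<noteq> 0" using n by auto
      then show "?g d * (\<xi> (n div d) / of_nat (n div d)) = \<xi> n / of_nat n * of_real (of_int (moebius_mu d) * ln (real N) - of_int (moebius_mu d) * ln (real d))"
        using m dcharacter_mult[OF chi, of d m] by (simp add: field_simps)
    qed
    also have "\<dots> = \<xi> n / of_nat n * of_real ((\<Sum>d | d dvd n. of_int (moebius_mu d)) * ln (real N) - (\<Sum>d | d dvd n. of_int (moebius_mu d) * ln (real d)))"
      by (simp only: sum_distrib_left[symmetric] of_real_sum[symmetric] sum_subtractf sum_distrib_right[symmetric])
    also have "\<dots> = \<xi> n * of_real (mangoldt n / real n) + (if n = 1 then of_real (ln (real N)) else 0)"
      using n dcharacter_1[OF chi] by (simp add: sum_moebius sum_moebius_ln)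
    finally show "\<xi> n * of_real (mangoldt n / real n) + (if n = 1 then of_real (ln (real N)) else 0) = (\<Sum>d | d dvd n. ?g d * (\<xi> (n div d) / of_nat (n div d)))"
      by simp
  qed
  also have "\<dots> = (\<Sum>d=1..N. ?g d * ?S (N div d))"
    unfolding sum_distrib_left by (rule sum_divisors_swap)
  also have "norm \<dots> \<le> (\<Sum>d=1..N. (ln (real N) - ln (real d)) * (2 * real l / real N))"
  proof (intro order.trans[OF norm_sum] sum_mono)
    fix d assume d: "d \<in> {1..N}"
    have ln: "ln (real d) \<le> ln (real N)" using d by auto
    have mu: "\<bar>of_int (moebius_mu d)\<bar> \<le> (1::real)" by (simp add: moebius_mu_def)
    have "norm (?g d * ?S (N div d)) = norm (\<xi> d) * (\<bar>of_int (moebius_mu d)\<bar> * ((ln (real N) - ln (real d)) / real d)) * norm (?S (N div d))"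
      using ln by (simp add: norm_mult norm_divide del: of_real_diff)
    also have "\<dots> \<le> 1 * (1 * ((ln (real N) - ln (real d)) / real d)) * (2 * real l / real (Suc (N div d)))"
      using norm_dcharacter_le_1[OF l chi, of d] L[of "N div d"] assms(1) ln mu
      by (intro mult_mono) (auto intro!: mult_nonneg_nonneg divide_nonneg_nonneg)
    also have "\<dots> = (ln (real N) - ln (real d)) * (1 / real d * (2 * real l / real (Suc (N div d))))" by simp
    also have "\<dots> \<le> (ln (real N) - ln (real d)) * (2 * real l / real N)"
      using d ln by (intro mult_left_mono div_Suc_div_le) auto
    finally show "norm (?g d * ?S (N div d)) \<le> (ln (real N) - ln (real d)) * (2 * real l / real N)" .
  qed
  \<comment> \<open>The weights ln N - ln d add up to at most N by the lower bound for ln N!, which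
    cancels the 1 / N of the error terms.\<close>
  also have "\<dots> = (real N * ln (real N) - ln (fact N)) * (2 * real l / real N)"
    by (subst sum_distrib_right[symmetric]) (simp add: sum_subtractf ln_fact_eq_sum)
  also have "\<dots> \<le> real N * (2 * real l / real N)"
    using ln_fact_ge[of N] by (intro mult_right_mono) auto
  also have "\<dots> = 2 * real l" using assms by simp
  finally show ?thesis .
qed

end

end

section \<open>Non-vanishing at 1 and Mertens in residue classes\<close>

text \<open>By orthogonality only n congruent to 1 survive, each with the number of characters as a
  factor, and \<open>mangoldt\<close> is nonnegative.\<close>

lemma sum_dcharacters_mangoldt_nonneg:
  assumes l: "l > 0"
  shows "0 \<le> (\<Sum>\<xi> | dcharacter l \<xi>. Re (\<Sum>n=1..N. \<xi> n * of_real (mangoldt n / real n)))"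
proof -
  have "(\<Sum>\<xi> | dcharacter l \<xi>. \<Sum>n=1..N. \<xi> n * of_real (mangoldt n / real n)) =
        (\<Sum>n=1..N. (\<Sum>\<xi> | dcharacter l \<xi>. \<xi> n) * of_real (mangoldt n / real n))"
    by (subst sum.swap) (simp only: sum_distrib_right)
  also have "Re \<dots> = (\<Sum>n=1..N. Re (\<Sum>\<xi> | dcharacter l \<xi>. \<xi> n) * (mangoldt n / real n))"
    by (simp del: of_real_divide)
  also have "\<dots> \<ge> 0"
  proof (intro sum_nonneg mult_nonneg_nonneg divide_nonneg_nonneg mangoldt_nonneg)
    fix n
    show "0 \<le> Re (\<Sum>\<xi> | dcharacter l \<xi>. \<xi> n)"
    proof (cases "coprime n l")
      case True
      show ?thesis unfolding sum_dcharacters[OF l True] by simp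
    next
      case False
      then have "(\<Sum>\<xi> | dcharacter l \<xi>. \<xi> n) = 0"
        by (intro sum.neutral) (simp add: dcharacter_eq_0_iff)
      then show ?thesis by simp
    qed
  qed auto
  finally show ?thesis by simp
qed

text \<open>Expresses L(1, xi) = 0 through the error bound for the partial sums with limit 0, so
  that no limit has to be named.\<close>

definition L_vanishes :: "nat \<Rightarrow> (nat \<Rightarrow> complex) \<Rightarrow> bool" where
  "L_vanishes l \<xi> \<longleftrightarrow> (\<forall>N. norm (\<Sum>n=1..N. \<xi> n / of_nat n) \<le> 2 * real l / real (Suc N))"

lemma sum_dcharacter_mangoldt_bounded':
  assumes "l > 0" "dcharacter l \<xi>" "\<xi> \<noteq> principal_character l" "\<not>L_vanishes l \<xi>"
  shows "\<exists>K. \<forall>N. norm (\<Sum>n=1..N. \<xi> n * of_real (mangoldt n / real n)) \<le> K"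
proof -
  from ex_L_value[OF assms(1-3)] obtain L where
    L: "\<And>N. norm ((\<Sum>n=1..N. \<xi> n / of_nat n) - L) \<le> 2 * real l / real (Suc N)" by blast
  have "L \<noteq> 0"
  proof
    assume "L = 0"
    then show False using L assms(4) by (simp add: L_vanishes_def)
  qed
  from sum_dcharacter_mangoldt_bounded[OF assms(1-3) L] obtain K where
    K: "\<And>N. norm L * norm (\<Sum>n=1..N. \<xi> n * of_real (mangoldt n / real n)) \<le> K" by blast
  have "norm (\<Sum>n=1..N. \<xi> n * of_real (mangoldt n / real n)) \<le> K / norm L" for N
    using K[of N] \<open>L \<noteq> 0\<close> by (subst pos_le_divide_eq) (auto simp: mult.commute)
  then show ?thesis by blast
qed

text \<open>Summed over all characters, the sums of xi(n) mangoldt(n) / n have nonnegative real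
  part. The principal character contributes at most ln N + 4, each vanishing one at most - ln N +
  O(1), the others O(1); two vanishing characters would leave - ln N + O(1).\<close>

lemma L_vanishes_unique:
  assumes l: "l > 0" and 1: "dcharacter l \<xi>1" "\<xi>1 \<noteq> principal_character l" "L_vanishes l \<xi>1"
    and 2: "dcharacter l \<xi>2" "\<xi>2 \<noteq> principal_character l" "L_vanishes l \<xi>2"
  shows "\<xi>1 = \<xi>2"
proof (rule ccontr)
  assume neq: "\<xi>1 \<noteq> \<xi>2"
  define X where "X = {\<xi>. dcharacter l \<xi>}"
  have fin: "finite X" unfolding X_def by (rule finite_dcharacters[OF l])
  define S where "S = (\<lambda>N \<xi>. Re (\<Sum>n=1..N. \<xi> n * of_real (mangoldt n / real n)))"
  have "\<exists>K. \<forall>N\<ge>1. S N \<xi> \<le> K - (if L_vanishes l \<xi> then ln (real N) else 0)" if "\<xi> \<in> X - {principal_character l}" for \<xi>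
  proof (cases "L_vanishes l \<xi>")
    case True
    have "S N \<xi> \<le> 2 * real l - ln (real N)" if "N \<ge> 1" for N
    proof -
      have "norm ((\<Sum>n=1..N. \<xi> n * of_real (mangoldt n / real n)) + of_real (ln (real N))) \<le> 2 * real l"
        using \<open>\<xi> \<in> X - {principal_character l}\<close> True that
        by (intro sum_dcharacter_mangoldt_zero[OF l, where L = 0]) (auto simp: X_def L_vanishes_def)
      from order.trans[OF complex_Re_le_cmod this] show ?thesis by (simp add: S_def)
    qed
    then show ?thesis using True by auto
  next
    case False
    have "dcharacter l \<xi>" "\<xi> \<noteq> principal_character l" using that by (auto simp: X_def)
    from sum_dcharacter_mangoldt_bounded'[OF l this False] obtain K where
      K: "\<And>N. norm (\<Sum>n=1..N. \<xi> n * of_real (mangoldt n / real n)) \<le> K" by blast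
    have "S N \<xi> \<le> K" for N using order.trans[OF complex_Re_le_cmod K] by (simp add: S_def)
    then show ?thesis using False by auto
  qed
  then obtain K where K: "\<And>\<xi> N. \<xi> \<in> X - {principal_character l} \<Longrightarrow> N \<ge> 1 \<Longrightarrow> S N \<xi> \<le> K \<xi> - (if L_vanishes l \<xi> then ln (real N) else 0)"
    by metis
  have principal: "S N (principal_character l) \<le> ln (real N) + 4" for N
  proof -
    have "S N (principal_character l) = (\<Sum>n=1..N. if coprime n l then mangoldt n / real n else 0)"
      unfolding S_def Re_sum by (intro sum.cong) (auto simp: principal_character_def)
    also have "\<dots> \<le> (\<Sum>n=1..N. mangoldt n / real n)"
      by (intro sum_mono) (auto intro!: divide_nonneg_nonneg mangoldt_nonneg)
    also have "\<dots> \<le> ln (real N) + 4" using mertens_mangoldt[of N] by linarith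
    finally show ?thesis .
  qed
  define C where "C = (\<Sum>\<xi>\<in>X - {principal_character l}. K \<xi>) + 4"
  have bound: "ln (real N) \<le> C" if N: "N \<ge> 1" for N
  proof -
    let ?Z = "\<lambda>\<xi>. if L_vanishes l \<xi> then ln (real N) else 0"
    have "0 \<le> (\<Sum>\<xi>\<in>X. S N \<xi>)" unfolding S_def X_def by (rule sum_dcharacters_mangoldt_nonneg[OF l])
    also have "\<dots> = S N (principal_character l) + (\<Sum>\<xi>\<in>X - {principal_character l}. S N \<xi>)"
      using fin dcharacter_principal by (intro sum.remove) (auto simp: X_def)
    finally have "0 \<le> S N (principal_character l) + (\<Sum>\<xi>\<in>X - {principal_character l}. S N \<xi>)" .
    moreover have "(\<Sum>\<xi>\<in>X - {principal_character l}. S N \<xi>) \<le> (\<Sum>\<xi>\<in>X - {principal_character l}. K \<xi> - ?Z \<xi>)"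
      by (intro sum_mono K N)
    moreover have "(\<Sum>\<xi>\<in>X - {principal_character l}. K \<xi> - ?Z \<xi>) =
        (\<Sum>\<xi>\<in>X - {principal_character l}. K \<xi>) - (\<Sum>\<xi>\<in>X - {principal_character l}. ?Z \<xi>)"
      by (rule sum_subtractf)
    moreover have "2 * ln (real N) \<le> (\<Sum>\<xi>\<in>X - {principal_character l}. ?Z \<xi>)"
    proof -
      have "2 * ln (real N) = (\<Sum>\<xi>\<in>{\<xi>1, \<xi>2}. ?Z \<xi>)" using neq 1 2 by simp
      also have "\<dots> \<le> (\<Sum>\<xi>\<in>X - {principal_character l}. ?Z \<xi>)"
        by (intro sum_mono2) (use fin 1 2 N in \<open>auto simp: X_def\<close>)
      finally show ?thesis .
    qed
    ultimately show ?thesis using principal[of N] unfolding C_def by argo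
  qed
  obtain M :: nat where M: "exp (C + 1) < real M" using reals_Archimedean2 by blast
  then have "M \<ge> 1" by (cases M) auto
  have "C + 1 = ln (exp (C + 1))" by simp
  also have "\<dots> \<le> ln (real M)" using M \<open>M \<ge> 1\<close> by (subst ln_le_cancel_iff) auto
  finally show False using bound[OF \<open>M \<ge> 1\<close>] by simp
qed

section \<open>Lambert series of a real multiplicative function\<close>

lemma sum_divisors_mult:
  fixes f :: "nat \<Rightarrow> 'a::comm_semiring_1"
  assumes ab: "coprime a b" and f: "\<And>x y. f (x * y) = f x * f y"
  shows "(\<Sum>d | d dvd a * b. f d) = (\<Sum>d | d dvd a. f d) * (\<Sum>d | d dvd b. f d)"
proof -
  have gcd1: "gcd (x * y) a = x" if "x dvd a" "y dvd b" for x y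
  proof -
    have "coprime a y" using ab that by (meson coprime_divisors dvd_refl)
    then have "gcd (x * y) a = gcd x a" by (rule gcd_mult_left_right_cancel)
    then show ?thesis using that by (simp add: gcd_nat.absorb1)
  qed
  have gcd2: "gcd (x * y) b = y" if "x dvd a" "y dvd b" for x y
  proof -
    have "coprime b x" using ab that by (meson coprime_commute coprime_divisors dvd_refl)
    then have "gcd (x * y) b = gcd y b" by (rule gcd_mult_left_left_cancel)
    then show ?thesis using that by (simp add: gcd_nat.absorb1)
  qed
  have "(\<Sum>d | d dvd a. f d) * (\<Sum>d | d dvd b. f d) = (\<Sum>(x,y)\<in>{d. d dvd a} \<times> {d. d dvd b}. f (x * y))"
    by (simp add: sum_product sum.cartesian_product f)
  also have "\<dots> = (\<Sum>d | d dvd a * b. f d)"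
  proof (rule sum.reindex_bij_witness[where i = "\<lambda>d. (gcd d a, gcd d b)" and j = "\<lambda>(x,y). x * y"], goal_cases)
    case (3 d)
    then obtain x y where "d = x * y" "x dvd a" "y dvd b" using division_decomp by blast
    then show ?case by (simp add: gcd1 gcd2)
  qed (auto simp: gcd1 gcd2 mult_dvd_mono)
  finally show ?thesis by simp
qed

text \<open>
  If \<open>\<Sum>d. c(d) / d = 0\<close>, then the Lambert series \<open>\<Sum>d. c(d) / (exp (s d) - 1)\<close> equals
  \<open>- \<Sum>d. c(d) b(s d)\<close>, which stays bounded as \<open>s \<rightarrow> 0\<close> because \<open>b\<close> decreases. As a power series
  in \<open>exp (- s)\<close> it has nonnegative coefficients, at least 1 at squares, hence it is unbounded.
\<close>
definition bkernel :: "real \<Rightarrow> real" where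
  "bkernel u = 1 / u - 1 / (exp u - 1)"

text \<open>Applied at v = x / 2, where it reads 2 sinh (x/2) >= x and decides the sign of the
  derivative of \<open>bkernel\<close>. The difference of both sides has derivative (exp (v/2) - exp
  (-v/2))^2.\<close>

lemma two_mult_le_exp_diff: "0 \<le> v \<Longrightarrow> 2 * v \<le> exp v - exp (- v :: real)"
proof -
  assume v: "0 \<le> v"
  have "(\<lambda>v. exp v - exp (-v) - 2 * v) 0 \<le> (\<lambda>v. exp v - exp (-v) - 2 * v) v"
  proof (rule DERIV_nonneg_imp_nondecreasing[OF v])
    fix x :: real
    have "((\<lambda>v. exp v - exp (-v) - 2 * v) has_real_derivative exp x + exp (-x) - 2) (at x)"
      by (auto intro!: derivative_eq_intros)
    moreover have "exp x + exp (-x) - 2 \<ge> 0"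
    proof -
      have "0 \<le> (exp (x/2) - exp (-x/2)) ^ 2" by simp
      also have "\<dots> = exp x + exp (-x) - 2"
        by (simp add: power2_eq_square algebra_simps flip: exp_add)
      finally show ?thesis .
    qed
    ultimately show "\<exists>y. ((\<lambda>v. exp v - exp (-v) - 2 * v) has_real_derivative y) (at x) \<and> y \<ge> 0" by blast
  qed
  then show ?thesis by simp
qed

text \<open>Since exp x - 1 = exp (x/2) * 2 sinh (x/2), the derivative is 1 / (2 sinh (x/2))^2 - 1 /
  x^2, and 2 sinh (x/2) >= x.\<close>

lemma bkernel_antimono:
  assumes "0 < u" "u \<le> v"
  shows "bkernel v \<le> bkernel u"
proof (rule DERIV_nonpos_imp_nonincreasing[OF assms(2)])
  fix x assume x: "u \<le> x" "x \<le> v"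
  then have x0: "x > 0" using assms by simp
  have e: "exp x - 1 > 0" using x0 by simp
  have "(bkernel has_real_derivative (exp x / (exp x - 1) ^ 2 - 1 / x ^ 2)) (at x)"
    unfolding bkernel_def using x0 e by (auto intro!: derivative_eq_intros simp: power2_eq_square field_simps)
  moreover have "exp x / (exp x - 1) ^ 2 \<le> 1 / x ^ 2"
  proof -
    have "x \<le> exp (x/2) - exp (-(x/2))" using two_mult_le_exp_diff[of "x/2"] x0 by simp
    then have "x * exp (x/2) \<le> (exp (x/2) - exp (-(x/2))) * exp (x/2)" by (intro mult_right_mono) auto
    also have "\<dots> = exp x - 1" by (simp add: algebra_simps flip: exp_add)
    finally have "(x * exp (x/2)) ^ 2 \<le> (exp x - 1) ^ 2" using x0 by (intro power_mono) auto
    also have "(x * exp (x/2)) ^ 2 = x ^ 2 * exp x" by (simp add: power_mult_distrib flip: exp_double)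
    finally show ?thesis using x0 e by (simp add: field_simps)
  qed
  ultimately show "\<exists>y. (bkernel has_real_derivative y) (at x) \<and> y \<le> 0" by (intro exI[of _ "exp x / (exp x - 1) ^ 2 - 1 / x ^ 2"]) auto
qed

lemma bkernel_nonneg: "u > 0 \<Longrightarrow> 0 \<le> bkernel u"
proof -
  assume u: "u > 0"
  have "u \<le> exp u - 1" using exp_ge_add_one_self[of u] by linarith
  then have "1 / (exp u - 1) \<le> 1 / u" using u by (intro divide_left_mono) auto
  then show ?thesis by (simp add: bkernel_def)
qed

lemma bkernel_le_1:
  assumes u: "u > 0"
  shows "bkernel u \<le> 1"
proof -
  have "exp u * (1 - u) \<le> exp u * exp (-u)"
    using exp_ge_add_one_self[of "-u"] by (intro mult_left_mono) auto
  then have "exp u - 1 - u \<le> u * (exp u - 1)" by (simp add: algebra_simps flip: exp_add)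
  then show ?thesis using u by (simp add: bkernel_def divide_simps)
qed

context
  fixes c :: "nat \<Rightarrow> real"
  assumes c_mult: "\<And>x y. c (x * y) = c x * c y" and c_1: "c 1 = 1" and c_range: "\<And>n. c n \<in> {-1, 0, 1}"
begin

lemma c_power: "c (n ^ k) = c n ^ k"
  by (induction k) (use c_1 in \<open>auto simp: c_mult\<close>)

lemma sum_divisors_prime_power_mult:
  assumes "prime p" "\<not>p dvd m"
  shows "(\<Sum>d | d dvd p ^ k * m. c d) = (\<Sum>i\<le>k. c p ^ i) * (\<Sum>d | d dvd m. c d)"
proof -
  have "coprime (p ^ k) m" using assms by (simp add: prime_imp_coprime)
  then have "(\<Sum>d | d dvd p ^ k * m. c d) = (\<Sum>d | d dvd p ^ k. c d) * (\<Sum>d | d dvd m. c d)"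
    by (rule sum_divisors_mult) (rule c_mult)
  also have "{d. d dvd p ^ k} = (\<lambda>i. p ^ i) ` {..k}"
    using assms by (auto simp: divides_primepow_nat)
  also have "(\<Sum>d\<in>(\<lambda>i. p ^ i) ` {..k}. c d) = (\<Sum>i\<le>k. c p ^ i)"
    using prime_gt_1_nat[OF assms(1)] by (subst sum.reindex) (auto simp: inj_on_def c_power power_inject_exp)
  finally show ?thesis .
qed

text \<open>For c p = -1 the sum alternates between 1 and 0, and even k hit 1. Hence the divisor
  sums of c are nonnegative, and at least 1 at squares.\<close>

lemma c_geometric_nonneg: "0 \<le> (\<Sum>i\<le>k. c p ^ i)"
  and c_geometric_ge_1: "even k \<Longrightarrow> 1 \<le> (\<Sum>i\<le>k. c p ^ i)"
proof -
  have minus: "(\<Sum>i\<le>k. (-1) ^ i) = (if even k then 1 else 0 :: real)" for k :: nat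
    by (induction k) auto
  have zero: "(\<Sum>i\<le>k. 0 ^ i) = (1 :: real)" for k :: nat
    by (induction k) auto
  show "0 \<le> (\<Sum>i\<le>k. c p ^ i)" using c_range[of p] by (auto simp: minus zero)
  show "even k \<Longrightarrow> 1 \<le> (\<Sum>i\<le>k. c p ^ i)" using c_range[of p] by (auto simp: minus zero)
qed

lemma sum_divisors_nonneg: "n > 0 \<Longrightarrow> 0 \<le> (\<Sum>d | d dvd n. c d)"
proof (induction n rule: less_induct)
  case (less n)
  show ?case
  proof (cases "n = 1")
    case False
    then obtain p where p: "prime p" "p dvd n" using prime_factor_nat by blast
    obtain m where m: "n = p ^ multiplicity p n * m" "\<not>p dvd m"
      using multiplicity_decompose'[of n p] less.prems p(1) by (auto simp: prime_nat_iff)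
    have "multiplicity p n > 0" using p less.prems by (simp add: prime_multiplicity_gt_zero_iff)
    then have "1 < p ^ multiplicity p n" using p(1) prime_gt_1_nat by (intro one_less_power) auto
    moreover have "m > 0" using m(1) less.prems by (intro Nat.gr0I) auto
    ultimately have "m < n" by (subst m(1)) auto
    then show ?thesis using less.IH[of m] \<open>m > 0\<close> c_geometric_nonneg[where p = p and k = "multiplicity p n"]
      sum_divisors_prime_power_mult[OF p(1) m(2), of "multiplicity p n"] m(1) by simp
  qed (use c_1 in auto)
qed

lemma sum_divisors_square_ge_1: "q > 0 \<Longrightarrow> 1 \<le> (\<Sum>d | d dvd q ^ 2. c d)"
proof (induction q rule: less_induct)
  case (less n)
  show ?case
  proof (cases "n = 1")
    case False
    then obtain p where p: "prime p" "p dvd n" using prime_factor_nat by blast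
    obtain m where m: "n = p ^ multiplicity p n * m" "\<not>p dvd m"
      using multiplicity_decompose'[of n p] less.prems p(1) by (auto simp: prime_nat_iff)
    have "multiplicity p n > 0" using p less.prems by (simp add: prime_multiplicity_gt_zero_iff)
    then have "1 < p ^ multiplicity p n" using p(1) prime_gt_1_nat by (intro one_less_power) auto
    moreover have "m > 0" using m(1) less.prems by (intro Nat.gr0I) auto
    ultimately have "m < n" by (subst m(1)) auto
    have n2: "n ^ 2 = p ^ (multiplicity p n * 2) * m ^ 2"
      by (subst m(1)) (simp add: power_mult_distrib power_mult)
    have "\<not>p dvd m ^ 2" using m(2) p(1) prime_dvd_power by blast
    from sum_divisors_prime_power_mult[OF p(1) this, of "multiplicity p n * 2"]
    have "(\<Sum>d | d dvd n ^ 2. c d) = (\<Sum>i\<le>multiplicity p n * 2. c p ^ i) * (\<Sum>d | d dvd m ^ 2. c d)"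
      by (simp only: n2)
    also have "\<dots> \<ge> 1 * 1"
      using less.IH[OF \<open>m < n\<close> \<open>m > 0\<close>] c_geometric_ge_1[of "multiplicity p n * 2" p] by (intro mult_mono) auto
    finally show ?thesis by simp
  qed (use c_1 in auto)
qed

text \<open>The Lambert series is truncated at N, and cutting off its geometric series leaves the
  remainder N exp (- s N) / (1 - exp (- s)), which vanishes as N grows with s fixed. Letting s tend
  to 0 afterwards makes each of the first K squares count fully, so that K <= B for every K.\<close>

lemma real_character_L_nonvanishing:
  assumes B: "\<And>M N. \<bar>\<Sum>n\<in>{M<..N}. c n\<bar> \<le> B" and L: "\<And>N. \<bar>\<Sum>n=1..N. c n / real n\<bar> \<le> B / real (Suc N)"
  shows False
proof -
  have B0: "B \<ge> 0" using B[of 0 0] by simp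
  have bound: "(\<Sum>n=1..N. (\<Sum>d | d dvd n. c d) * exp (- s * real n)) \<le>
      B / real (Suc N) / s + B + real N * exp (- s * real N) / (1 - exp (- s))" if s: "s > 0" for s N
  proof -
    have "(\<Sum>n=1..N. (\<Sum>d | d dvd n. c d) * exp (- s * real n)) =
      (\<Sum>n=1..N. \<Sum>d | d dvd n. c d * exp (- s * real d) ^ (n div d))"
    proof (intro sum.cong refl, unfold sum_distrib_right, intro sum.cong refl)
      fix n d assume "n \<in> {1..N}" "d \<in> {d. d dvd n}"
      then obtain m where "n = d * m" "d > 0" by auto
      then show "c d * exp (- s * real n) = c d * exp (- s * real d) ^ (n div d)"
        by (simp add: exp_of_nat_mult[symmetric] mult_ac)
    qed
    also have "\<dots> = (\<Sum>d=1..N. \<Sum>m=1..N div d. c d * exp (- s * real d) ^ m)"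
      by (rule sum_divisors_swap)
    also have "\<dots> \<le> (\<Sum>d=1..N. c d / real d / s - c d * bkernel (s * real d) + exp (- s * real N) / (1 - exp (- s)))"
    proof (intro sum_mono)
      fix d assume d: "d \<in> {1..N}"
      define x where "x = exp (- s * real d)"
      have x: "0 < x" "x < 1" using s d by (auto simp: x_def mult_pos_pos)
      have "N div d \<ge> 1" using d by (simp add: div_greater_zero_iff Suc_le_eq)
      then have "(\<Sum>m=1..N div d. x ^ m) = x / (1 - x) - x ^ Suc (N div d) / (1 - x)"
        using x by (simp add: sum_gp diff_divide_distrib)
      \<comment> \<open>The complete geometric series is 1 / (exp (s d) - 1). Its singular part 1 /
        (s d) is what the vanishing of the L-value removes after summation over d.\<close>
      moreover have "x / (1 - x) = 1 / real d / s - bkernel (s * real d)"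
      proof -
        have "x * exp (s * real d) = 1" by (simp add: x_def flip: exp_add)
        then have e: "exp (s * real d) = 1 / x" using x by (simp add: field_simps)
        have "1 / (1 / x - 1) = x / (1 - x)" using x by (simp add: divide_simps)
        then show ?thesis by (simp add: bkernel_def e mult.commute)
      qed
      moreover have "x ^ Suc (N div d) / (1 - x) \<le> exp (- s * real N) / (1 - exp (- s))"
      proof (intro frac_le)
        have "N < d * Suc (N div d)" using d by (simp add: dividend_less_times_div)
        then have "real N \<le> real d * real (Suc (N div d))" by (metis less_imp_le of_nat_le_iff of_nat_mult)
        then have "s * real N \<le> s * (real d * real (Suc (N div d)))" using s by (intro mult_left_mono) auto
        then show "x ^ Suc (N div d) \<le> exp (- s * real N)"
          unfolding x_def exp_of_nat_mult[symmetric] by (subst exp_le_cancel_iff) (simp add: mult_ac)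
        show "1 - exp (- s) \<le> 1 - x" using s d by (simp add: x_def)
      qed (use s in auto)
      ultimately have "c d * (\<Sum>m=1..N div d. x ^ m) \<le> c d * (1 / real d / s - bkernel (s * real d)) + exp (- s * real N) / (1 - exp (- s))"
      proof -
        assume eq: "(\<Sum>m=1..N div d. x ^ m) = x / (1 - x) - x ^ Suc (N div d) / (1 - x)"
          "x / (1 - x) = 1 / real d / s - bkernel (s * real d)"
          and le: "x ^ Suc (N div d) / (1 - x) \<le> exp (- s * real N) / (1 - exp (- s))"
        have "0 \<le> x ^ Suc (N div d) / (1 - x)" using x by simp
        then have "- c d * (x ^ Suc (N div d) / (1 - x)) \<le> x ^ Suc (N div d) / (1 - x)"
          using c_range[of d] by auto
        then show ?thesis using le unfolding eq(1) eq(2)[symmetric] right_diff_distrib by linarith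
      qed
      then show "(\<Sum>m=1..N div d. c d * exp (- s * real d) ^ m) \<le>
          c d / real d / s - c d * bkernel (s * real d) + exp (- s * real N) / (1 - exp (- s))"
        unfolding x_def[symmetric] sum_distrib_left[symmetric] by (simp add: right_diff_distrib)
    qed
    also have "\<dots> = (\<Sum>d=1..N. c d / real d) / s + - (\<Sum>d=1..N. c d * bkernel (s * real d)) + real N * exp (- s * real N) / (1 - exp (- s))"
      by (simp add: sum.distrib sum_subtractf sum_divide_distrib)
    also have "(\<Sum>d=1..N. c d / real d) / s \<le> B / real (Suc N) / s"
      using L[of N] s by (intro divide_right_mono) auto
    also have "- (\<Sum>d=1..N. c d * bkernel (s * real d)) \<le> B"
    proof -
      have "norm (\<Sum>d\<in>{0<..N}. bkernel (s * real d) *\<^sub>R c d) \<le> B * bkernel (s * real (Suc 0))"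
        using s B by (intro abel_summation_bound bkernel_antimono bkernel_nonneg) auto
      also have "\<dots> \<le> B * 1" using s B0 by (intro mult_left_mono bkernel_le_1) auto
      finally show ?thesis by (simp add: mult.commute greaterThanAtMost_def atLeastAtMost_def atLeast_Suc_greaterThan)
    qed
    finally show ?thesis by simp
  qed
  have squares: "(\<Sum>k=1..K. exp (- s * real (k ^ 2))) \<le> B" if s: "s > 0" for s K
  proof -
    have "(\<Sum>k=1..K. exp (- s * real (k ^ 2))) \<le> B / real (Suc N) / s + B + real N * exp (- s * real N) / (1 - exp (- s))"
      if N: "N \<ge> K ^ 2" for N
    proof -
      have "(\<Sum>k=1..K. exp (- s * real (k ^ 2))) \<le> (\<Sum>k=1..K. (\<Sum>d | d dvd k ^ 2. c d) * exp (- s * real (k ^ 2)))"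
      proof (intro sum_mono)
        fix k assume "k \<in> {1..K}"
        then have "1 * exp (- s * real (k ^ 2)) \<le> (\<Sum>d | d dvd k ^ 2. c d) * exp (- s * real (k ^ 2))"
          by (intro mult_right_mono sum_divisors_square_ge_1) auto
        then show "exp (- s * real (k ^ 2)) \<le> (\<Sum>d | d dvd k ^ 2. c d) * exp (- s * real (k ^ 2))" by simp
      qed
      also have "\<dots> = (\<Sum>n\<in>(\<lambda>k. k ^ 2) ` {1..K}. (\<Sum>d | d dvd n. c d) * exp (- s * real n))"
        by (subst sum.reindex) (auto simp: inj_on_def power2_eq_iff)
      also have "\<dots> \<le> (\<Sum>n=1..N. (\<Sum>d | d dvd n. c d) * exp (- s * real n))"
      proof (intro sum_mono2)
        show "(\<lambda>k. k ^ 2) ` {1..K} \<subseteq> {1..N}"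
          using N by (auto simp: Suc_le_eq intro: order.trans[OF power_mono])
      qed (auto intro!: mult_nonneg_nonneg sum_divisors_nonneg)
      also note bound[OF s]
      finally show ?thesis .
    qed
    then have ev: "eventually (\<lambda>N. (\<Sum>k=1..K. exp (- s * real (k ^ 2))) \<le> B / real (Suc N) / s + B + real N * exp (- s * real N) / (1 - exp (- s))) sequentially"
      by (auto simp: eventually_sequentially)
    have "((\<lambda>N. B / real (Suc N) / s) \<longlongrightarrow> 0) sequentially" using s by real_asymp
    moreover have "((\<lambda>N. real N * exp (- s * real N)) \<longlongrightarrow> 0) sequentially" using s by real_asymp
    ultimately have "((\<lambda>N. B / real (Suc N) / s + B + real N * exp (- s * real N) / (1 - exp (- s))) \<longlongrightarrow> 0 + B + 0 / (1 - exp (-s))) sequentially"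
      using s by (intro tendsto_intros) auto
    from tendsto_lowerbound[OF this ev] show ?thesis by simp
  qed
  have "real K \<le> B" for K
  proof -
    have "((\<lambda>s::real. \<Sum>k=1..K. exp (- s * real (k ^ 2))) \<longlongrightarrow> (\<Sum>k=1..K. exp (- 0 * real (k ^ 2)))) (at_right 0)"
      by (intro tendsto_intros)
    moreover have "eventually (\<lambda>s::real. (\<Sum>k=1..K. exp (- s * real (k ^ 2))) \<le> B) (at_right 0)"
      using squares by (auto simp: eventually_at_right_field intro!: exI[of _ 1])
    ultimately have "(\<Sum>k=1..K. exp (- 0 * real (k ^ 2))) \<le> B"
      by (rule tendsto_upperbound) auto
    then show ?thesis by simp
  qed
  then show False using reals_Archimedean2[of B] by (meson not_less)
qed

end

text \<open>The conjugate character vanishes together with xi, so uniqueness makes xi real. Its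
  values are then 0, 1 and -1, the case excluded by the Lambert series.\<close>

theorem L_nonvanishing:
  assumes l: "l > 0" and xi: "dcharacter l \<xi>" "\<xi> \<noteq> principal_character l"
  shows "\<not>L_vanishes l \<xi>"
proof
  assume van: "L_vanishes l \<xi>"
  let ?\<xi>' = "\<lambda>n. cnj (\<xi> n)"
  have "dcharacter l ?\<xi>'" using xi(1) by (auto simp: dcharacter_def)
  moreover have "?\<xi>' \<noteq> principal_character l"
  proof
    assume *: "?\<xi>' = principal_character l"
    have "\<xi> n = principal_character l n" for n
      using fun_cong[OF *, of n] by (metis complex_cnj_cnj complex_cnj_one complex_cnj_zero principal_character_def)
    then show False using xi(2) by auto
  qed
  moreover have "L_vanishes l ?\<xi>'"
  proof -
    have "(\<Sum>n=1..N. ?\<xi>' n / of_nat n) = cnj (\<Sum>n=1..N. \<xi> n / of_nat n)" for N by simp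
    then show ?thesis using van unfolding L_vanishes_def by (metis complex_mod_cnj)
  qed
  ultimately have "\<xi> = ?\<xi>'" using L_vanishes_unique[OF l xi van] by blast
  then have real: "\<xi> n = of_real (Re (\<xi> n))" for n
    by (metis complex_cnj_cancel_iff complex_eq_iff complex_cnj_complex_of_real Reals_cnj_iff of_real_Re)
  define c where "c = (\<lambda>n. Re (\<xi> n))"
  have c: "\<xi> n = of_real (c n)" for n using real by (simp add: c_def)
  have "complex_of_real (c (x * y)) = complex_of_real (c x * c y)" for x y
    using dcharacter_mult[OF xi(1), of x y] by (simp add: c)
  then have c_mult: "c (x * y) = c x * c y" for x y by (simp only: of_real_eq_iff)
  have "complex_of_real (c 1) = complex_of_real 1" using dcharacter_1[OF xi(1)] by (simp add: c)
  then have c_1: "c 1 = 1" by (simp only: of_real_eq_iff)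
  have c_range: "c n \<in> {-1, 0, 1}" for n
  proof (cases "coprime n l")
    case True
    from dcharacter_root[OF xi(1) this] have "norm (\<xi> n) = 1 \<or> totient l = 0" by (rule power_eq_1_iff)
    then show ?thesis using l by (auto simp: c abs_if split: if_splits)
  next
    case False
    then have "\<xi> n = 0" using dcharacter_eq_0_iff[OF xi(1)] by simp
    then show ?thesis by (simp add: c_def)
  qed
  have B: "\<bar>\<Sum>n\<in>{M<..N}. c n\<bar> \<le> 2 * real l" for M N
    using norm_sum_dcharacter[OF l xi, of M N] by (simp add: c flip: of_real_sum)
  have L: "\<bar>\<Sum>n=1..N. c n / real n\<bar> \<le> 2 * real l / real (Suc N)" for N
  proof -
    have "(\<Sum>n=1..N. \<xi> n / of_nat n) = of_real (\<Sum>n=1..N. c n / real n)" by (simp add: c)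
    then have "norm (\<Sum>n=1..N. \<xi> n / of_nat n) = \<bar>\<Sum>n=1..N. c n / real n\<bar>" by (simp only: norm_of_real)
    then show ?thesis using van unfolding L_vanishes_def by metis
  qed
  show False by (rule real_character_L_nonvanishing[OF c_mult c_1 c_range B L])
qed

section \<open>Primes in residue classes\<close>

lemma sum_dcharacter_primes_bounded:
  assumes "l > 0" "dcharacter l \<xi>" "\<xi> \<noteq> principal_character l"
  shows "\<exists>K. \<forall>N. norm (\<Sum>n=1..N. if prime n then \<xi> n * of_real (ln (real n) / real n) else 0) \<le> K"
proof -
  from sum_dcharacter_mangoldt_bounded'[OF assms L_nonvanishing[OF assms]] obtain K where
    K: "\<And>N. norm (\<Sum>n=1..N. \<xi> n * of_real (mangoldt n / real n)) \<le> K" by blast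
  have "norm (\<Sum>n=1..N. if prime n then \<xi> n * of_real (ln (real n) / real n) else 0) \<le> K + 8" for N
  proof -
    let ?f = "\<lambda>n. \<xi> n * of_real (mangoldt n / real n)"
    have "(\<Sum>n=1..N. ?f n) = (\<Sum>n=1..N. if prime n then \<xi> n * of_real (ln (real n) / real n) else 0) + (\<Sum>n=1..N. if prime n then 0 else ?f n)"
      unfolding sum.distrib[symmetric] by (intro sum.cong) auto
    moreover have "norm (\<Sum>n=1..N. if prime n then 0 else ?f n) \<le> 8"
    proof -
      have "norm (\<Sum>n=1..N. if prime n then 0 else ?f n) \<le> (\<Sum>n=1..N. if prime n then 0 else mangoldt n / real n)"
      proof (intro order.trans[OF norm_sum] sum_mono)
        fix n
        have "norm (?f n) \<le> 1 * (mangoldt n / real n)"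
          using norm_dcharacter_le_1[OF assms(1,2), of n] unfolding norm_mult
          by (intro mult_mono) (auto simp: norm_divide intro!: divide_nonneg_nonneg mangoldt_nonneg)
        then show "norm (if prime n then 0 else ?f n) \<le> (if prime n then 0 else mangoldt n / real n)" by simp
      qed
      also have "\<dots> = (\<Sum>n | n \<in> {1..N} \<and> \<not>prime n. mangoldt n / real n)"
        by (rule sum.mono_neutral_cong_right) auto
      also have "\<dots> \<le> 8" by (rule sum_mangoldt_not_prime_le)
      finally show ?thesis .
    qed
    ultimately show ?thesis using K[of N] by (smt (verit) norm_diff_ineq add.commute norm_triangle_ineq4 add_diff_cancel_left')
  qed
  then show ?thesis by blast
qed

text \<open>Here \<kappa> is 1 over the number of characters. Orthogonality writes the indicator of
  the class of j as \<kappa> times the sum of xi(j') xi(n), with j' inverse to j. The principal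
  character supplies the mean \<kappa>, and all others have bounded prime sums. The range of
  \<kappa> keeps the deviation from the mean at most 1 in absolute value.\<close>

theorem mertens_residue_class:
  assumes l: "l > 0" and j: "coprime j l"
  obtains \<kappa> K where "0 \<le> \<kappa>" "\<kappa> \<le> 1"
    "\<And>N. \<bar>\<Sum>n=1..N. if prime n then (of_bool [n = j] (mod l) - \<kappa>) * ln (real n) / real n else 0\<bar> \<le> K"
proof -
  define X where "X = {\<xi>. dcharacter l \<xi>}"
  have fin: "finite X" unfolding X_def by (rule finite_dcharacters[OF l])
  have pX: "principal_character l \<in> X" using dcharacter_principal by (simp add: X_def)
  define \<kappa> where "\<kappa> = 1 / real (card X)"
  have card: "card X \<ge> 1" using fin pX by (metis One_nat_def Suc_leI card_gt_0_iff empty_iff)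
  define X' where "X' = X - {principal_character l}"
  have "\<exists>K. \<forall>N. norm (\<Sum>n=1..N. if prime n then \<xi> n * of_real (ln (real n) / real n) else 0) \<le> K" if "\<xi> \<in> X'" for \<xi>
    using that sum_dcharacter_primes_bounded[OF l] by (auto simp: X'_def X_def)
  then obtain K where K: "\<And>\<xi> N. \<xi> \<in> X' \<Longrightarrow> norm (\<Sum>n=1..N. if prime n then \<xi> n * of_real (ln (real n) / real n) else 0) \<le> K \<xi>"
    by metis
  obtain j' where j': "[j * j' = 1] (mod l)" using cong_solve_coprime_nat[OF j] by (auto simp: One_nat_def)
  have j'cop: "coprime j' l" using j' by (metis coprime_iff_invertible_nat mult.commute One_nat_def)
  have inv: "[j' * n = 1] (mod l) \<longleftrightarrow> [n = j] (mod l)" for n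
  proof -
    have "[n = j] (mod l) \<longleftrightarrow> [j' * n = j' * j] (mod l)" using j'cop by (simp add: cong_mult_lcancel_nat)
    also have "\<dots> \<longleftrightarrow> [j' * n = 1] (mod l)" using j' by (metis cong_sym cong_trans mult.commute)
    finally show ?thesis ..
  qed
  \<comment> \<open>The last term corrects n not coprime to l, where all characters vanish but -
    \<kappa> remains on the left. Among primes this concerns only the divisors of l, a bounded
    contribution.\<close>
  have key: "complex_of_real (of_bool [n = j] (mod l) - \<kappa>) = of_real \<kappa> * (\<Sum>\<xi>\<in>X'. \<xi> j' * \<xi> n) - of_real \<kappa> * of_bool (\<not>coprime n l)" for n
  proof (cases "coprime n l")
    case True
    have "(\<Sum>\<xi>\<in>X. \<xi> (j' * n)) = (if [n = j] (mod l) then of_nat (card X) else 0)"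
      unfolding X_def inv[symmetric] by (rule sum_dcharacters[OF l]) (use True j'cop in simp)
    moreover have "(\<Sum>\<xi>\<in>X. \<xi> (j' * n)) = 1 + (\<Sum>\<xi>\<in>X'. \<xi> j' * \<xi> n)"
    proof -
      have "(\<Sum>\<xi>\<in>X'. \<xi> (j' * n)) = (\<Sum>\<xi>\<in>X'. \<xi> j' * \<xi> n)"
        by (intro sum.cong refl) (auto simp: X'_def X_def dcharacter_mult)
      then show ?thesis using True j'cop unfolding sum.remove[OF fin pX] X'_def by (simp add: principal_character_def)
    qed
    ultimately have "(\<Sum>\<xi>\<in>X'. \<xi> j' * \<xi> n) = (if [n = j] (mod l) then of_nat (card X) else 0) - 1" by (simp add: algebra_simps)
    then show ?thesis using True card by (simp add: \<kappa>_def field_simps)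
  next
    case False
    have "(\<Sum>\<xi>\<in>X'. \<xi> j' * \<xi> n) = 0"
    proof (intro sum.neutral ballI)
      fix \<xi> assume "\<xi> \<in> X'"
      then have "\<xi> n = 0" using dcharacter_eq_0_iff[of l \<xi> n] False by (simp add: X'_def X_def)
      then show "\<xi> j' * \<xi> n = 0" by simp
    qed
    moreover have "\<not>[n = j] (mod l)" using False j by (metis cong_imp_coprime cong_sym)
    ultimately show ?thesis using False by simp
  qed
  define C where "C = \<kappa> * (\<Sum>\<xi>\<in>X'. K \<xi>) + \<kappa> * (\<Sum>n=1..l. ln (real n) / real n)"
  have "\<bar>\<Sum>n=1..N. if prime n then (of_bool [n = j] (mod l) - \<kappa>) * ln (real n) / real n else 0\<bar> \<le> C" for N
  proof -
    let ?P = "\<lambda>\<xi>. (\<Sum>n=1..N. if prime n then \<xi> n * of_real (ln (real n) / real n) else 0)"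
    let ?Q = "\<Sum>n=1..N. if prime n \<and> \<not>coprime n l then ln (real n) / real n else 0"
    have "complex_of_real (\<Sum>n=1..N. if prime n then (of_bool [n = j] (mod l) - \<kappa>) * ln (real n) / real n else 0) =
       (\<Sum>n=1..N. if prime n then complex_of_real (of_bool [n = j] (mod l) - \<kappa>) * of_real (ln (real n) / real n) else 0)"
      unfolding of_real_sum by (intro sum.cong refl) simp
    also have "\<dots> = (\<Sum>n=1..N. of_real \<kappa> * (\<Sum>\<xi>\<in>X'. \<xi> j' * (if prime n then \<xi> n * of_real (ln (real n) / real n) else 0)) -
        of_real \<kappa> * of_real (if prime n \<and> \<not>coprime n l then ln (real n) / real n else 0))"
    proof (intro sum.cong refl)
      fix n
      define w where "w = ln (real n) / real n"
      have "(\<Sum>\<xi>\<in>X'. \<xi> j' * (if prime n then \<xi> n * of_real w else 0)) = (if prime n then (\<Sum>\<xi>\<in>X'. \<xi> j' * \<xi> n) * of_real w else 0)"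
        by (simp add: sum_distrib_right mult.assoc)
      then show "(if prime n then complex_of_real (of_bool [n = j] (mod l) - \<kappa>) * of_real (ln (real n) / real n) else 0) =
        of_real \<kappa> * (\<Sum>\<xi>\<in>X'. \<xi> j' * (if prime n then \<xi> n * of_real (ln (real n) / real n) else 0)) -
        of_real \<kappa> * of_real (if prime n \<and> \<not>coprime n l then ln (real n) / real n else 0)"
        unfolding key w_def[symmetric] by (auto simp: left_diff_distrib)
    qed
    also have "\<dots> = of_real \<kappa> * (\<Sum>\<xi>\<in>X'. \<xi> j' * ?P \<xi>) - of_real \<kappa> * of_real ?Q"
    proof -
      have "(\<Sum>n=1..N. \<Sum>\<xi>\<in>X'. \<xi> j' * (if prime n then \<xi> n * of_real (ln (real n) / real n) else 0)) = (\<Sum>\<xi>\<in>X'. \<xi> j' * ?P \<xi>)"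
        by (subst sum.swap) (simp only: sum_distrib_left)
      then show ?thesis by (simp only: sum_subtractf sum_distrib_left[symmetric] of_real_sum[symmetric])
    qed
    finally have eq: "complex_of_real (\<Sum>n=1..N. if prime n then (of_bool [n = j] (mod l) - \<kappa>) * ln (real n) / real n else 0) =
      of_real \<kappa> * (\<Sum>\<xi>\<in>X'. \<xi> j' * ?P \<xi>) - of_real \<kappa> * of_real ?Q" .
    have "\<bar>\<Sum>n=1..N. if prime n then (of_bool [n = j] (mod l) - \<kappa>) * ln (real n) / real n else 0\<bar> =
      norm (of_real \<kappa> * (\<Sum>\<xi>\<in>X'. \<xi> j' * ?P \<xi>) - of_real \<kappa> * of_real ?Q :: complex)"
      unfolding eq[symmetric] norm_of_real ..
    also have "\<dots> \<le> norm (of_real \<kappa> * (\<Sum>\<xi>\<in>X'. \<xi> j' * ?P \<xi>)) + norm (of_real \<kappa> * of_real ?Q :: complex)"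
      by (rule norm_triangle_ineq4)
    also have "norm (of_real \<kappa> * (\<Sum>\<xi>\<in>X'. \<xi> j' * ?P \<xi>)) \<le> \<kappa> * (\<Sum>\<xi>\<in>X'. K \<xi>)"
    proof -
      have "norm (\<Sum>\<xi>\<in>X'. \<xi> j' * ?P \<xi>) \<le> (\<Sum>\<xi>\<in>X'. K \<xi>)"
      proof (intro order.trans[OF norm_sum] sum_mono)
        fix \<xi> assume xi: "\<xi> \<in> X'"
        have "norm (\<xi> j' * ?P \<xi>) \<le> 1 * K \<xi>"
          unfolding norm_mult using K[OF xi] xi norm_dcharacter_le_1[OF l, of \<xi> j']
          by (intro mult_mono) (auto simp: X'_def X_def)
        then show "norm (\<xi> j' * ?P \<xi>) \<le> K \<xi>" by simp
      qed
      then show ?thesis unfolding norm_mult norm_of_real by (intro mult_mono) (auto simp: \<kappa>_def)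
    qed
    also have "norm (of_real \<kappa> * of_real ?Q :: complex) \<le> \<kappa> * (\<Sum>n=1..l. ln (real n) / real n)"
    proof -
      have "?Q \<ge> 0" by (intro sum_nonneg) auto
      have "?Q = (\<Sum>n | n \<in> {1..N} \<and> prime n \<and> \<not>coprime n l. ln (real n) / real n)"
        by (rule sum.mono_neutral_cong_right) auto
      also have "\<dots> \<le> (\<Sum>n=1..l. ln (real n) / real n)"
      proof (intro sum_mono2)
        show "{n. n \<in> {1..N} \<and> prime n \<and> \<not>coprime n l} \<subseteq> {1..l}"
          using l by (auto dest!: prime_imp_coprime[of _ l] intro: dvd_imp_le)
      qed auto
      finally show ?thesis using \<open>?Q \<ge> 0\<close> unfolding norm_mult norm_of_real
        by (intro mult_mono) (auto simp: \<kappa>_def)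
    qed
    finally show ?thesis by (simp add: C_def)
  qed
  moreover have "0 \<le> \<kappa>" "\<kappa> \<le> 1" using card by (auto simp: \<kappa>_def)
  ultimately show thesis using that by blast
qed

section \<open>Smooth and rough numbers\<close>

definition rough :: "nat \<Rightarrow> nat \<Rightarrow> bool" where
  "rough y n \<longleftrightarrow> (\<forall>p\<in>prime_factors n. y < p)"

definition smooth :: "nat \<Rightarrow> nat \<Rightarrow> bool" where
  "smooth y n \<longleftrightarrow> (\<forall>p\<in>prime_factors n. p \<le> y)"

text \<open>Splitting off the exact power of one prime from each m yields one geometric series per
  prime. As M is finite, only partial sums of these series occur.\<close>

lemma sum_le_euler_product:
  fixes g :: "nat \<Rightarrow> real"
  assumes "finite P" and "\<And>p. p \<in> P \<Longrightarrow> prime p"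
    and g: "g 1 = 1" "\<And>x y. g (x * y) = g x * g y" "\<And>x. g x \<ge> 0" and "\<And>p. p \<in> P \<Longrightarrow> g p < 1"
    and "finite M" "\<And>m. m \<in> M \<Longrightarrow> m > 0 \<and> prime_factors m \<subseteq> P"
  shows "(\<Sum>m\<in>M. g m) \<le> (\<Prod>p\<in>P. 1 / (1 - g p))"
  using assms(1,2) assms(6-)
proof (induction P arbitrary: M)
  case empty
  have "M \<subseteq> {1}"
  proof
    fix m assume "m \<in> M"
    then have "m > 0" "prime_factors m = {}" using empty by auto
    then show "m \<in> {1}" by (simp add: prime_factorization_empty_iff)
  qed
  then have "(\<Sum>m\<in>M. g m) \<le> (\<Sum>m\<in>{1}. g m)" using g(3) by (intro sum_mono2) auto
  then show ?case using g(1) by simp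
next
  case (insert p P)
  have p: "prime p" "g p < 1" using insert.prems by auto
  define h where "h = (\<lambda>m. m div p ^ multiplicity p m)"
  define K where "K = Max (insert 0 (multiplicity p ` M))"
  have dec: "m = p ^ multiplicity p m * h m" for m
    by (simp add: h_def multiplicity_dvd)
  have h: "h m > 0 \<and> prime_factors (h m) \<subseteq> P" if "m \<in> M" for m
  proof -
    have m: "m > 0" "prime_factors m \<subseteq> insert p P" using insert.prems that by auto
    have h0: "h m > 0" using m dec[of m] by (intro Nat.gr0I) auto
    have "\<not>p dvd h m" unfolding h_def using m p by (intro multiplicity_decompose) (auto simp: prime_nat_iff)
    then have "p \<notin> prime_factors (h m)" by auto
    moreover have "prime_factors (h m) \<subseteq> prime_factors m"
      using m by (intro dvd_prime_factors) (auto intro: dvdI[of _ _ "p ^ multiplicity p m"] simp: mult.commute[of "h m"] dec[symmetric])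
    ultimately show ?thesis using m h0 by auto
  qed
  have sub: "M \<subseteq> (\<lambda>(i,b). p ^ i * b) ` ({..K} \<times> h ` M)"
  proof
    fix m assume m: "m \<in> M"
    have "multiplicity p m \<le> K" unfolding K_def using m insert.prems by (intro Max_ge) auto
    then show "m \<in> (\<lambda>(i,b). p ^ i * b) ` ({..K} \<times> h ` M)"
      using m dec[of m] by (intro image_eqI[of _ _ "(multiplicity p m, h m)"]) auto
  qed
  have gpow: "g (p ^ i) = g p ^ i" for i by (induction i) (use g in auto)
  have "(\<Sum>m\<in>M. g m) \<le> (\<Sum>m\<in>(\<lambda>(i,b). p ^ i * b) ` ({..K} \<times> h ` M). g m)"
    using insert.prems g(3) by (intro sum_mono2 sub) auto
  also have "\<dots> \<le> (\<Sum>(i,b)\<in>{..K} \<times> h ` M. g (p ^ i * b))"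
    using insert.prems g(3) by (intro order.trans[OF sum_image_le]) (auto simp: case_prod_unfold o_def)
  also have "\<dots> = (\<Sum>i\<le>K. g p ^ i) * (\<Sum>b\<in>h ` M. g b)"
    by (simp add: sum_product sum.cartesian_product g(2) gpow)
  also have "\<dots> \<le> 1 / (1 - g p) * (\<Prod>p\<in>P. 1 / (1 - g p))"
  proof (intro mult_mono)
    show "(\<Sum>i\<le>K. g p ^ i) \<le> 1 / (1 - g p)"
      using p g(3)[of p] by (simp add: sum_gp0 divide_right_mono)
    show "(\<Sum>b\<in>h ` M. g b) \<le> (\<Prod>p\<in>P. 1 / (1 - g p))"
      proof (rule insert.IH)
      fix b assume "b \<in> h ` M"
      then show "b > 0 \<and> prime_factors b \<subseteq> P" using h by blast
    qed (use insert.prems in auto)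
  qed (use p g(3) in \<open>auto intro!: sum_nonneg\<close>)
  finally show ?case using insert.hyps by simp
qed

text \<open>From 1 / (1 - x) = 1 + x + x^2 / (1 - x) and 1 + t <= exp t, with 1 / (1 - x) <= 4. The
  bound 3/4 leaves room for the weight of the prime 2 in Rankin's estimate, which can reach 1 / sqrt
  2.\<close>

lemma prod_inverse_one_minus_le_exp:
  fixes x :: "'a \<Rightarrow> real"
  assumes "\<And>p. p \<in> P \<Longrightarrow> 0 \<le> x p" "\<And>p. p \<in> P \<Longrightarrow> x p \<le> 3/4"
  shows "(\<Prod>p\<in>P. 1 / (1 - x p)) \<le> exp ((\<Sum>p\<in>P. x p) + 4 * (\<Sum>p\<in>P. x p ^ 2))"
proof (cases "finite P")
  case True
  have "(\<Prod>p\<in>P. 1 / (1 - x p)) \<le> (\<Prod>p\<in>P. exp (x p + 4 * x p ^ 2))"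
  proof (intro prod_mono conjI)
    fix p assume p: "p \<in> P"
    have x: "0 \<le> x p" "x p \<le> 3/4" using assms p by auto
    then show "0 \<le> 1 / (1 - x p)" by simp
    have "1 / (1 - x p) = 1 + (x p + x p ^ 2 / (1 - x p))"
      using x by (simp add: field_simps power2_eq_square)
    also have "\<dots> \<le> exp (x p + x p ^ 2 / (1 - x p))" by (rule exp_ge_add_one_self)
    also have "x p ^ 2 / (1 - x p) \<le> x p ^ 2 / (1/4)" using x by (intro divide_left_mono) auto
    finally show "1 / (1 - x p) \<le> exp (x p + 4 * x p ^ 2)" by (simp add: mult.commute)
  qed
  then show ?thesis using True by (simp add: exp_sum[symmetric] sum.distrib sum_distrib_left)
qed auto

lemma sum_inverse_square_primes_le:
  assumes "finite P" "\<And>p. p \<in> P \<Longrightarrow> p \<ge> (2::nat)"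
  shows "(\<Sum>p\<in>P. (1 / real p) ^ 2) \<le> 1"
proof -
  define N where "N = Max (insert 2 P)"
  have N: "N \<ge> 2" "p \<in> P \<Longrightarrow> p \<le> N" for p unfolding N_def using assms by auto
  have "(\<Sum>p\<in>P. (1 / real p) ^ 2) \<le> (\<Sum>p=2..N. (1 / real p) ^ 2)"
    using assms(2) N by (intro sum_mono2) auto
  also have "\<dots> \<le> (\<Sum>p=2..N. 1 / real (p - 1) - 1 / real p)"
  proof (intro sum_mono)
    fix p assume "p \<in> {2..N}"
    then have p: "real p \<ge> 2" "real (p - 1) = real p - 1" by auto
    then have "1 / real (p - 1) - 1 / real p = 1 / ((real p - 1) * real p)" by (simp add: field_simps)
    also have "\<dots> \<ge> 1 / (real p * real p)" using p by (intro divide_left_mono mult_right_mono) auto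
    finally show "(1 / real p) ^ 2 \<le> 1 / real (p - 1) - 1 / real p" by (simp add: power2_eq_square)
  qed
  also have "\<dots> = 1 - 1 / real N" using N(1)
    by (induction N rule: dec_induct) auto
  finally show ?thesis using N(1) by (smt (verit) divide_nonneg_nonneg of_nat_0_le_iff)
qed

lemma sum_mangoldt_div:
  assumes "n > 0"
  shows "(\<Sum>d | d dvd n. mangoldt (n div d)) = ln (real n)"
proof -
  have "(\<Sum>d | d dvd n. mangoldt (n div d)) = (\<Sum>d | d dvd n. (mangoldt d :: real))"
    by (rule sum.reindex_bij_witness[where i = "\<lambda>d. n div d" and j = "\<lambda>d. n div d"])
      (use assms in \<open>auto simp: dvd_div_eq_0_iff div_dvd_iff_mult\<close>)
  then show ?thesis using assms by (simp add: mangoldt_sum)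
qed

text \<open>The Euler product over the primes between y and N is controlled by the sum of their
  reciprocals; 52 is the 48 from that sum plus 4 times the sum of the squares, which is at most
  1.\<close>

lemma sum_rough_inverse_le:
  assumes y: "2 \<le> y" "y \<le> N"
  shows "(\<Sum>m | m \<in> {1..N} \<and> rough y m. 1 / real m) \<le> exp 52 * (ln (real N) / ln (real y))"
proof -
  define P where "P = {p. prime p \<and> y < p \<and> p \<le> N}"
  have fin: "finite P" by (simp add: P_def)
  have "(\<Sum>m | m \<in> {1..N} \<and> rough y m. 1 / real m) \<le> (\<Prod>p\<in>P. 1 / (1 - 1 / real p))"
  proof (rule sum_le_euler_product[where g = "\<lambda>m. 1 / real m"])
    fix m assume m: "m \<in> {m. m \<in> {1..N} \<and> rough y m}"
    have "p \<le> N" if "p \<in> prime_factors m" for p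
      proof -
      have "p dvd m" "m > 0" using that m by auto
      then have "p \<le> m" by (rule dvd_imp_le)
      then show ?thesis using m by simp
    qed
    then show "m > 0 \<and> prime_factors m \<subseteq> P"
      using m by (auto simp: P_def rough_def)
  qed (use fin y in \<open>auto simp: P_def\<close>)
  also have "\<dots> \<le> exp ((\<Sum>p\<in>P. 1 / real p) + 4 * (\<Sum>p\<in>P. (1 / real p) ^ 2))"
  proof (rule prod_inverse_one_minus_le_exp)
    fix p assume "p \<in> P"
    then have "real p \<ge> 2" using y by (simp add: P_def)
    then show "1 / real p \<le> 3 / 4" by (simp add: field_simps)
  qed auto
  also have "\<dots> \<le> exp (ln (ln (real N)) - ln (ln (real y)) + 52)"
  proof -
    have "(\<Sum>p\<in>P. 1 / real p) \<le> ln (ln (real N)) - ln (ln (real y)) + 48"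
      unfolding P_def by (rule sum_inverse_primes_le[OF y])
    moreover have "(\<Sum>p\<in>P. (1 / real p) ^ 2) \<le> 1"
      by (rule sum_inverse_square_primes_le[OF fin]) (auto simp: P_def prime_ge_2_nat)
    ultimately show ?thesis by simp
  qed
  also have "\<dots> = exp 52 * (ln (real N) / ln (real y))"
    using y by (simp add: exp_add exp_diff)
  finally show ?thesis .
qed

lemma rough_dvd: "rough y n \<Longrightarrow> d dvd n \<Longrightarrow> n > 0 \<Longrightarrow> rough y d"
  unfolding rough_def using dvd_prime_factors[of n d] by auto

text \<open>A logarithmic weight takes the place of a sieve: ln N = ln (N / n) + ln n, where the
  first part is at most N / n and the second is a divisor sum of \<open>mangoldt\<close>. As
  divisors of rough numbers are rough, \<open>psi_le\<close> reduces this to 4 N times the sum of 1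
  / d over rough d, and division by ln N leaves N / ln y. The range starts at 2 because 1 is rough
  for every y and would spoil the bound for small N.\<close>

lemma card_rough_le:
  "\<exists>K>0. \<forall>N y. 2 \<le> y \<longrightarrow> real (card {n \<in> {2..N}. rough y n}) \<le> K * (real N / ln (real y))"
proof (intro exI conjI allI impI)
  fix N y :: nat assume y: "2 \<le> y"
  show "real (card {n \<in> {2..N}. rough y n}) \<le> 5 * exp 52 * (real N / ln (real y))"
  proof (cases "N \<le> y")
    case True
    have "{n \<in> {2..N}. rough y n} = {}"
    proof safe
      fix n assume n: "n \<in> {2..N}" "rough y n"
      then obtain p where p: "prime p" "p dvd n" using prime_factor_nat[of n] by auto
      then have "p \<in> prime_factors n" using n by (auto simp: in_prime_factors_iff)
      then have "y < p" "p \<le> n" using n p by (auto simp: rough_def intro: dvd_imp_le)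
      then show "n \<in> {}" using n True by simp
    qed
    then show ?thesis using y by (simp only: card.empty) auto
  next
    case False
    define R where "R = {n \<in> {1..N}. rough y n}"
    have N: "y \<le> N" "N > 0" using False y by auto
    have lnN: "ln (real N) > 0" using N y by simp
    have R: "(\<Sum>n\<in>R. f n) = (\<Sum>n=1..N. if rough y n then f n else 0)" for f :: "nat \<Rightarrow> real"
      unfolding R_def by (rule sum.mono_neutral_cong_left) auto
    have "(\<Sum>n\<in>R. ln (real n)) = (\<Sum>n=1..N. \<Sum>d | d dvd n. if rough y n then mangoldt (n div d) else 0)"
      unfolding R by (intro sum.cong refl) (auto simp: sum_mangoldt_div)
    also have "\<dots> \<le> (\<Sum>n=1..N. \<Sum>d | d dvd n. if rough y d then mangoldt (n div d) else 0)"
      by (intro sum_mono) (auto intro: mangoldt_nonneg rough_dvd)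
    also have "\<dots> = (\<Sum>d=1..N. \<Sum>m=1..N div d. if rough y d then mangoldt m else 0)"
      by (rule sum_divisors_swap[where f = "\<lambda>d m. if rough y d then mangoldt m else 0"])
    also have "\<dots> = (\<Sum>d\<in>R. psi (N div d))"
      unfolding R by (intro sum.cong refl) (auto simp: psi_def)
    also have "\<dots> \<le> (\<Sum>d\<in>R. 4 * (real N / real d))"
    proof (intro sum_mono)
      fix d
      have "psi (N div d) \<le> 4 * real (N div d)" by (rule psi_le)
      also have "\<dots> \<le> 4 * (real N / real d)" by (intro mult_left_mono of_nat_div_le_of_nat) auto
      finally show "psi (N div d) \<le> 4 * (real N / real d)" .
    qed
    finally have 1: "(\<Sum>n\<in>R. ln (real n)) \<le> (\<Sum>d\<in>R. 4 * (real N / real d))" .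
    have "real (card R) * ln (real N) = (\<Sum>n\<in>R. ln (real N))" by simp
    also have "\<dots> \<le> (\<Sum>n\<in>R. real N / real n + ln (real n))"
    proof (intro sum_mono)
      fix n assume n: "n \<in> R"
      then have "ln (real N / real n) \<le> real N / real n" using N by (intro ln_bound) (auto simp: R_def)
      then show "ln (real N) \<le> real N / real n + ln (real n)" using n N by (simp add: R_def ln_div)
    qed
    also have "\<dots> \<le> (\<Sum>d\<in>R. real N / real d) + (\<Sum>d\<in>R. 4 * (real N / real d))"
      using 1 by (simp add: sum.distrib)
    also have "\<dots> = 5 * real N * (\<Sum>d\<in>R. 1 / real d)"
      by (simp add: sum_distrib_left sum.distrib[symmetric])
    also have "\<dots> \<le> 5 * real N * (exp 52 * (ln (real N) / ln (real y)))"
      using sum_rough_inverse_le[OF y N(1)] by (intro mult_left_mono) (auto simp: R_def)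
    finally have "real (card R) * ln (real N) \<le> (5 * exp 52 * (real N / ln (real y))) * ln (real N)" by (simp add: mult_ac)
    then have 2: "real (card R) \<le> 5 * exp 52 * (real N / ln (real y))" using lnN by (simp only: mult_le_cancel_right_pos)
    have "card {n \<in> {2..N}. rough y n} \<le> card R" by (intro card_mono) (auto simp: R_def)
    then show ?thesis using 2 by linarith
  qed
qed simp

lemma sum_inverse_primes_upto_le:
  assumes "2 \<le> y"
  shows "(\<Sum>p | prime p \<and> p \<le> y. 1 / real p) \<le> ln (ln (real y)) + 50"
proof -
  have "{p::nat. prime p \<and> p \<le> y} = insert 2 {p. prime p \<and> 2 < p \<and> p \<le> y}"
    using assms prime_ge_2_nat by (auto simp: le_less)
  then have "(\<Sum>p | prime p \<and> p \<le> y. 1 / real p) = 1 / 2 + (\<Sum>p | prime p \<and> 2 < p \<and> p \<le> y. 1 / real p)"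
    by simp
  moreover have "- ln (ln 2) \<le> (1::real)"
  proof -
    have "ln (1/2) \<le> ln (ln (2::real))" using ln2_ge_half by (subst ln_le_cancel_iff) auto
    then show ?thesis using ln_2_less_1 by (simp add: ln_div)
  qed
  ultimately show ?thesis using sum_inverse_primes_le[OF order.refl assms] by simp
qed

text \<open>Rankin's method: for m > sqrt N the weight m^(\<alpha> - 1) times N^(1 - \<alpha>/2) is
  at least 1, and the weights of all smooth m are bounded by an Euler product. With \<alpha> = 1 /
  ln y the factor p^\<alpha> is at most e for p <= y, so the product is still O(ln y). The
  hypothesis on y gives \<alpha> <= 1/2.\<close>

lemma card_smooth_le:
  assumes y: "ln (real y) \<ge> 2"
  shows "real (card {m \<in> {1..N}. smooth y m}) \<le> sqrt (real N) + real N * exp (- ln (real N) / (2 * ln (real y))) * (exp 100 * ln (real y))"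
proof (cases "N \<ge> 1")
  case N: True
  define \<alpha> where "\<alpha> = 1 / ln (real y)"
  have y2: "y \<ge> 2" using y by (cases "y = 0 \<or> y = 1") auto
  have \<alpha>: "0 < \<alpha>" "\<alpha> \<le> 1 / 2" using y by (auto simp: \<alpha>_def field_simps)
  define g where "g = (\<lambda>m. real m powr (\<alpha> - 1))"
  define P where "P = {p. prime p \<and> p \<le> y}"
  have fin: "finite P" by (simp add: P_def)
  have p2: "real p \<ge> 2" if "p \<in> P" for p using that prime_ge_2_nat[of p] by (simp add: P_def)
  have g34: "g p \<le> 3 / 4" if "p \<in> P" for p
  proof -
    have "g p \<le> 2 powr (\<alpha> - 1)" unfolding g_def using p2[OF that] \<alpha> by (intro powr_mono2') auto
    also have "\<dots> \<le> 2 powr (-1/2)" using \<alpha> by (intro powr_mono) auto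
    also have "\<dots> = 1 / sqrt 2" by (simp add: powr_minus powr_half_sqrt divide_simps)
    also have "\<dots> \<le> 3 / 4"
    proof -
      have "4 / 3 \<le> sqrt 2" by (rule real_le_rsqrt) (simp add: power2_eq_square)
      then show ?thesis by (simp add: field_simps)
    qed
    finally show ?thesis .
  qed
  have gp: "g p = exp (\<alpha> * ln (real p)) / real p" if "p \<in> P" for p
  proof -
    have "g p = real p powr \<alpha> / real p" using p2[OF that] by (simp add: g_def powr_diff)
    then show ?thesis using p2[OF that] by (simp add: powr_def)
  qed
  have t: "0 \<le> \<alpha> * ln (real p)" "\<alpha> * ln (real p) \<le> 1" if "p \<in> P" for p
  proof -
    show "0 \<le> \<alpha> * ln (real p)" using p2[OF that] \<alpha> by simp
    have "ln (real p) \<le> ln (real y)" using that p2[OF that] by (simp add: P_def)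
    then show "\<alpha> * ln (real p) \<le> 1" using y by (simp add: \<alpha>_def)
  qed
  have g1: "g p \<le> 1 / real p + 2 * \<alpha> * (ln (real p) / real p)" if "p \<in> P" for p
  proof -
    have "exp (\<alpha> * ln (real p)) \<le> 1 + \<alpha> * ln (real p) + (\<alpha> * ln (real p)) ^ 2"
      by (rule exp_bound[OF t[OF that]])
    also have "(\<alpha> * ln (real p)) ^ 2 \<le> \<alpha> * ln (real p)"
      using t[OF that] mult_left_mono[of "\<alpha> * ln (real p)" 1 "\<alpha> * ln (real p)"] by (simp add: power2_eq_square)
    finally have "exp (\<alpha> * ln (real p)) / real p \<le> (1 + \<alpha> * ln (real p) + \<alpha> * ln (real p)) / real p"
      by (intro divide_right_mono) auto
    then show ?thesis using gp[OF that] by (simp add: add_divide_distrib)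
  qed
  have g2: "g p ^ 2 \<le> 9 * (1 / real p) ^ 2" if "p \<in> P" for p
  proof -
    have "exp (\<alpha> * ln (real p)) \<le> exp 1" using t[OF that] by simp
    also have "\<dots> \<le> 3" using exp_le by simp
    finally have "g p \<le> 3 * (1 / real p)" using gp[OF that] by (simp add: divide_right_mono)
    then have "g p ^ 2 \<le> (3 * (1 / real p)) ^ 2" by (intro power_mono) (auto simp: g_def)
    then show ?thesis by (simp add: power_mult_distrib power2_eq_square)
  qed
  define M where "M = {m \<in> {1..N}. smooth y m}"
  have "(\<Sum>m\<in>M. g m) \<le> (\<Prod>p\<in>P. 1 / (1 - g p))"
  proof (rule sum_le_euler_product)
    fix p assume "p \<in> P"
    then show "g p < 1" using g34[of p] by simp
  next
    fix m assume "m \<in> M"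
    then show "m > 0 \<and> prime_factors m \<subseteq> P" by (auto simp: M_def P_def smooth_def)
  qed (auto simp: fin g_def M_def powr_mult P_def)
  also have "\<dots> \<le> exp ((\<Sum>p\<in>P. g p) + 4 * (\<Sum>p\<in>P. g p ^ 2))"
    by (rule prod_inverse_one_minus_le_exp) (use g34 in \<open>auto simp: g_def\<close>)
  \<comment> \<open>100 = 50 + 14 + 4 * 9: reciprocals of the primes, the correction linear in
    \<alpha> (Mertens' ln y cancels against \<alpha>), and the squares.\<close>
  also have "\<dots> \<le> exp (ln (ln (real y)) + 100)"
  proof -
    have "(\<Sum>p\<in>P. g p) \<le> (\<Sum>p\<in>P. 1 / real p + 2 * \<alpha> * (ln (real p) / real p))"
      by (intro sum_mono g1)
    also have "\<dots> = (\<Sum>p\<in>P. 1 / real p) + 2 * \<alpha> * (\<Sum>p\<in>P. ln (real p) / real p)"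
      by (simp only: sum.distrib sum_distrib_left)
    also have "(\<Sum>p\<in>P. ln (real p) / real p) = (\<Sum>n=1..y. if prime n then ln (real n) / real n else 0)"
      unfolding P_def by (rule sum.mono_neutral_cong_left) (auto simp: Suc_le_eq prime_gt_0_nat)
    also have "(\<Sum>p\<in>P. 1 / real p) + 2 * \<alpha> * (\<Sum>n=1..y. if prime n then ln (real n) / real n else 0) \<le>
        (ln (ln (real y)) + 50) + 2 * \<alpha> * (ln (real y) + 12)"
      using sum_inverse_primes_upto_le[OF y2] mertens_primes[of y] \<alpha> unfolding P_def
      by (intro add_mono mult_left_mono) auto
    also have "2 * \<alpha> * (ln (real y) + 12) \<le> 14"
      using y by (simp add: \<alpha>_def field_simps)
    finally have "(\<Sum>p\<in>P. g p) \<le> ln (ln (real y)) + 64" by simp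
    moreover have "(\<Sum>p\<in>P. g p ^ 2) \<le> 9"
    proof -
      have "(\<Sum>p\<in>P. g p ^ 2) \<le> (\<Sum>p\<in>P. 9 * (1 / real p) ^ 2)" by (intro sum_mono g2)
      also have "\<dots> = 9 * (\<Sum>p\<in>P. (1 / real p) ^ 2)" by (simp only: sum_distrib_left)
      also have "\<dots> \<le> 9 * 1"
        using p2 by (intro mult_left_mono sum_inverse_square_primes_le[OF fin]) (auto simp: P_def prime_ge_2_nat)
      finally show ?thesis by simp
    qed
    ultimately show ?thesis by simp
  qed
  also have "\<dots> = exp 100 * ln (real y)" using y by (simp add: exp_add)
  finally have sumM: "(\<Sum>m\<in>M. g m) \<le> exp 100 * ln (real y)" .
  define c where "c = real N * exp (- ln (real N) / (2 * ln (real y)))"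
  have c0: "c \<ge> 0" by (simp add: c_def)
  define M' where "M' = {m \<in> M. sqrt (real N) < real m}"
  have finM: "finite M" by (simp add: M_def)
  have "real (card M') = (\<Sum>m\<in>M'. 1)" by simp
  also have "\<dots> \<le> (\<Sum>m\<in>M'. c * g m)"
  proof (intro sum_mono)
    fix m assume m: "m \<in> M'"
    then have m': "1 \<le> m" "m \<le> N" "sqrt (real N) < real m" by (auto simp: M'_def M_def)
    have "exp (ln (real N) / (2 * ln (real y))) = sqrt (real N) powr \<alpha>"
      using N by (simp add: powr_def \<alpha>_def ln_sqrt)
    also have "\<dots> \<le> real m powr \<alpha>" using m' \<alpha> by (intro powr_mono2) auto
    also have "\<dots> = real m * g m" using m' by (simp add: g_def powr_diff)
    also have "\<dots> \<le> real N * g m" using m' by (intro mult_right_mono) (auto simp: g_def)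
    finally have "exp (- ln (real N) / (2 * ln (real y))) * exp (ln (real N) / (2 * ln (real y))) \<le> exp (- ln (real N) / (2 * ln (real y))) * (real N * g m)"
      by (intro mult_left_mono) auto
    then show "1 \<le> c * g m" by (simp add: c_def mult_ac flip: exp_add)
  qed
  also have "\<dots> \<le> (\<Sum>m\<in>M. c * g m)"
    using finM c0 by (intro sum_mono2) (auto simp: M'_def g_def)
  also have "\<dots> = c * (\<Sum>m\<in>M. g m)" by (simp only: sum_distrib_left)
  also have "\<dots> \<le> c * (exp 100 * ln (real y))" using sumM c0 by (rule mult_left_mono)
  finally have 1: "real (card M') \<le> c * (exp 100 * ln (real y))" .
  have "M \<subseteq> {1..nat \<lfloor>sqrt (real N)\<rfloor>} \<union> M'"
    by (auto simp: M'_def M_def le_nat_iff le_floor_iff)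
  then have "card M \<le> card ({1..nat \<lfloor>sqrt (real N)\<rfloor>} \<union> M')"
    using finM by (intro card_mono) (auto simp: M'_def)
  also have "\<dots> \<le> nat \<lfloor>sqrt (real N)\<rfloor> + card M'"
    using card_Un_le[of "{1..nat \<lfloor>sqrt (real N)\<rfloor>}" M'] by simp
  finally have "real (card M) \<le> real (nat \<lfloor>sqrt (real N)\<rfloor> + card M')" by (simp only: of_nat_le_iff)
  also have "\<dots> \<le> sqrt (real N) + real (card M')" by simp
  finally show ?thesis using 1 by (simp add: M_def c_def)
qed (use y in auto)

lemma ex_smooth_cutoff:
  "\<exists>K>0. \<exists>N0. \<forall>N\<ge>N0. \<exists>y\<ge>2. 1 / ln (real y) \<le> K * (lam N / ln (real N + 2)) \<and>
     real (card {m \<in> {1..N}. smooth y m}) \<le> K * (real N / ln (real N + 2))"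
proof -
  \<comment> \<open>The cutoff is a compromise. The 4 makes Rankin's factor exp (- ln x / (2 ln y))
    at most (ln x)^(-2), enough to beat an Euler product of size ln y, while 1 / ln y exceeds 1 / ln
    x only by a multiple of ln ln x.\<close>
  define Y where "Y = (\<lambda>x::real. exp (ln x / (4 * ln (ln x))))"
  have "eventually (\<lambda>x::real. Y x \<ge> exp 4 \<and> ln (ln x) \<ge> 1 \<and> ln (x + 2) \<le> 2 * ln x \<and> ln x > 0 \<and> x > 0) at_top"
    unfolding Y_def by (intro eventually_conj; real_asymp)
  then obtain x0 where x0: "\<And>x. x \<ge> x0 \<Longrightarrow> Y x \<ge> exp 4 \<and> ln (ln x) \<ge> 1 \<and> ln (x + 2) \<le> 2 * ln x \<and> ln x > 0 \<and> x > 0"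
    by (auto simp: eventually_at_top_linorder)
  define K :: real where "K = 16 + 2 * exp 100"
  have K: "K \<ge> 16" "K \<ge> 2 * exp 100 + 4" by (auto simp: K_def)
  have "\<exists>y\<ge>2. 1 / ln (real y) \<le> K * (lam N / ln (real N + 2)) \<and>
     real (card {m \<in> {1..N}. smooth y m}) \<le> K * (real N / ln (real N + 2))" if N: "N \<ge> nat \<lceil>x0\<rceil>" for N
  proof -
    have "real N \<ge> x0" using N by linarith
    note N0 = x0[OF this]
    define L where "L = ln (real N)"
    define LL where "LL = ln L"
    have L: "L > 0" "LL \<ge> 1" "ln (real N + 2) \<le> 2 * L" "real N > 0" using N0 by (auto simp: L_def LL_def)
    define y where "y = nat \<lfloor>Y (real N)\<rfloor>"
    have Y4: "Y (real N) \<ge> exp 4" using N0 by simp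
    have Ypos: "Y (real N) > 0" by (simp add: Y_def)
    have lnY: "ln (Y (real N)) = L / (4 * LL)" by (simp add: Y_def L_def LL_def)
    have yY: "real y \<le> Y (real N)" unfolding y_def using Ypos by simp
    have e4: "exp 4 \<ge> (5::real)" using exp_ge_add_one_self[of 4] by simp
    have y1: "real y \<ge> Y (real N) - 1" unfolding y_def by linarith
    \<comment> \<open>Rounding Y down to an integer thus costs at most half of its
      logarithm.\<close>
    have "sqrt (Y (real N)) \<le> Y (real N) - 1"
    proof (rule real_le_lsqrt)
      have "5 * Y (real N) \<le> Y (real N) * Y (real N)" using Y4 e4 Ypos by (intro mult_right_mono) auto
      moreover have "(Y (real N) - 1) ^ 2 = Y (real N) * Y (real N) - 2 * Y (real N) + 1"
        by (simp add: power2_eq_square algebra_simps)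
      ultimately show "Y (real N) \<le> (Y (real N) - 1) ^ 2" using Ypos by linarith
    qed (use Y4 e4 in auto)
    then have ys: "real y \<ge> sqrt (Y (real N))" using y1 by simp
    have ypos: "real y > 0" using y1 Y4 e4 by simp
    have "ln (real y) \<ge> ln (sqrt (Y (real N)))" using ys Ypos ypos by (subst ln_le_cancel_iff) auto
    then have lny: "ln (real y) \<ge> L / (4 * LL) / 2" using Ypos by (simp add: ln_sqrt lnY)
    have "4 \<le> L / (4 * LL)" using Y4 Ypos unfolding lnY[symmetric] by (simp add: ln_ge_iff)
    then have lny2: "ln (real y) \<ge> 2" using lny by argo
    have lny': "ln (real y) \<le> L / (4 * LL)" using yY ypos Ypos unfolding lnY[symmetric] by (subst ln_le_cancel_iff) auto
    have "y \<ge> 2" using lny2 by (cases "y = 0 \<or> y = 1") auto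
    have ln2: "ln (real N + 2) > 0" by simp
    have LLlam: "LL \<le> lam N"
    proof -
      have "LL \<le> ln (ln (real N + 2))" unfolding LL_def L_def using L by (subst ln_le_cancel_iff) (auto simp: L_def)
      then show ?thesis by (simp add: lam_def)
    qed
    have "1 / ln (real y) \<le> 1 / (L / (4 * LL) / 2)"
      using lny L lny2 by (intro divide_left_mono) auto
    also have "\<dots> = 16 * LL / (2 * L)" using L by simp
    also have "\<dots> \<le> 16 * lam N / ln (real N + 2)"
      using LLlam L ln2 by (intro frac_le) auto
    also have "\<dots> = 16 * (lam N / ln (real N + 2))" by simp
    also have "\<dots> \<le> K * (lam N / ln (real N + 2))"
      using K LLlam L by (intro mult_right_mono) auto
    finally have 1: "1 / ln (real y) \<le> K * (lam N / ln (real N + 2))" .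
    have "real (card {m \<in> {1..N}. smooth y m}) \<le> sqrt (real N) + real N * exp (- ln (real N) / (2 * ln (real y))) * (exp 100 * ln (real y))"
      by (rule card_smooth_le[OF lny2])
    also have "\<dots> \<le> 2 * (real N / L) + exp 100 * (real N / L)"
    proof (intro add_mono)
      have "L \<le> 2 * sqrt (real N)" using ln_bound[of "sqrt (real N)"] L by (simp add: L_def ln_sqrt)
      then have "L * sqrt (real N) \<le> 2 * sqrt (real N) * sqrt (real N)" by (intro mult_right_mono) auto
      also have "\<dots> = 2 * real N" by simp
      finally show "sqrt (real N) \<le> 2 * (real N / L)" using L by (simp add: pos_le_divide_eq mult.commute)
      have "exp (- ln (real N) / (2 * ln (real y))) \<le> exp (- (2 * LL))"
      proof -
        have "ln (real y) * (4 * LL) \<le> L" using lny' L by (simp add: field_simps)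
        then have "2 * LL \<le> L / (2 * ln (real y))" using lny2 by (simp add: field_simps)
        then show ?thesis by (simp add: L_def)
      qed
      also have "\<dots> = 1 / L ^ 2" using L by (simp add: LL_def exp_minus exp_double divide_simps)
      finally have e: "exp (- ln (real N) / (2 * ln (real y))) \<le> 1 / L ^ 2" .
      have "L / (4 * LL) \<le> L" using L by (simp add: field_simps)
      then have "ln (real y) \<le> L" using lny' by simp
      with e have "real N * exp (- ln (real N) / (2 * ln (real y))) * (exp 100 * ln (real y)) \<le> real N * (1 / L ^ 2) * (exp 100 * L)"
        using lny2 by (intro mult_mono) auto
      then show "real N * exp (- ln (real N) / (2 * ln (real y))) * (exp 100 * ln (real y)) \<le> exp 100 * (real N / L)"
        using L by (simp add: power2_eq_square mult.commute)
    qed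
    also have "\<dots> = (2 + exp 100) * (real N / L)" by (simp only: distrib_right)
    also have "\<dots> \<le> (2 + exp 100) * (real N / (ln (real N + 2) / 2))"
      using L by (intro mult_left_mono divide_left_mono) auto
    also have "\<dots> = (2 * exp 100 + 4) * (real N / ln (real N + 2))" by (simp add: field_simps)
    also have "\<dots> \<le> K * (real N / ln (real N + 2))" using K by (intro mult_right_mono) auto
    finally show ?thesis using 1 \<open>y \<ge> 2\<close> by blast
  qed
  moreover have "K > 0" using K by simp
  ultimately show ?thesis by blast
qed

section \<open>The largest prime factor\<close>

text \<open>The inserted 1 keeps \<open>Max\<close> off the empty set, gives the value 1 at n <= 1,
  and makes \<open>gpf n \<le> y\<close> agree with smoothness for y >= 1.\<close>

definition gpf :: "nat \<Rightarrow> nat" where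
  "gpf n = Max (insert 1 (prime_factors n))"

lemma gpf_le_iff: "y \<ge> 1 \<Longrightarrow> gpf n \<le> y \<longleftrightarrow> smooth y n"
  by (auto simp: gpf_def smooth_def)

lemma gpf_ge: "p \<in> prime_factors n \<Longrightarrow> p \<le> gpf n"
  by (auto simp: gpf_def)

lemma gpf_ge_1: "gpf n \<ge> 1"
  by (auto simp: gpf_def)

lemma gpf_in_prime_factors:
  assumes "n > 1"
  shows "gpf n \<in> prime_factors n"
proof -
  obtain p where p: "prime p" "p dvd n" using prime_factor_nat[of n] assms by auto
  then have "p \<in> prime_factors n" using assms by (auto simp: in_prime_factors_iff)
  then have "gpf n \<noteq> 1" using gpf_ge[of p n] prime_gt_1_nat[OF p(1)] by auto
  moreover have "gpf n \<in> insert 1 (prime_factors n)" unfolding gpf_def by (rule Max_in) auto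
  ultimately show ?thesis by auto
qed

lemma gpf_mult_prime:
  assumes "prime p" "b > 0" "gpf b \<le> p"
  shows "gpf (p * b) = p"
proof -
  have "prime_factors (p * b) = insert p (prime_factors b)"
    using assms by (subst prime_factors_product) (auto simp: prime_prime_factors dest: prime_gt_0_nat)
  moreover have "q \<le> p" if "q \<in> prime_factors b" for q using gpf_ge[OF that] assms by simp
  ultimately show ?thesis
    unfolding gpf_def using assms prime_gt_0_nat[OF assms(1)] by (intro Max_eqI) auto
qed

lemma gpf_decompose:
  assumes "n > 1"
  shows "prime (gpf n)" "n = gpf n * (n div gpf n)" "n div gpf n > 0" "gpf (n div gpf n) \<le> gpf n"
proof -
  have p: "gpf n \<in> prime_factors n" by (rule gpf_in_prime_factors[OF assms])
  then show "prime (gpf n)" "n = gpf n * (n div gpf n)" by auto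
  then show pos: "n div gpf n > 0" using assms by (intro Nat.gr0I) auto
  have "prime_factors (n div gpf n) \<subseteq> prime_factors n"
  proof (intro dvd_prime_factors)
    show "n div gpf n dvd n" using \<open>n = gpf n * (n div gpf n)\<close> by (metis dvd_triv_right)
  qed (use assms in auto)
  then have "q \<le> gpf n" if "q \<in> prime_factors (n div gpf n)" for q
    using that gpf_ge by blast
  then show "gpf (n div gpf n) \<le> gpf n" using gpf_ge_1[of n] by (subst (1) gpf_def) auto
qed

text \<open>Every m > 1 is uniquely p * b with p prime and \<open>gpf b \<le> p\<close>. The
  restriction on b is again a strict truncation, by \<open>Suc p\<close>, so sums of the same kind
  reappear inside.\<close>

lemma sum_largest_prime:
  fixes F :: "nat \<Rightarrow> nat \<Rightarrow> 'a::comm_monoid_add"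
  shows "(\<Sum>m | m \<in> {1..N} \<and> m > 1 \<and> gpf m < w. F (gpf m) (m div gpf m)) =
    (\<Sum>p | prime p \<and> p \<le> N \<and> p < w. \<Sum>b | b \<in> {1..N div p} \<and> gpf b < Suc p. F p b)"
proof -
  have "(\<Sum>p | prime p \<and> p \<le> N \<and> p < w. \<Sum>b | b \<in> {1..N div p} \<and> gpf b < Suc p. F p b) =
    (\<Sum>(p,b)\<in>(SIGMA p:{p. prime p \<and> p \<le> N \<and> p < w}. {b. b \<in> {1..N div p} \<and> gpf b < Suc p}). F p b)"
    by (subst sum.Sigma) auto
  also have "\<dots> = (\<Sum>m | m \<in> {1..N} \<and> m > 1 \<and> gpf m < w. F (gpf m) (m div gpf m))"
  proof (rule sum.reindex_bij_witness[where i = "\<lambda>m. (gpf m, m div gpf m)" and j = "\<lambda>(p,b). p * b"], goal_cases)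
    case (1 a)
    then show ?case by (auto simp: gpf_mult_prime less_Suc_eq_le dest: prime_gt_0_nat)
  next
    case (2 a)
    then obtain p b where a: "a = (p, b)" "prime p" "p \<le> N" "p < w" "1 \<le> b" "b \<le> N div p" "gpf b \<le> p" by auto
    have "p * b \<le> N" using a mult_le_mono2[of b "N div p" p] times_div_less_eq_dividend[of p N] by linarith
    moreover have "p * b > 1" using prime_gt_1_nat[OF a(2)] a(5) by (metis One_nat_def less_1_mult less_le_trans linorder_neqE_nat mult.right_neutral not_less)
    ultimately show ?case using a prime_gt_0_nat[OF a(2)] by (auto simp: gpf_mult_prime Suc_le_eq)
  next
    case (3 m)
    then show ?case using gpf_decompose(2)[of m] by auto
  next
    case (4 m)
    then have m: "m > 1" "m \<le> N" "gpf m < w" by auto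
    have "gpf m \<le> m" using gpf_in_prime_factors[OF m(1)] m(1) by (auto intro: dvd_imp_le)
    then show ?case using gpf_decompose[OF m(1)] m by (auto simp: less_Suc_eq_le Suc_le_eq intro: div_le_mono)
  next
    case (5 a)
    then show ?case by (auto simp: gpf_mult_prime less_Suc_eq_le dest: prime_gt_0_nat)
  qed
  finally show ?thesis ..
qed

text \<open>
  The truncation by \<open>w\<close> makes the notion stable under removal of the largest prime \<open>p\<close>, since the
  cofactor is then restricted to primes up to \<open>p\<close>.
\<close>
definition small_sums :: "nat \<Rightarrow> (nat \<Rightarrow> real) \<Rightarrow> bool" where
  "small_sums A g \<longleftrightarrow> (\<exists>K. \<forall>N w. \<bar>\<Sum>b | b \<in> {1..N} \<and> gpf b < w. g b\<bar> \<le> K * (real N * lam N ^ A / ln (real N + 2)))"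

text \<open>For N < N0 the trivial bound G * N is absorbed into the constant at the cost of a factor
  ln (N0 + 2).\<close>

lemma small_sumsI:
  assumes g: "\<And>n. \<bar>g n\<bar> \<le> G"
    and K: "\<And>N w. N \<ge> N0 \<Longrightarrow> \<bar>\<Sum>b | b \<in> {1..N} \<and> gpf b < w. g b\<bar> \<le> K * (real N * lam N ^ A / ln (real N + 2))"
  shows "small_sums A g"
  unfolding small_sums_def
proof (intro exI allI)
  fix N w :: nat
  have G: "G \<ge> 0" using g[of 0] by simp
  define M where "M = real N * lam N ^ A / ln (real N + 2)"
  have M: "M \<ge> 0" using lam_ge_1[of N] by (cases "N = 0") (auto simp: M_def)
  have l0: "ln (real N0 + 2) \<ge> 0" by simp
  have "\<bar>\<Sum>b | b \<in> {1..N} \<and> gpf b < w. g b\<bar> \<le> max K (G * ln (real N0 + 2)) * M"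
  proof (cases "N \<ge> N0")
    case True
    then have "\<bar>\<Sum>b | b \<in> {1..N} \<and> gpf b < w. g b\<bar> \<le> K * M" unfolding M_def by (rule K)
    also have "\<dots> \<le> max K (G * ln (real N0 + 2)) * M" using M by (intro mult_right_mono) auto
    finally show ?thesis .
  next
    case False
    show ?thesis
    proof (cases "N = 0")
      case N: False
      have "\<bar>\<Sum>b | b \<in> {1..N} \<and> gpf b < w. g b\<bar> \<le> (\<Sum>b | b \<in> {1..N} \<and> gpf b < w. G)"
        by (intro order.trans[OF sum_abs] sum_mono g)
      also have "\<dots> \<le> (\<Sum>b=1..N. G)" using G by (intro sum_mono2) auto
      also have "\<dots> = G * real N" by simp
      also have "\<dots> \<le> G * (ln (real N0 + 2) * M)"
      proof (intro mult_left_mono G)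
        have "1 \<le> lam N ^ A" using lam_ge_1[of N] N by (intro one_le_power) auto
        moreover have "1 \<le> ln (real N0 + 2) / ln (real N + 2)" using False by simp
        ultimately have "1 * 1 \<le> ln (real N0 + 2) / ln (real N + 2) * lam N ^ A" by (intro mult_mono) auto
        then have "real N * 1 \<le> real N * (ln (real N0 + 2) / ln (real N + 2) * lam N ^ A)" by (intro mult_left_mono) auto
        then show "real N \<le> ln (real N0 + 2) * M" by (simp add: M_def mult_ac)
      qed
      also have "\<dots> = (G * ln (real N0 + 2)) * M" by simp
      also have "\<dots> \<le> max K (G * ln (real N0 + 2)) * M" using M by (intro mult_right_mono) auto
      finally show ?thesis .
    qed (use M in \<open>auto simp: M_def\<close>)
  qed
  then show "\<bar>\<Sum>b | b \<in> {1..N} \<and> gpf b < w. g b\<bar> \<le> max K (G * ln (real N0 + 2)) * (real N * lam N ^ A / ln (real N + 2))"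
    by (simp only: M_def)
qed

text \<open>If g depends on the largest prime, \<open>strip g\<close> reads off the next one,
  counted with multiplicity.\<close>

definition strip :: "(nat \<Rightarrow> real) \<Rightarrow> nat \<Rightarrow> real" where
  "strip g m = (if m \<le> 1 then 0 else g (m div gpf m))"

lemma sum_gt_1_eq:
  fixes f :: "nat \<Rightarrow> 'a::comm_monoid_add"
  assumes "\<And>m. m \<le> 1 \<Longrightarrow> f m = 0"
  shows "(\<Sum>m | m \<in> {1..N} \<and> gpf m < w. f m) = (\<Sum>m | m \<in> {1..N} \<and> m > 1 \<and> gpf m < w. f m)"
proof (rule sum.mono_neutral_right)
  show "\<forall>m\<in>{m. m \<in> {1..N} \<and> gpf m < w} - {m. m \<in> {1..N} \<and> m > 1 \<and> gpf m < w}. f m = 0"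
    by (intro ballI assms) auto
qed auto

text \<open>Sorting m by p = \<open>gpf m\<close> leaves a sum of g over cofactors up to
  \<open>N div p\<close>, truncated at \<open>Suc p\<close>, to which the hypothesis applies.
  Summing these bounds over p costs one factor \<open>lam N\<close>.\<close>

lemma small_sums_strip:
  assumes "small_sums A g"
  shows "small_sums (Suc A) (strip g)"
proof -
  obtain K0 where K0: "\<And>N w. \<bar>\<Sum>b | b \<in> {1..N} \<and> gpf b < w. g b\<bar> \<le> K0 * (real N * lam N ^ A / ln (real N + 2))"
    using assms unfolding small_sums_def by blast
  define K where "K = max K0 0"
  have K: "K \<ge> 0" by (simp add: K_def)
  have "\<bar>\<Sum>b | b \<in> {1..N} \<and> gpf b < w. strip g b\<bar> \<le> K * 3840 * (real N * lam N ^ Suc A / ln (real N + 2))" for N w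
  proof -
    have "(\<Sum>b | b \<in> {1..N} \<and> gpf b < w. strip g b) = (\<Sum>m | m \<in> {1..N} \<and> m > 1 \<and> gpf m < w. g (m div gpf m))"
      by (subst sum_gt_1_eq) (auto simp: strip_def intro!: sum.cong)
    also have "\<dots> = (\<Sum>p | prime p \<and> p \<le> N \<and> p < w. \<Sum>b | b \<in> {1..N div p} \<and> gpf b < Suc p. g b)"
      by (rule sum_largest_prime)
    finally have eq: "(\<Sum>b | b \<in> {1..N} \<and> gpf b < w. strip g b) =
      (\<Sum>p | prime p \<and> p \<le> N \<and> p < w. \<Sum>b | b \<in> {1..N div p} \<and> gpf b < Suc p. g b)" .
    have "\<bar>\<Sum>b | b \<in> {1..N} \<and> gpf b < w. strip g b\<bar> \<le> (\<Sum>p | prime p \<and> p \<le> N \<and> p < w. K * lam N ^ A * (real (N div p) / ln (real (N div p) + 2)))"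
    unfolding eq
    proof (rule order.trans[OF sum_abs], rule sum_mono)
      fix p assume p: "p \<in> {p. prime p \<and> p \<le> N \<and> p < w}"
      then have "N div p \<ge> 1" by (simp add: div_greater_zero_iff prime_gt_0_nat Suc_le_eq)
      then have lam: "1 \<le> lam (N div p)" "lam (N div p) \<le> lam N" by (auto intro: lam_ge_1 lam_mono)
      have "\<bar>\<Sum>b | b \<in> {1..N div p} \<and> gpf b < Suc p. g b\<bar> \<le> K0 * (real (N div p) * lam (N div p) ^ A / ln (real (N div p) + 2))"
        by (rule K0)
      also have "\<dots> \<le> K * (real (N div p) * lam N ^ A / ln (real (N div p) + 2))"
        using lam by (intro mult_mono divide_right_mono mult_left_mono power_mono) (auto simp: K_def)
      finally show "\<bar>\<Sum>b | b \<in> {1..N div p} \<and> gpf b < Suc p. g b\<bar> \<le> K * lam N ^ A * (real (N div p) / ln (real (N div p) + 2))"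
        by (simp add: mult_ac)
    qed
    also have "\<dots> \<le> (\<Sum>p | prime p \<and> p \<le> N. K * lam N ^ A * (real (N div p) / ln (real (N div p) + 2)))"
    proof (intro sum_mono2)
      fix p assume "p \<in> {p. prime p \<and> p \<le> N} - {p. prime p \<and> p \<le> N \<and> p < w}"
      then have "p \<ge> 1" "p \<le> N" by (auto simp: Suc_le_eq prime_gt_0_nat)
      then have "N \<ge> 1" by simp
      then show "0 \<le> K * lam N ^ A * (real (N div p) / ln (real (N div p) + 2))"
        using K lam_ge_1[of N] by simp
    qed auto
    also have "\<dots> = K * lam N ^ A * (\<Sum>p | prime p \<and> p \<le> N. real (N div p) / ln (real (N div p) + 2))"
      by (simp only: sum_distrib_left)
    also have "\<dots> \<le> K * lam N ^ A * (3840 * (real N * lam N / ln (real N + 2)))"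
    proof (cases "N = 0")
      case False
      then show ?thesis using K lam_ge_1[of N] by (intro mult_left_mono sum_primes_div_ln_le) auto
    next
      case True
      have "{p. prime p \<and> p \<le> (0::nat)} = {}" by auto
      then show ?thesis using True by simp
    qed
    finally show ?thesis by (simp add: mult_ac)
  qed
  then show ?thesis unfolding small_sums_def by blast
qed

text \<open>The main-term coefficient when the t-smooth integers up to s are counted by
  inclusion-exclusion over the primes above t. Truncation at s leaves at most s rounding
  errors.\<close>

definition rough_moebius_sum :: "nat \<Rightarrow> nat \<Rightarrow> real" where
  "rough_moebius_sum t s = (\<Sum>d | d \<in> {1..s} \<and> rough t d. of_int (moebius_mu d) / real d)"

lemma abs_moebius_mu_le: "\<bar>real_of_int (moebius_mu d)\<bar> \<le> 1"
  by (simp add: moebius_mu_def)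

text \<open>Summed over the rough divisors of n, the Moebius function is the indicator of
  smoothness: only subsets of the primes above t survive, and their alternating sum vanishes unless
  there are no such primes.\<close>

lemma sum_rough_moebius_eq_card_smooth:
  "(\<Sum>d | d \<in> {1..s} \<and> rough t d. of_int (moebius_mu d) * real (s div d)) = real (card {b \<in> {1..s}. smooth t b})"
proof -
  have inner: "(\<Sum>d | d dvd n. of_int (moebius_mu d) * of_bool (rough t d)) = (of_bool (smooth t n) :: real)" if n: "n > 0" for n
  proof -
    have "(\<Sum>d | d dvd n. of_int (moebius_mu d) * of_bool (rough t d)) =
        (\<Sum>T\<in>Pow (prime_factors n). (-1) ^ card T * (of_bool (rough t (\<Prod>T)) :: real))"
      by (rule sum_moebius_divisors[OF n])
    also have "\<dots> = (\<Sum>T\<in>Pow {p\<in>prime_factors n. t < p}. (-1) ^ card T)"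
    proof (rule sum.mono_neutral_cong_right)
      show "\<forall>T\<in>Pow (prime_factors n) - Pow {p\<in>prime_factors n. t < p}. (-1) ^ card T * (of_bool (rough t (\<Prod>T)) :: real) = 0"
      proof
        fix T assume T: "T \<in> Pow (prime_factors n) - Pow {p\<in>prime_factors n. t < p}"
        then have "prime_factors (\<Prod>T) = T" by (intro prime_factors_prod_primes) auto
        then have "\<not>rough t (\<Prod>T)" using T unfolding rough_def by auto
        then show "(-1) ^ card T * (of_bool (rough t (\<Prod>T)) :: real) = 0" by simp
      qed
      fix T assume T: "T \<in> Pow {p\<in>prime_factors n. t < p}"
      then have "prime_factors (\<Prod>T) = T" by (intro prime_factors_prod_primes[of _ n]) auto
      then have "rough t (\<Prod>T)" using T unfolding rough_def by auto
      then show "(-1) ^ card T * (of_bool (rough t (\<Prod>T)) :: real) = (-1) ^ card T" by simp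
    qed auto
    also have "\<dots> = of_bool (smooth t n)"
      by (subst sum_alternating) (auto simp: smooth_def not_less)
    finally show ?thesis .
  qed
  have "(\<Sum>d | d \<in> {1..s} \<and> rough t d. of_int (moebius_mu d) * real (s div d)) =
    (\<Sum>d=1..s. \<Sum>m=1..s div d. of_int (moebius_mu d) * of_bool (rough t d))"
    by (rule sum.mono_neutral_cong_left) auto
  also have "\<dots> = (\<Sum>n=1..s. \<Sum>d | d dvd n. of_int (moebius_mu d) * of_bool (rough t d))"
    by (rule sum_divisors_swap[symmetric])
  also have "\<dots> = (\<Sum>n=1..s. of_bool (smooth t n))"
    by (intro sum.cong refl inner) auto
  also have "\<dots> = real (card {b \<in> {1..s}. smooth t b})"
    by (subst sum_of_bool_eq) (auto simp: Int_def intro!: arg_cong[of _ _ card])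
  finally show ?thesis .
qed

text \<open>The classical argument for sums of mu(d) / d: multiplied by s, the sum differs from a
  count of smooth integers, at most s, by a rounding error of at most 1 for each d, again at most s
  in total.\<close>

lemma abs_rough_moebius_sum_le: "\<bar>rough_moebius_sum t s\<bar> \<le> 2"
proof (cases "s = 0")
  case False
  let ?D = "{d. d \<in> {1..s} \<and> rough t d}"
  have "real s * rough_moebius_sum t s = (\<Sum>d\<in>?D. of_int (moebius_mu d) * real (s div d)) +
     (\<Sum>d\<in>?D. of_int (moebius_mu d) * (real s / real d - real (s div d)))"
    by (simp add: rough_moebius_sum_def sum_distrib_left sum.distrib[symmetric] algebra_simps)
  then have "\<bar>real s * rough_moebius_sum t s\<bar> \<le> \<bar>real (card {b \<in> {1..s}. smooth t b})\<bar> +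
     \<bar>\<Sum>d\<in>?D. of_int (moebius_mu d) * (real s / real d - real (s div d))\<bar>"
    unfolding sum_rough_moebius_eq_card_smooth by (simp only: abs_triangle_ineq)
  also have "\<bar>\<Sum>d\<in>?D. of_int (moebius_mu d) * (real s / real d - real (s div d))\<bar> \<le> (\<Sum>d\<in>?D. 1 * 1)"
  proof (intro order.trans[OF sum_abs] sum_mono, unfold abs_mult, intro mult_mono abs_moebius_mu_le)
    fix d
    show "\<bar>real s / real d - real (s div d)\<bar> \<le> 1"
      using real_div_minus_one_le[of s d] of_nat_div_le_of_nat[of s d, where ?'a = real] by (simp add: abs_le_iff)
  qed auto
  also have "(\<Sum>d\<in>?D. 1 * 1) = real (card ?D)" by simp
  also have "card ?D \<le> card {1..s}" by (intro card_mono) auto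
  also have "\<bar>real (card {b \<in> {1..s}. smooth t b})\<bar> \<le> real s"
  proof -
    have "card {b \<in> {1..s}. smooth t b} \<le> card {1..s}" by (intro card_mono) auto
    then show ?thesis by simp
  qed
  finally have "real s * \<bar>rough_moebius_sum t s\<bar> \<le> real s * 2" by (simp add: abs_mult)
  then show ?thesis using False by (simp add: mult_le_cancel_left_pos)
qed (auto simp: rough_moebius_sum_def)

lemma moebius_mu_mult_prime:
  assumes "prime p" "\<not>p dvd e"
  shows "moebius_mu (p * e) = - moebius_mu e"
proof (cases "e = 0")
  case False
  have cop: "coprime p e" using assms by (simp add: prime_imp_coprime)
  have "prime_factors (p * e) = insert p (prime_factors e)"
    using assms False by (subst prime_factors_product) (auto simp: prime_prime_factors)
  moreover have "p \<notin> prime_factors e" using assms by auto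
  ultimately have "omega (p * e) = Suc (omega e)" by (simp add: omega_def)
  moreover have "squarefree (p * e) \<longleftrightarrow> squarefree e"
    using assms(1) cop squarefree_prime[OF assms(1)] by (auto intro: squarefree_mult_coprime squarefree_mono[of e "p * e"])
  ultimately show ?thesis by (simp add: moebius_mu_def)
qed (auto simp: moebius_mu_def)

lemma rough_Suc_iff: "rough (Suc t) d \<longleftrightarrow> rough t d \<and> \<not>(prime (Suc t) \<and> Suc t dvd d \<and> d > 0)"
proof
  assume R: "rough (Suc t) d"
  show "rough t d \<and> \<not>(prime (Suc t) \<and> Suc t dvd d \<and> d > 0)"
  proof (intro conjI notI)
    show "rough t d" using R by (auto simp: rough_def)
    assume "prime (Suc t) \<and> Suc t dvd d \<and> d > 0"
    then have "Suc t \<in> prime_factors d" by (auto simp: in_prime_factors_iff)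
    then show False using R by (auto simp: rough_def)
  qed
next
  assume R: "rough t d \<and> \<not>(prime (Suc t) \<and> Suc t dvd d \<and> d > 0)"
  show "rough (Suc t) d" unfolding rough_def
  proof
    fix p assume p: "p \<in> prime_factors d"
    have "d > 0" using p by (intro Nat.gr0I) auto
    moreover have "t < p" "prime p" "p dvd d" using p R by (auto simp: rough_def)
    ultimately have "p \<noteq> Suc t" using R by blast
    then show "Suc t < p" using \<open>t < p\<close> by simp
  qed
qed

text \<open>An identity of Buchstab type. The levels t and t + 1 differ in the d divisible by the
  prime q = t + 1; such d = q e contributes - mu(e) / (q e) if e is q-rough, and 0 if q divides e
  again.\<close>

lemma rough_moebius_sum_Suc:
  "rough_moebius_sum t s = rough_moebius_sum (Suc t) s -
     (if prime (Suc t) then rough_moebius_sum (Suc t) (s div Suc t) / real (Suc t) else 0)"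
proof (cases "prime (Suc t)")
  case False
  then show ?thesis by (simp add: rough_moebius_sum_def rough_Suc_iff)
next
  case True
  let ?f = "\<lambda>d. real_of_int (moebius_mu d) / real d"
  define q where "q = Suc t"
  have q: "prime q" "q > 0" using True by (auto simp: q_def)
  have "{d. d \<in> {1..s} \<and> rough t d} = {d. d \<in> {1..s} \<and> rough q d} \<union> {d. d \<in> {1..s} \<and> rough t d \<and> q dvd d}"
    using True by (auto simp: q_def rough_Suc_iff)
  moreover have "{d. d \<in> {1..s} \<and> rough q d} \<inter> {d. d \<in> {1..s} \<and> rough t d \<and> q dvd d} = {}"
    using True by (auto simp: q_def rough_Suc_iff)
  ultimately have "rough_moebius_sum t s = rough_moebius_sum q s + (\<Sum>d | d \<in> {1..s} \<and> rough t d \<and> q dvd d. ?f d)"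
    unfolding rough_moebius_sum_def by (simp add: sum.union_disjoint)
  also have "(\<Sum>d | d \<in> {1..s} \<and> rough t d \<and> q dvd d. ?f d) = (\<Sum>d\<in>(\<lambda>e. q * e) ` {e. e \<in> {1..s div q} \<and> rough q e}. ?f d)"
  proof (rule sum.mono_neutral_right)
    show "(\<lambda>e. q * e) ` {e. e \<in> {1..s div q} \<and> rough q e} \<subseteq> {d. d \<in> {1..s} \<and> rough t d \<and> q dvd d}"
    proof safe
      fix e assume e: "e \<in> {1..s div q}" "rough q e"
      have "q * e \<le> q * (s div q)" using e by auto
      also have "\<dots> \<le> s" by simp
      finally have "q * e \<le> s" .
      then show "q * e \<in> {1..s}" using e q by auto
      have "prime_factors (q * e) = insert q (prime_factors e)"
        using e q by (subst prime_factors_product) (auto simp: prime_prime_factors)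
      then show "rough t (q * e)" using e by (auto simp: rough_def q_def)
    qed auto
    show "\<forall>d\<in>{d. d \<in> {1..s} \<and> rough t d \<and> q dvd d} - (\<lambda>e. q * e) ` {e. e \<in> {1..s div q} \<and> rough q e}. ?f d = 0"
    proof
      fix d assume d: "d \<in> {d. d \<in> {1..s} \<and> rough t d \<and> q dvd d} - (\<lambda>e. q * e) ` {e. e \<in> {1..s div q} \<and> rough q e}"
      then obtain e where e: "d = q * e" by auto
      have "e \<in> {1..s div q}" using d e q by (auto simp: less_eq_div_iff_mult_less_eq mult.commute Suc_le_eq)
      then have "\<not>rough q e" using d e by auto
      moreover have "rough t e" using d e by (auto intro: rough_dvd[of t d])
      ultimately have "q dvd e" by (auto simp: q_def rough_Suc_iff)
      then have "q ^ 2 dvd d" using e by (simp add: power2_eq_square)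
      then have "\<not>squarefree d" using q(1) by (auto simp: squarefree_def prime_nat_iff)
      then show "?f d = 0" by (simp add: moebius_mu_def)
    qed
  qed auto
  also have "\<dots> = (\<Sum>e | e \<in> {1..s div q} \<and> rough q e. ?f (q * e))"
    using q by (subst sum.reindex) (auto simp: inj_on_def)
  also have "\<dots> = (\<Sum>e | e \<in> {1..s div q} \<and> rough q e. - (?f e / real q))"
  proof (intro sum.cong refl)
    fix e assume "e \<in> {e. e \<in> {1..s div q} \<and> rough q e}"
    then have "\<not>q dvd e" using True by (auto simp: q_def rough_Suc_iff)
    then show "?f (q * e) = - (?f e / real q)" using q by (simp add: moebius_mu_mult_prime)
  qed
  also have "\<dots> = - (rough_moebius_sum q (s div q) / real q)"
    by (simp add: rough_moebius_sum_def sum_negf sum_divide_distrib)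
  finally show ?thesis using True by (simp add: q_def)
qed

section \<open>The main term for the largest prime\<close>

lemma sum_prime_tail_bound:
  fixes c :: "nat \<Rightarrow> real"
  assumes K: "\<And>N. \<bar>\<Sum>n=1..N. if prime n then c n * ln (real n) / real n else 0\<bar> \<le> K" and t: "t \<ge> 2"
  shows "\<bar>\<Sum>s\<in>{t<..n}. if prime s then c s / real s else 0\<bar> \<le> 2 * K / ln (real t)"
proof -
  have "(\<Sum>s\<in>{t<..n}. if prime s then c s / real s else 0) =
      (\<Sum>s\<in>{t<..n}. (if prime s then c s * ln (real s) / real s else 0) / ln (real s))"
    using t by (intro sum.cong refl) auto
  then show ?thesis using sum_div_ln_bound[OF K t, of n] by simp
qed

text \<open>Uses tails instead of initial sums, because it is the tails of sum c(p) / p that are O(1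
  / ln t).\<close>

lemma abel_summation_tail:
  fixes a m :: "nat \<Rightarrow> real"
  assumes "y \<le> n"
  defines "E \<equiv> \<lambda>t. \<Sum>s\<in>{t<..n}. a s"
  shows "(\<Sum>t\<in>{y<..n}. a t * m t) = E y * m (Suc y) + (\<Sum>t\<in>{y<..n}. E t * (m (Suc t) - m t))"
proof -
  have E: "a (Suc k) = E k - E (Suc k)" if "k < n" for k
  proof -
    have "{k<..n} = insert (Suc k) {Suc k<..n}" using that by auto
    then show ?thesis by (simp add: E_def)
  qed
  have "(\<Sum>t\<in>{y<..k}. a t * m t) = E y * m (Suc y) - E k * m (Suc k) + (\<Sum>t\<in>{y<..k}. E t * (m (Suc t) - m t))"
    if "y \<le> k" "k \<le> n" for k
    using that
  proof (induction k rule: dec_induct)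
    case (step k)
    have "{y<..Suc k} = insert (Suc k) {y<..k}" using step.hyps by auto
    moreover have "a (Suc k) * m (Suc k) = E k * m (Suc k) - E (Suc k) * m (Suc k)"
      using step.prems by (simp add: E[of k] left_diff_distrib)
    ultimately show ?case using step by (simp add: right_diff_distrib)
  qed auto
  from this[OF assms(1) order.refl] show ?thesis by (simp add: E_def)
qed

text \<open>Two things change with t: the roughness level, which by the Buchstab identity matters
  only if t + 1 is prime and then costs 2 / (t + 1), and the range, which loses the d between
  \<open>N div Suc t\<close> and \<open>N div t\<close>.\<close>

lemma abs_rough_moebius_sum_step_le:
  assumes "t > 0"
  shows "\<bar>rough_moebius_sum (Suc t) (N div Suc t) - rough_moebius_sum t (N div t)\<bar> \<le>
    2 * (if prime (Suc t) then 1 / real (Suc t) else 0) +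
    (\<Sum>d | d \<in> {N div Suc t<..N div t} \<and> rough t d. 1 / real d)"
proof -
  have le: "N div Suc t \<le> N div t" using assms by (intro div_le_mono2) auto
  then have "{d. d \<in> {1..N div t} \<and> rough t d} = {d. d \<in> {1..N div Suc t} \<and> rough t d} \<union> {d. d \<in> {N div Suc t<..N div t} \<and> rough t d}"
    by auto
  moreover have "{d. d \<in> {1..N div Suc t} \<and> rough t d} \<inter> {d. d \<in> {N div Suc t<..N div t} \<and> rough t d} = {}" by auto
  ultimately have 1: "rough_moebius_sum t (N div t) = rough_moebius_sum t (N div Suc t) +
      (\<Sum>d | d \<in> {N div Suc t<..N div t} \<and> rough t d. of_int (moebius_mu d) / real d)"
    unfolding rough_moebius_sum_def by (simp add: sum.union_disjoint)
  have 2: "\<bar>\<Sum>d | d \<in> {N div Suc t<..N div t} \<and> rough t d. of_int (moebius_mu d) / real d\<bar> \<le>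
      (\<Sum>d | d \<in> {N div Suc t<..N div t} \<and> rough t d. 1 / real d)"
    by (rule order.trans[OF sum_abs], rule sum_mono) (auto simp: abs_divide intro!: divide_right_mono abs_moebius_mu_le)
  have "\<bar>rough_moebius_sum (Suc t) (N div Suc t div Suc t)\<bar> / real (Suc t) \<le> 2 / real (Suc t)"
    by (intro divide_right_mono abs_rough_moebius_sum_le) auto
  then have 3: "\<bar>rough_moebius_sum (Suc t) (N div Suc t) - rough_moebius_sum t (N div Suc t)\<bar> \<le> 2 * (if prime (Suc t) then 1 / real (Suc t) else 0)"
    unfolding rough_moebius_sum_Suc[of t] by (simp add: abs_divide)
  show ?thesis using 1 2 3 by linarith
qed

lemma sum_primes_dyadic_le:
  assumes X: "X \<ge> 2"
  shows "(\<Sum>t\<in>{X..<2*X}. if prime (Suc t) then 1 / real (Suc t) else 0) \<le> 40 / ln (real X)"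
proof -
  have "(\<Sum>t\<in>{X..<2*X}. if prime (Suc t) then 1 / real (Suc t) else 0) = (\<Sum>t | t \<in> {X..<2*X} \<and> prime (Suc t). 1 / real (Suc t))"
    by (rule sum.mono_neutral_cong_right) auto
  also have "\<dots> \<le> (\<Sum>t | t \<in> {X..<2*X} \<and> prime (Suc t). 1 / real X)"
    using X by (intro sum_mono divide_left_mono) auto
  also have "\<dots> = real (card {t. t \<in> {X..<2*X} \<and> prime (Suc t)}) / real X" by simp
  also have "card {t. t \<in> {X..<2*X} \<and> prime (Suc t)} \<le> card {p. prime p \<and> p \<le> 2 * X}"
    by (rule card_inj_on_le[where f = Suc]) auto
  also have "real (card {p. prime p \<and> p \<le> 2 * X}) \<le> 20 * real (2 * X) / ln (real (2 * X) + 2)"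
    by (rule card_primes_le)
  also have "\<dots> \<le> 20 * real (2 * X) / ln (real X)"
    using X by (intro divide_left_mono mult_pos_pos) auto
  finally show ?thesis using X by (simp add: divide_right_mono field_simps)
qed

text \<open>For different t the intervals are disjoint, so all d together are X-rough integers up to
  N / X. There are O(N / (X ln X)) of them, each of weight at most 2 X / N. The value d = 1 is left
  out, being rough at every level.\<close>

lemma sum_rough_hyperbola_dyadic_le:
  assumes K: "\<And>N y. 2 \<le> y \<Longrightarrow> real (card {n \<in> {2..N}. rough y n}) \<le> K * (real N / ln (real y))"
    and X: "X \<ge> 2" and K0: "K > 0"
  shows "(\<Sum>t\<in>{X..<2*X}. \<Sum>d | d \<in> {N div Suc t<..N div t} \<and> 2 \<le> d \<and> rough t d. 1 / real d) \<le> 2 * K / ln (real X)"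
proof (cases "N = 0")
  case False
  let ?D = "\<lambda>t. {d. d \<in> {N div Suc t<..N div t} \<and> 2 \<le> d \<and> rough t d}"
  have "(\<Sum>t\<in>{X..<2*X}. \<Sum>d\<in>?D t. 1 / real d) \<le> (\<Sum>t\<in>{X..<2*X}. \<Sum>d\<in>?D t. 2 * real X / real N)"
  proof (intro sum_mono)
    fix t d assume t: "t \<in> {X..<2*X}" and d: "d \<in> ?D t"
    have "N < Suc t * d" using d by (simp add: div_less_iff_less_mult mult.commute)
    also have "\<dots> \<le> 2 * X * d" using t by (intro mult_right_mono) auto
    finally have "real N \<le> 2 * real X * real d" by (metis less_imp_le of_nat_le_iff of_nat_mult of_nat_numeral)
    then show "1 / real d \<le> 2 * real X / real N" using d False by (simp add: field_simps)
  qed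
  also have "\<dots> = real (card (SIGMA t:{X..<2*X}. ?D t)) * (2 * real X / real N)"
    by (subst card_SigmaI) (auto simp: sum_distrib_right sum_divide_distrib)
  also have "\<dots> \<le> K * (real N / real X / ln (real X)) * (2 * real X / real N)"
  proof (rule mult_right_mono)
    have "card (SIGMA t:{X..<2*X}. ?D t) \<le> card {n \<in> {2..N div X}. rough X n}"
    proof (rule card_inj_on_le[where f = snd])
      show "inj_on snd (SIGMA t:{X..<2*X}. ?D t)"
      proof (rule inj_onI)
        fix a b assume ab: "a \<in> (SIGMA t:{X..<2*X}. ?D t)" "b \<in> (SIGMA t:{X..<2*X}. ?D t)" "snd a = snd b"
        have le: "\<not>t < t'" if "d \<in> ?D t" "d \<in> ?D t'" for t t' d
        proof
          assume "t < t'"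
          then have "N div t' \<le> N div Suc t" by (intro div_le_mono2) auto
          then show False using that by auto
        qed
        then have "fst a = fst b" using ab by (metis (no_types, lifting) SigmaE fst_conv snd_conv linorder_neqE_nat)
        then show "a = b" using ab(3) by (simp add: prod_eq_iff)
      qed
      show "snd ` (SIGMA t:{X..<2*X}. ?D t) \<subseteq> {n \<in> {2..N div X}. rough X n}"
      proof safe
        fix t d assume t: "t \<in> {X..<2*X}" and d: "d \<in> {N div Suc t<..N div t}" "2 \<le> d" "rough t d"
        have "N div t \<le> N div X" using t X by (intro div_le_mono2) auto
        then show "snd (t, d) \<in> {2..N div X}" using d by auto
        show "rough X (snd (t, d))" using d t by (auto simp: rough_def)
      qed
    qed auto
    then have "real (card (SIGMA t:{X..<2*X}. ?D t)) \<le> real (card {n \<in> {2..N div X}. rough X n})"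
      by (simp only: of_nat_le_iff)
    also have "\<dots> \<le> K * (real (N div X) / ln (real X))"
      by (rule K[OF X])
    also have "\<dots> \<le> K * (real N / real X / ln (real X))"
      using K0 X by (intro mult_left_mono divide_right_mono of_nat_div_le_of_nat) auto
    finally show "real (card (SIGMA t:{X..<2*X}. ?D t)) \<le> K * (real N / real X / ln (real X))" .
  qed simp
  also have "\<dots> = 2 * K / ln (real X)" using X False by (simp add: field_simps)
  finally show ?thesis .
qed (use K0 X in auto)

text \<open>In a dyadic block the prime steps are controlled by Chebyshev and the lost d by the
  count of rough integers, both O(1 / ln X); the weight 1 / ln t makes the blocks summable. The 1 in
  C pays for d = 1.\<close>

lemma sum_rough_moebius_steps_le:
  "\<exists>C\<ge>0. \<forall>N y n. 2 \<le> y \<longrightarrow> (\<Sum>t\<in>{y<..n}.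
     \<bar>rough_moebius_sum (Suc t) (N div Suc t) - rough_moebius_sum t (N div t)\<bar> / ln (real t)) \<le> C / ln (real y)"
proof -
  obtain K where K: "K > 0" "\<And>N y. 2 \<le> y \<Longrightarrow> real (card {n \<in> {2..N}. rough y n}) \<le> K * (real N / ln (real y))"
    using card_rough_le by blast
  define C where "C = 4 * (80 + 2 * K) + 1"
  have "(\<Sum>t\<in>{y<..n}. \<bar>rough_moebius_sum (Suc t) (N div Suc t) - rough_moebius_sum t (N div t)\<bar> / ln (real t)) \<le> C / ln (real y)"
    if y: "2 \<le> y" for N y n
  proof -
    define a where "a = (\<lambda>t. 2 * (if prime (Suc t) then 1 / real (Suc t) else 0) +
       (\<Sum>d | d \<in> {N div Suc t<..N div t} \<and> 2 \<le> d \<and> rough t d. 1 / real d))"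
    have step: "\<bar>rough_moebius_sum (Suc t) (N div Suc t) - rough_moebius_sum t (N div t)\<bar> \<le> a t + (if t = N then 1 else 0)"
      if t: "t > 0" for t
    proof -
      \<comment> \<open>The value d = 1 lies in the interval only if \<open>N div Suc t\<close> is 0
        and \<open>N div t\<close> is not, that is, only for t = N.\<close>
      have "(\<Sum>d | d \<in> {N div Suc t<..N div t} \<and> rough t d. 1 / real d) \<le>
        (\<Sum>d | d \<in> {N div Suc t<..N div t} \<and> 2 \<le> d \<and> rough t d. 1 / real d) + (\<Sum>d | d = 1 \<and> t = N. 1 / real d)"
      proof (subst sum.union_disjoint[symmetric])
        show "(\<Sum>d | d \<in> {N div Suc t<..N div t} \<and> rough t d. 1 / real d) \<le>
          (\<Sum>d\<in>{d. d \<in> {N div Suc t<..N div t} \<and> 2 \<le> d \<and> rough t d} \<union> {d. d = 1 \<and> t = N}. 1 / real d)"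
        proof (rule sum_mono2)
          show "{d. d \<in> {N div Suc t<..N div t} \<and> rough t d} \<subseteq> {d. d \<in> {N div Suc t<..N div t} \<and> 2 \<le> d \<and> rough t d} \<union> {d. d = 1 \<and> t = N}"
          proof
            fix d assume d: "d \<in> {d. d \<in> {N div Suc t<..N div t} \<and> rough t d}"
            have "t = N" if "d = 1"
            proof -
              have "N div Suc t = 0" "N div t \<ge> 1" using d that by auto
              then show ?thesis using t by (auto simp: div_eq_0_iff div_greater_zero_iff Suc_le_eq less_Suc_eq_le)
            qed
            then show "d \<in> {d. d \<in> {N div Suc t<..N div t} \<and> 2 \<le> d \<and> rough t d} \<union> {d. d = 1 \<and> t = N}"
              using d by (cases "d = 1") auto
          qed
        qed auto
      qed auto
      moreover have "(\<Sum>d | d = 1 \<and> t = N. 1 / real d) = (if t = N then 1 else 0)" by auto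
      ultimately show ?thesis using abs_rough_moebius_sum_step_le[OF t, of N] unfolding a_def by linarith
    qed
    have "(\<Sum>t\<in>{y<..n}. \<bar>rough_moebius_sum (Suc t) (N div Suc t) - rough_moebius_sum t (N div t)\<bar> / ln (real t)) \<le>
       (\<Sum>t\<in>{y<..n}. a t / ln (real t) + (if t = N then 1 / ln (real y) else 0))"
    proof (intro sum_mono)
      fix t assume t: "t \<in> {y<..n}"
      then have ln: "0 < ln (real y)" "ln (real y) \<le> ln (real t)" using y by auto
      have "\<bar>rough_moebius_sum (Suc t) (N div Suc t) - rough_moebius_sum t (N div t)\<bar> / ln (real t) \<le> (a t + (if t = N then 1 else 0)) / ln (real t)"
        using t ln by (intro divide_right_mono step) auto
      also have "\<dots> = a t / ln (real t) + (if t = N then 1 / ln (real t) else 0)" by (simp add: add_divide_distrib)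
      also have "(if t = N then 1 / ln (real t) else 0) \<le> (if t = N then 1 / ln (real y) else 0)"
        using ln by (auto intro!: divide_left_mono)
      finally show "\<bar>rough_moebius_sum (Suc t) (N div Suc t) - rough_moebius_sum t (N div t)\<bar> / ln (real t) \<le> a t / ln (real t) + (if t = N then 1 / ln (real y) else 0)"
        by simp
    qed
    also have "\<dots> = (\<Sum>t\<in>{y<..n}. a t / ln (real t)) + (\<Sum>t\<in>{y<..n}. if t = N then 1 / ln (real y) else 0)"
      by (rule sum.distrib)
    also have "(\<Sum>t\<in>{y<..n}. if t = N then 1 / ln (real y) else 0) \<le> 1 / ln (real y)"
      using y by simp
    also have "(\<Sum>t\<in>{y<..n}. a t / ln (real t)) \<le> (\<Sum>t\<in>{y..<Suc n}. a t / ln (real t))"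
      using y by (intro sum_mono2) (auto simp: a_def intro!: divide_nonneg_nonneg add_nonneg_nonneg sum_nonneg)
    also have "\<dots> \<le> 4 * (80 + 2 * K) / ln (real y)"
    proof (rule sum_div_ln_dyadic_le)
      fix X assume "X \<ge> y"
      then have X: "X \<ge> 2" using y by simp
      have "(\<Sum>t\<in>{X..<2*X}. a t) = 2 * (\<Sum>t\<in>{X..<2*X}. if prime (Suc t) then 1 / real (Suc t) else 0) +
          (\<Sum>t\<in>{X..<2*X}. \<Sum>d | d \<in> {N div Suc t<..N div t} \<and> 2 \<le> d \<and> rough t d. 1 / real d)"
        unfolding a_def sum.distrib sum_distrib_left ..
      also have "\<dots> \<le> 2 * (40 / ln (real X)) + 2 * K / ln (real X)"
        by (intro add_mono mult_left_mono sum_primes_dyadic_le sum_rough_hyperbola_dyadic_le K X) auto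
      also have "\<dots> = (80 + 2 * K) / ln (real X)" by (simp add: add_divide_distrib)
      finally show "(\<Sum>t\<in>{X..<2*X}. a t) \<le> (80 + 2 * K) / ln (real X)" .
    qed (use y in \<open>auto simp: a_def intro!: add_nonneg_nonneg sum_nonneg\<close>)
    finally show ?thesis by (simp add: C_def add_divide_distrib)
  qed
  moreover have "C \<ge> 0" using K by (simp add: C_def)
  ultimately show ?thesis by blast
qed

text \<open>Abel summation sets the tails of sum c(p) / p, which are O(1 / ln t), against the
  increments of the bounded Moebius factor, whose variation weighted by 1 / ln t is O(1 / ln y).
  Uniformity in n serves the truncation by w.\<close>

lemma sum_prime_rough_moebius_bound:
  assumes "\<And>N. \<bar>\<Sum>n=1..N. if prime n then c n * ln (real n) / real n else 0\<bar> \<le> K"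
  shows "\<exists>C\<ge>0. \<forall>N y n. 2 \<le> y \<longrightarrow>
    \<bar>\<Sum>q\<in>{y<..n}. (if prime q then c q / real q else 0) * rough_moebius_sum q (N div q)\<bar> \<le> C / ln (real y)"
proof -
  obtain C where C: "C \<ge> 0" "\<And>N y n. 2 \<le> y \<Longrightarrow> (\<Sum>t\<in>{y<..n}.
     \<bar>rough_moebius_sum (Suc t) (N div Suc t) - rough_moebius_sum t (N div t)\<bar> / ln (real t)) \<le> C / ln (real y)"
    using sum_rough_moebius_steps_le by blast
  have K: "K \<ge> 0" using assms[of 0] by simp
  have "\<bar>\<Sum>q\<in>{y<..n}. (if prime q then c q / real q else 0) * rough_moebius_sum q (N div q)\<bar> \<le> (4 * K + 2 * K * C) / ln (real y)"
    if y: "2 \<le> y" for N y n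
  proof (cases "y \<le> n")
    case True
    define a where "a = (\<lambda>q. if prime q then c q / real q else 0)"
    define m where "m = (\<lambda>q. rough_moebius_sum q (N div q))"
    define E where "E = (\<lambda>t. \<Sum>s\<in>{t<..n}. a s)"
    have E: "\<bar>E t\<bar> \<le> 2 * K / ln (real t)" if "t \<ge> 2" for t
      unfolding E_def a_def by (rule sum_prime_tail_bound[OF assms that])
    have "(\<Sum>q\<in>{y<..n}. a q * m q) = E y * m (Suc y) + (\<Sum>t\<in>{y<..n}. E t * (m (Suc t) - m t))"
      unfolding E_def by (rule abel_summation_tail[OF True])
    then have "\<bar>\<Sum>q\<in>{y<..n}. a q * m q\<bar> \<le> \<bar>E y * m (Suc y)\<bar> + \<bar>\<Sum>t\<in>{y<..n}. E t * (m (Suc t) - m t)\<bar>"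
      by (simp only: abs_triangle_ineq)
    also have "\<bar>E y * m (Suc y)\<bar> \<le> 2 * K / ln (real y) * 2"
      unfolding abs_mult m_def using K y by (intro mult_mono E abs_rough_moebius_sum_le) auto
    also have "\<bar>\<Sum>t\<in>{y<..n}. E t * (m (Suc t) - m t)\<bar> \<le> (\<Sum>t\<in>{y<..n}. 2 * K * (\<bar>m (Suc t) - m t\<bar> / ln (real t)))"
    proof (rule order.trans[OF sum_abs], rule sum_mono)
      fix t assume "t \<in> {y<..n}"
      then have "\<bar>E t\<bar> * \<bar>m (Suc t) - m t\<bar> \<le> 2 * K / ln (real t) * \<bar>m (Suc t) - m t\<bar>"
        using y by (intro mult_right_mono E) auto
      then show "\<bar>E t * (m (Suc t) - m t)\<bar> \<le> 2 * K * (\<bar>m (Suc t) - m t\<bar> / ln (real t))" by (simp add: abs_mult)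
    qed
    also have "\<dots> = 2 * K * (\<Sum>t\<in>{y<..n}. \<bar>m (Suc t) - m t\<bar> / ln (real t))" by (simp only: sum_distrib_left)
    also have "\<dots> \<le> 2 * K * (C / ln (real y))" using K C(2)[OF y] unfolding m_def by (intro mult_left_mono) auto
    finally have "\<bar>\<Sum>q\<in>{y<..n}. a q * m q\<bar> \<le> 2 * K / ln (real y) * 2 + 2 * K * (C / ln (real y))" by simp
    also have "\<dots> = (4 * K + 2 * K * C) / ln (real y)" by (simp add: add_divide_distrib)
    finally show ?thesis by (simp add: a_def m_def)
  qed (use K C y in auto)
  moreover have "4 * K + 2 * K * C \<ge> 0" using K C by simp
  ultimately show ?thesis by blast
qed

text \<open>The map (q, d) to q * d is injective, as q is the least prime factor of the product. So
  the rounding errors for all q together are no more numerous than the y-rough integers up to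
  N.\<close>

lemma sum_card_rough_le:
  assumes "finite Q" "\<And>q. q \<in> Q \<Longrightarrow> prime q \<and> y < q"
  shows "(\<Sum>q\<in>Q. card {d. d \<in> {1..N div q} \<and> rough q d}) \<le> card {n \<in> {2..N}. rough y n}"
proof -
  let ?D = "\<lambda>q. {d. d \<in> {1..N div q} \<and> rough q d}"
  have pf: "prime_factors (q * d) = insert q (prime_factors d)" if "q \<in> Q" "d \<in> ?D q" for q d
    using that assms(2)[of q] by (subst prime_factors_product) (auto simp: prime_prime_factors)
  have Min: "Min (prime_factors (q * d)) = q" if "q \<in> Q" "d \<in> ?D q" for q d
    unfolding pf[OF that] using that by (intro Min_eqI) (auto simp: rough_def)
  have "(\<Sum>q\<in>Q. card (?D q)) = card (SIGMA q:Q. ?D q)" using assms(1) by simp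
  also have "\<dots> \<le> card {n \<in> {2..N}. rough y n}"
  proof (rule card_inj_on_le[where f = "\<lambda>(q,d). q * d"])
    show "inj_on (\<lambda>(q,d). q * d) (SIGMA q:Q. ?D q)"
    proof (rule inj_onI)
      fix a b assume ab: "a \<in> (SIGMA q:Q. ?D q)" "b \<in> (SIGMA q:Q. ?D q)" "(\<lambda>(q,d). q * d) a = (\<lambda>(q,d). q * d) b"
      obtain q d q' d' where eq: "a = (q, d)" "b = (q', d')" by (cases a, cases b)
      have "q = q'" using Min[of q d] Min[of q' d'] ab by (simp add: eq)
      moreover have "q > 0" using ab assms(2)[of q] by (auto simp: eq prime_gt_0_nat)
      ultimately show "a = b" using ab by (simp add: eq)
    qed
    show "(\<lambda>(q,d). q * d) ` (SIGMA q:Q. ?D q) \<subseteq> {n \<in> {2..N}. rough y n}"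
    proof safe
      fix q d assume q: "q \<in> Q" and d: "d \<in> {1..N div q}" "rough q d"
      have q': "prime q" "y < q" using assms(2)[OF q] by auto
      have "q * d \<le> q * (N div q)" using d by auto
      also have "\<dots> \<le> N" by simp
      finally have "q * d \<le> N" .
      moreover have "2 * 1 \<le> q * d" using d prime_ge_2_nat[OF q'(1)] by (intro mult_le_mono) auto
      ultimately show "q * d \<in> {2..N}" by simp
      show "rough y (q * d)" using pf[OF q, of d] d q' by (auto simp: rough_def)
    qed
  qed auto
  finally show ?thesis .
qed

text \<open>Each count of q-smooth cofactors is expanded over q-rough d, and
  \<open>N div q div d\<close> = \<open>N div (q * d)\<close> differs from N / (q d) by at most
  1.\<close>

lemma sum_smooth_approx:
  assumes c: "\<And>n. \<bar>c n\<bar> \<le> (1::real)" and Q: "finite Q" "\<And>q. q \<in> Q \<Longrightarrow> prime q \<and> y < q"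
  shows "\<bar>(\<Sum>q\<in>Q. c q * real (card {b \<in> {1..N div q}. smooth q b})) - real N * (\<Sum>q\<in>Q. c q / real q * rough_moebius_sum q (N div q))\<bar>
     \<le> real (card {n \<in> {2..N}. rough y n})"
proof -
  let ?D = "\<lambda>q. {d. d \<in> {1..N div q} \<and> rough q d}"
  have "(\<Sum>q\<in>Q. c q * real (card {b \<in> {1..N div q}. smooth q b})) - real N * (\<Sum>q\<in>Q. c q / real q * rough_moebius_sum q (N div q)) =
    (\<Sum>q\<in>Q. c q * (real (card {b \<in> {1..N div q}. smooth q b}) - real N / real q * rough_moebius_sum q (N div q)))"
    by (simp add: sum_distrib_left sum_subtractf[symmetric] algebra_simps)
  also have "\<bar>\<dots>\<bar> \<le> (\<Sum>q\<in>Q. real (card (?D q)))"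
  proof (rule order.trans[OF sum_abs], rule sum_mono)
    fix q assume q: "q \<in> Q"
    have "real (card {b \<in> {1..N div q}. smooth q b}) - real N / real q * rough_moebius_sum q (N div q) =
      (\<Sum>d\<in>?D q. of_int (moebius_mu d) * (real (N div (q * d)) - real N / real (q * d)))"
      unfolding sum_rough_moebius_eq_card_smooth[symmetric] rough_moebius_sum_def
      by (simp add: sum_distrib_left sum_subtractf[symmetric] right_diff_distrib div_mult2_eq[symmetric] mult_ac)
    also have "\<bar>\<dots>\<bar> \<le> (\<Sum>d\<in>?D q. 1 * 1)"
    proof (rule order.trans[OF sum_abs], rule sum_mono, unfold abs_mult, rule mult_mono[OF abs_moebius_mu_le])
      fix d
      show "\<bar>real (N div (q * d)) - real N / real (q * d)\<bar> \<le> 1"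
        using real_div_minus_one_le[of N "q * d"] of_nat_div_le_of_nat[of N "q * d", where ?'a = real] by (simp add: abs_le_iff)
    qed auto
    finally have "\<bar>c q\<bar> * \<bar>real (card {b \<in> {1..N div q}. smooth q b}) - real N / real q * rough_moebius_sum q (N div q)\<bar> \<le> 1 * real (card (?D q))"
      using c[of q] by (intro mult_mono) auto
    then show "\<bar>c q * (real (card {b \<in> {1..N div q}. smooth q b}) - real N / real q * rough_moebius_sum q (N div q))\<bar> \<le> real (card (?D q))"
      by (simp add: abs_mult)
  qed
  also have "\<dots> = real (\<Sum>q\<in>Q. card (?D q))" by simp
  also have "\<dots> \<le> real (card {n \<in> {2..N}. rough y n})"
    by (subst of_nat_le_iff) (rule sum_card_rough_le[OF Q])
  finally show ?thesis .
qed

theorem small_sums_largest_prime: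
  assumes c: "\<And>n. \<bar>c n\<bar> \<le> (1::real)"
    and K: "\<And>N. \<bar>\<Sum>n=1..N. if prime n then c n * ln (real n) / real n else 0\<bar> \<le> K"
  shows "small_sums 1 (\<lambda>m. if m \<le> 1 then 0 else c (gpf m))"
proof -
  obtain C where C: "C \<ge> 0" "\<And>N y n. 2 \<le> y \<Longrightarrow>
    \<bar>\<Sum>q\<in>{y<..n}. (if prime q then c q / real q else 0) * rough_moebius_sum q (N div q)\<bar> \<le> C / ln (real y)"
    using sum_prime_rough_moebius_bound[OF K] by blast
  obtain R where R: "R > 0" "\<And>N y. 2 \<le> y \<Longrightarrow> real (card {n \<in> {2..N}. rough y n}) \<le> R * (real N / ln (real y))"
    using card_rough_le by blast
  obtain S N0 where S: "S > 0" and cut: "\<And>N. N \<ge> N0 \<Longrightarrow> \<exists>y\<ge>2. 1 / ln (real y) \<le> S * (lam N / ln (real N + 2)) \<and>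
     real (card {m \<in> {1..N}. smooth y m}) \<le> S * (real N / ln (real N + 2))"
    using ex_smooth_cutoff by blast
  let ?g = "\<lambda>m. if m \<le> 1 then 0 else c (gpf m)"
  have "\<bar>\<Sum>b | b \<in> {1..N} \<and> gpf b < w. ?g b\<bar> \<le> (S + (R + C) * S) * (real N * lam N ^ 1 / ln (real N + 2))"
    if N: "N \<ge> max N0 1" for N w
  proof -
    obtain y where y: "y \<ge> 2" "1 / ln (real y) \<le> S * (lam N / ln (real N + 2))"
      "real (card {m \<in> {1..N}. smooth y m}) \<le> S * (real N / ln (real N + 2))"
      using cut[of N] N by auto
    define F where "F = (\<lambda>m. if y < gpf m then c (gpf m) else 0)"
    define Q where "Q = {q. prime q \<and> q \<le> N \<and> q < w \<and> y < q}"
    have finQ: "finite Q" by (simp add: Q_def)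
    have Q2: "prime q \<and> y < q" if "q \<in> Q" for q using that by (simp add: Q_def)
    have lam: "lam N \<ge> 1" using N by (intro lam_ge_1) auto
    have split: "(\<Sum>b | b \<in> {1..N} \<and> gpf b < w. ?g b) =
       (\<Sum>b | b \<in> {1..N} \<and> gpf b < w. if gpf b \<le> y then ?g b else 0) + (\<Sum>b | b \<in> {1..N} \<and> b > 1 \<and> gpf b < w. F b)"
    proof -
      have "(\<Sum>b | b \<in> {1..N} \<and> gpf b < w. ?g b) =
        (\<Sum>b | b \<in> {1..N} \<and> gpf b < w. if gpf b \<le> y then ?g b else 0) + (\<Sum>b | b \<in> {1..N} \<and> gpf b < w. if b \<le> 1 then 0 else F b)"
        unfolding sum.distrib[symmetric] by (intro sum.cong) (auto simp: F_def)
      also have "(\<Sum>b | b \<in> {1..N} \<and> gpf b < w. if b \<le> 1 then 0 else F b) = (\<Sum>b | b \<in> {1..N} \<and> b > 1 \<and> gpf b < w. F b)"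
        by (subst sum_gt_1_eq) (auto intro!: sum.cong)
      finally show ?thesis .
    qed
    have small: "\<bar>\<Sum>b | b \<in> {1..N} \<and> gpf b < w. if gpf b \<le> y then ?g b else 0\<bar> \<le> S * (real N / ln (real N + 2))"
    proof -
      have "\<bar>\<Sum>b | b \<in> {1..N} \<and> gpf b < w. if gpf b \<le> y then ?g b else 0\<bar> \<le> (\<Sum>b | b \<in> {1..N} \<and> gpf b < w. if gpf b \<le> y then 1 else 0)"
        by (rule order.trans[OF sum_abs], rule sum_mono) (use c in auto)
      also have "\<dots> \<le> (\<Sum>b\<in>{1..N}. if gpf b \<le> y then 1 else 0)" by (intro sum_mono2) auto
      also have "\<dots> = (\<Sum>b\<in>{m \<in> {1..N}. smooth y m}. 1)"
        using y(1) by (intro sum.mono_neutral_cong_right) (auto simp: gpf_le_iff)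
      also have "\<dots> = real (card {m \<in> {1..N}. smooth y m})" by simp
      finally show ?thesis using y(3) by linarith
    qed
    have large: "(\<Sum>b | b \<in> {1..N} \<and> b > 1 \<and> gpf b < w. F b) = (\<Sum>q\<in>Q. c q * real (card {b \<in> {1..N div q}. smooth q b}))"
    proof -
      have "(\<Sum>b | b \<in> {1..N} \<and> b > 1 \<and> gpf b < w. F b) = (\<Sum>p | prime p \<and> p \<le> N \<and> p < w. \<Sum>b | b \<in> {1..N div p} \<and> gpf b < Suc p. if y < p then c p else 0)"
        unfolding F_def by (rule sum_largest_prime[where F = "\<lambda>p b. if y < p then c p else 0"])
      also have "\<dots> = (\<Sum>q\<in>Q. c q * real (card {b \<in> {1..N div q}. smooth q b}))"
      proof (rule sum.mono_neutral_cong_right)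
        fix q assume "q \<in> Q"
        then have "{b. b \<in> {1..N div q} \<and> gpf b < Suc q} = {b \<in> {1..N div q}. smooth q b}" "y < q"
          by (auto simp: Q_def gpf_le_iff less_Suc_eq_le prime_gt_0_nat Suc_le_eq)
        then show "(\<Sum>b | b \<in> {1..N div q} \<and> gpf b < Suc q. if y < q then c q else 0) = c q * real (card {b \<in> {1..N div q}. smooth q b})"
          by simp
      qed (auto simp: Q_def)
      finally show ?thesis .
    qed
    \<comment> \<open>The truncation by w only shortens the range of q, and the bound is uniform in
      its upper end. For w = 0 both sums are empty.\<close>
    have main: "(\<Sum>q\<in>Q. c q / real q * rough_moebius_sum q (N div q)) =
      (\<Sum>q\<in>{y<..min N (w - 1)}. (if prime q then c q / real q else 0) * rough_moebius_sum q (N div q))"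
      by (rule sum.mono_neutral_cong_left) (auto simp: Q_def)
    have "\<bar>(\<Sum>q\<in>Q. c q * real (card {b \<in> {1..N div q}. smooth q b})) - real N * (\<Sum>q\<in>Q. c q / real q * rough_moebius_sum q (N div q))\<bar>
     \<le> real (card {n \<in> {2..N}. rough y n})"
      by (rule sum_smooth_approx[OF c finQ Q2])
    then have "\<bar>\<Sum>q\<in>Q. c q * real (card {b \<in> {1..N div q}. smooth q b})\<bar> \<le> real (card {n \<in> {2..N}. rough y n}) +
       \<bar>real N * (\<Sum>q\<in>Q. c q / real q * rough_moebius_sum q (N div q))\<bar>"
      by linarith
    also have "real (card {n \<in> {2..N}. rough y n}) \<le> R * (real N / ln (real y))" by (rule R(2)[OF y(1)])
    also have "\<bar>real N * (\<Sum>q\<in>Q. c q / real q * rough_moebius_sum q (N div q))\<bar> \<le> real N * (C / ln (real y))"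
      unfolding abs_mult main using C(2)[OF y(1)] by (intro mult_mono) auto
    finally have "\<bar>\<Sum>q\<in>Q. c q * real (card {b \<in> {1..N div q}. smooth q b})\<bar> \<le> R * (real N / ln (real y)) + real N * (C / ln (real y))"
      by simp
    also have "\<dots> = (R + C) * real N * (1 / ln (real y))" by (simp add: distrib_left distrib_right add_divide_distrib mult.commute)
    also have "\<dots> \<le> (R + C) * real N * (S * (lam N / ln (real N + 2)))"
      using y(2) R(1) C(1) by (intro mult_left_mono) auto
    finally have 2: "\<bar>\<Sum>q\<in>Q. c q * real (card {b \<in> {1..N div q}. smooth q b})\<bar> \<le> (R + C) * real N * (S * (lam N / ln (real N + 2)))" .
    have "real N / ln (real N + 2) \<le> real N * lam N / ln (real N + 2)"
      using lam mult_left_mono[of 1 "lam N" "real N"] by (intro divide_right_mono) auto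
    then have "S * (real N / ln (real N + 2)) \<le> S * (real N * lam N / ln (real N + 2))" using S by (intro mult_left_mono) auto
    then have "\<bar>\<Sum>b | b \<in> {1..N} \<and> gpf b < w. ?g b\<bar> \<le> S * (real N * lam N / ln (real N + 2)) + (R + C) * real N * (S * (lam N / ln (real N + 2)))"
      unfolding split large using small 2 by linarith
    also have "\<dots> = (S + (R + C) * S) * (real N * lam N ^ 1 / ln (real N + 2))" by (simp add: algebra_simps add_divide_distrib)
    finally show ?thesis .
  qed
  then show ?thesis by (rule small_sumsI[rotated, where G = 1 and ?N0.0 = "max N0 1"]) (use c in auto)
qed

section \<open>Duality\<close>

lemma gpf_le: "n \<ge> 1 \<Longrightarrow> gpf n \<le> n"
  by (cases "n = 1") (use gpf_in_prime_factors[of n] in \<open>auto simp: gpf_def intro: dvd_imp_le\<close>)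

lemma small_sums_full:
  assumes "small_sums A g" "A \<le> B"
  shows "\<exists>K\<ge>0. \<forall>N. \<bar>\<Sum>b=1..N. g b\<bar> \<le> K * (real N * lam N ^ B / ln (real N + 2))"
proof -
  obtain K where K: "\<And>N w. \<bar>\<Sum>b | b \<in> {1..N} \<and> gpf b < w. g b\<bar> \<le> K * (real N * lam N ^ A / ln (real N + 2))"
    using assms(1) unfolding small_sums_def by blast
  have "\<bar>\<Sum>b=1..N. g b\<bar> \<le> max K 0 * (real N * lam N ^ B / ln (real N + 2))" for N
  proof (cases "N = 0")
    case False
    have "{b. b \<in> {1..N} \<and> gpf b < Suc N} = {1..N}" using gpf_le by (force simp: less_Suc_eq_le)
    then have "\<bar>\<Sum>b=1..N. g b\<bar> \<le> K * (real N * lam N ^ A / ln (real N + 2))" using K[where w = "Suc N"] by metis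
    also have "\<dots> \<le> max K 0 * (real N * lam N ^ B / ln (real N + 2))"
      using lam_ge_1[of N] assms(2) False
      by (intro mult_mono divide_right_mono mult_left_mono power_increasing) auto
    finally show ?thesis .
  qed auto
  then show ?thesis by (intro exI[of _ "max K 0"]) auto
qed

section \<open>Exceptional integers\<close>

lemma abs_sum_le_sum_full:
  assumes "\<And>b. f b \<ge> (0::real)"
  shows "\<bar>\<Sum>b | b \<in> {1..N} \<and> gpf b < w. f b\<bar> \<le> (\<Sum>b=1..N. f b)"
  using assms by (subst abs_of_nonneg) (auto intro!: sum_nonneg sum_mono2)

text \<open>Stripped once and twice, this indicator picks out the primes and the products of two
  primes, which lack a second or third largest prime.\<close>

lemma small_sums_eq_1: "small_sums 0 (\<lambda>m. of_bool (m = 1))"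
proof (rule small_sumsI[where G = 1 and ?N0.0 = 1 and K = 2])
  fix N w :: nat assume N: "1 \<le> N"
  have "\<bar>\<Sum>b | b \<in> {1..N} \<and> gpf b < w. of_bool (b = 1) :: real\<bar> \<le> (\<Sum>b=1..N. of_bool (b = 1))"
    by (rule abs_sum_le_sum_full) simp
  also have "\<dots> = 1" using N by simp
  also have "1 \<le> 2 * (real N * lam N ^ 0 / ln (real N + 2))"
  proof -
    have "ln (real N + 2) \<le> real N + 1" using ln_le_minus_one[of "real N + 2"] by simp
    then have "ln (real N + 2) \<le> 2 * real N" using N by simp
    then show ?thesis using N by (simp add: field_simps)
  qed
  finally show "\<bar>\<Sum>b | b \<in> {1..N} \<and> gpf b < w. of_bool (b = 1)\<bar> \<le> 2 * (real N * lam N ^ 0 / ln (real N + 2))" .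
qed auto

text \<open>Either m is y-smooth, or m is a multiple of p^2 for some p > y; the sum of 1 / p^2 over
  all integers p > y is at most 1 / y <= 1 / ln y.\<close>

lemma small_sums_gpf_square_dvd: "small_sums 1 (\<lambda>m. of_bool (m > 1 \<and> gpf m ^ 2 dvd m))"
proof -
  obtain S N0 where S: "S > 0" and cut: "\<And>N. N \<ge> N0 \<Longrightarrow> \<exists>y\<ge>2. 1 / ln (real y) \<le> S * (lam N / ln (real N + 2)) \<and>
     real (card {m \<in> {1..N}. smooth y m}) \<le> S * (real N / ln (real N + 2))"
    using ex_smooth_cutoff by blast
  show ?thesis
  proof (rule small_sumsI[where G = 1 and ?N0.0 = "max N0 1" and K = "2 * S"])
    fix N w :: nat assume N: "max N0 1 \<le> N"
    obtain y where y: "y \<ge> 2" "1 / ln (real y) \<le> S * (lam N / ln (real N + 2))"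
      "real (card {m \<in> {1..N}. smooth y m}) \<le> S * (real N / ln (real N + 2))"
      using cut[of N] N by auto
    have lam: "lam N \<ge> 1" using N by (intro lam_ge_1) auto
    let ?A = "{m. m \<in> {1..N} \<and> m > 1 \<and> gpf m ^ 2 dvd m}"
    let ?U = "\<lambda>p. (\<lambda>k. p ^ 2 * k) ` {1..N div p ^ 2}"
    have "?A \<subseteq> {m \<in> {1..N}. smooth y m} \<union> (\<Union>p\<in>{y<..N}. ?U p)"
    proof
      fix m assume m: "m \<in> ?A"
      show "m \<in> {m \<in> {1..N}. smooth y m} \<union> (\<Union>p\<in>{y<..N}. ?U p)"
      proof (cases "gpf m \<le> y")
        case True
        then show ?thesis using m y(1) by (auto simp: gpf_le_iff)
      next
        case False
        obtain k where k: "m = gpf m ^ 2 * k" using m by (auto elim: dvdE)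
        have l: "gpf m > 0" using gpf_ge_1[of m] by simp
        have "k \<ge> 1" using m k by (cases k) auto
        moreover have "k * gpf m ^ 2 \<le> N" using m k by (simp add: mult.commute)
        then have "k \<le> N div gpf m ^ 2" using l by (simp add: less_eq_div_iff_mult_less_eq)
        moreover have "gpf m \<le> N" using gpf_le[of m] m by auto
        ultimately show ?thesis using k False by (intro UnI2 UN_I[of "gpf m"] image_eqI[of _ _ k]) auto
      qed
    qed
    then have "card ?A \<le> card ({m \<in> {1..N}. smooth y m} \<union> (\<Union>p\<in>{y<..N}. ?U p))"
      by (intro card_mono) auto
    also have "\<dots> \<le> card {m \<in> {1..N}. smooth y m} + card (\<Union>p\<in>{y<..N}. ?U p)" by (rule card_Un_le)
    also have "card (\<Union>p\<in>{y<..N}. ?U p) \<le> (\<Sum>p\<in>{y<..N}. card (?U p))" by (rule card_UN_le) simp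
    also have "\<dots> \<le> (\<Sum>p\<in>{y<..N}. N div p ^ 2)"
      by (intro sum_mono order.trans[OF card_image_le]) auto
    finally have "real (card ?A) \<le> real (card {m \<in> {1..N}. smooth y m} + (\<Sum>p\<in>{y<..N}. N div p ^ 2))"
      by (simp only: of_nat_le_iff)
    also have "\<dots> = real (card {m \<in> {1..N}. smooth y m}) + (\<Sum>p\<in>{y<..N}. real (N div p ^ 2))" by simp
    also have "(\<Sum>p\<in>{y<..N}. real (N div p ^ 2)) \<le> (\<Sum>p\<in>{y<..N}. real N * (1 / real (p - 1) - 1 / real p))"
    proof (intro sum_mono)
      fix p assume "p \<in> {y<..N}"
      then have p: "real p \<ge> 2" "real (p - 1) = real p - 1" using y by auto
      then have eq: "1 / real (p - 1) - 1 / real p = 1 / ((real p - 1) * real p)" by (simp add: field_simps)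
      have "1 / (real p * real p) \<le> 1 / ((real p - 1) * real p)" using p by (intro divide_left_mono mult_right_mono) auto
      then have "real N * (1 / (real p * real p)) \<le> real N * (1 / real (p - 1) - 1 / real p)"
        unfolding eq by (intro mult_left_mono) auto
      moreover have "real (N div p ^ 2) \<le> real N * (1 / (real p * real p))"
        using of_nat_div_le_of_nat[of N "p ^ 2", where ?'a = real] by (simp add: power2_eq_square)
      ultimately show "real (N div p ^ 2) \<le> real N * (1 / real (p - 1) - 1 / real p)" by linarith
    qed
    also have "\<dots> = real N * (\<Sum>p\<in>{y<..N}. 1 / real (p - 1) - 1 / real p)" by (simp only: sum_distrib_left)
    also have "\<dots> \<le> real N * (1 / ln (real y))"
    proof (intro mult_left_mono)
      have "(\<Sum>p\<in>{y<..N}. 1 / real (p - 1) - 1 / real p) \<le> 1 / real y"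
      proof (cases "y \<le> N")
        case True
        have "(\<Sum>p\<in>{y<..N}. 1 / real (p - 1) - 1 / real p) = 1 / real y - 1 / real N" using True
        proof (induction N rule: dec_induct)
          case (step n)
          then have "{y<..Suc n} = insert (Suc n) {y<..n}" by auto
          then show ?case using step by simp
        qed auto
        then show ?thesis by simp
      qed auto
      also have "\<dots> \<le> 1 / ln (real y)" using y(1) ln_bound[of "real y"] by (intro divide_left_mono) auto
      finally show "(\<Sum>p\<in>{y<..N}. 1 / real (p - 1) - 1 / real p) \<le> 1 / ln (real y)" .
    qed auto
    also have "\<dots> \<le> real N * (S * (lam N / ln (real N + 2)))" using y(2) by (intro mult_left_mono) auto
    also have "real (card {m \<in> {1..N}. smooth y m}) \<le> S * (real N / ln (real N + 2))" by (rule y(3))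
    also have "\<dots> \<le> S * (real N * lam N / ln (real N + 2))"
      using S lam mult_left_mono[of 1 "lam N" "real N"] by (intro mult_left_mono divide_right_mono) auto
    finally have A: "real (card ?A) \<le> 2 * S * (real N * lam N ^ 1 / ln (real N + 2))" by simp
    have "\<bar>\<Sum>b | b \<in> {1..N} \<and> gpf b < w. of_bool (b > 1 \<and> gpf b ^ 2 dvd b) :: real\<bar> \<le> (\<Sum>b=1..N. of_bool (b > 1 \<and> gpf b ^ 2 dvd b))"
      by (rule abs_sum_le_sum_full) simp
    also have "\<dots> = (\<Sum>b\<in>?A. 1)" by (rule sum.mono_neutral_cong_right) auto
    also have "\<dots> = real (card ?A)" by simp
    also note A
    finally show "\<bar>\<Sum>b | b \<in> {1..N} \<and> gpf b < w. of_bool (b > 1 \<and> gpf b ^ 2 dvd b)\<bar> \<le> 2 * S * (real N * lam N ^ 1 / ln (real N + 2))" .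
  qed auto
qed

text \<open>Up to sign, the contribution of the subsets that contain a new smallest prime: with T
  for the other elements, such a subset has \<open>card T + 1\<close> members.\<close>

definition shifted_square_sum :: "'a set \<Rightarrow> real" where
  "shifted_square_sum P = (\<Sum>T\<in>Pow P. (-1) ^ card T * (real (card T) + 1) ^ 2)"

lemma shifted_square_sum_insert:
  assumes "finite P" "p \<notin> P"
  shows "shifted_square_sum (insert p P) = (\<Sum>T\<in>Pow P. (-1) ^ card T * (- 2 * real (card T) - 3))"
proof -
  have "card (insert p T) = Suc (card T)" if "T \<in> Pow P" for T
    using that assms by (subst card_insert_disjoint) (auto intro: finite_subset)
  then show ?thesis unfolding shifted_square_sum_def sum_alternating_insert[OF assms]
    by (intro sum.cong refl) (simp add: power2_eq_square algebra_simps)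
qed

lemma sum_alternating_linear_insert:
  assumes "finite P" "p \<notin> P"
  shows "(\<Sum>T\<in>Pow (insert p P). (-1) ^ card T * (- 2 * real (card T) - 3)) = 2 * (\<Sum>T\<in>Pow P. (-1) ^ card T)"
proof -
  have "card (insert p T) = Suc (card T)" if "T \<in> Pow P" for T
    using that assms by (subst card_insert_disjoint) (auto intro: finite_subset)
  then show ?thesis unfolding sum_alternating_insert[OF assms] sum_distrib_left
    by (intro sum.cong refl) (simp add: algebra_simps)
qed

text \<open>Two pairings reduce (t + 1)^2 to - 2 t - 3 and then to 2; a third gives 0. The values 1,
  -3, 2 are, up to sign, the coefficients of the three largest primes.\<close>

lemma shifted_square_sum_eq:
  assumes "finite P"
  shows "shifted_square_sum P = (if card P = 0 then 1 else if card P = 1 then -3 else if card P = 2 then 2 else 0)"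
proof -
  consider "P = {}" | a where "P = {a}" | a b B where "P = insert a (insert b B)" "a \<noteq> b" "a \<notin> B" "b \<notin> B" "finite B"
  proof (cases "P = {}")
    case False
    then obtain a A where a: "P = insert a A" "a \<notin> A" "finite A" using assms by (metis finite_insert mk_disjoint_insert ex_in_conv)
    show ?thesis
    proof (cases "A = {}")
      case False
      then obtain b B where "A = insert b B" "b \<notin> B" "finite B" using a by (metis finite_insert mk_disjoint_insert ex_in_conv)
      then show ?thesis using a that(3)[of a b B] by auto
    qed (use a that in auto)
  qed (use that in auto)
  then show ?thesis
  proof cases
    case 1
    then show ?thesis by (simp add: shifted_square_sum_def)
  next
    case (2 a)
    then show ?thesis by (simp add: shifted_square_sum_insert)
  next
    case (3 a b B)
    then have "shifted_square_sum P = 2 * (\<Sum>T\<in>Pow B. (-1) ^ card T)"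
      using shifted_square_sum_insert[of "insert b B" a] sum_alternating_linear_insert[of B b] by simp
    also have "\<dots> = (if B = {} then 2 else 0)" using 3 by (simp add: sum_alternating)
    finally show ?thesis using 3 by (auto simp: card_eq_0_iff)
  qed
qed

text \<open>For P the set of primes of m, this is the divisor sum f m of the duality, a squarefree
  divisor n being given by its set T of primes. The case T = {}, that is n = 1, is set to 0 because
  \<open>Min {}\<close> is unspecified.\<close>

definition min_square_sum :: "(nat \<Rightarrow> bool) \<Rightarrow> nat set \<Rightarrow> real" where
  "min_square_sum J P = (\<Sum>T\<in>Pow P. (-1) ^ card T * (if T = {} then 0 else real (card T) ^ 2 * of_bool (J (Min T))))"

lemma min_square_sum_empty: "min_square_sum J {} = 0"
  by (simp add: min_square_sum_def)

text \<open>Every subset containing p has minimum p, whatever else it contains, so its J-factor is J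
  p and only cardinalities remain.\<close>

lemma min_square_sum_insert:
  assumes P: "finite P" and p: "\<And>q. q \<in> P \<Longrightarrow> p < q"
  shows "min_square_sum J (insert p P) = min_square_sum J P - of_bool (J p) * shifted_square_sum P"
proof -
  have "p \<notin> P" using p by auto
  have "(\<Sum>T\<in>Pow P. (-1) ^ card (insert p T) * (if insert p T = {} then 0 else real (card (insert p T)) ^ 2 * of_bool (J (Min (insert p T))))) =
     (\<Sum>T\<in>Pow P. - of_bool (J p) * ((-1) ^ card T * (real (card T) + 1) ^ 2))"
  proof (intro sum.cong refl)
    fix T assume T: "T \<in> Pow P"
    then have fin: "finite T" using P by (auto intro: finite_subset)
    have "p \<notin> T" using T \<open>p \<notin> P\<close> by auto
    have "Min (insert p T) = p" using fin T p by (intro Min_eqI) (auto intro: less_imp_le)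
    then show "(-1) ^ card (insert p T) * (if insert p T = {} then 0 else real (card (insert p T)) ^ 2 * of_bool (J (Min (insert p T)))) =
      - of_bool (J p) * ((-1) ^ card T * (real (card T) + 1) ^ 2)"
      using fin \<open>p \<notin> T\<close> by (simp add: add.commute)
  qed
  then show ?thesis
    unfolding min_square_sum_def shifted_square_sum_def sum_Pow_insert[OF P \<open>p \<notin> P\<close>]
    by (simp add: sum_distrib_left[symmetric] sum_negf)
qed

text \<open>When P is built up from its largest element downwards, only the first three insertions
  change the sum, each by at most 3 in absolute value.\<close>

lemma abs_min_square_sum_le:
  assumes "finite P"
  shows "\<bar>min_square_sum J P\<bar> \<le> 9"
proof -
  have "\<bar>min_square_sum J P\<bar> \<le> 3 * real (min (card P) 3)"
    using assms
  proof (induction P rule: finite_linorder_min_induct)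
    case (insert p P)
    have "p \<notin> P" using insert.hyps by auto
    have "min_square_sum J (insert p P) = min_square_sum J P - of_bool (J p) * shifted_square_sum P"
      using insert.hyps by (intro min_square_sum_insert) auto
    then show ?case using insert \<open>p \<notin> P\<close>
      by (auto simp: shifted_square_sum_eq min_def split: if_splits)
  qed (simp add: min_square_sum_empty)
  also have "\<dots> \<le> 9" by simp
  finally show ?thesis .
qed

text \<open>
  Only the three largest primes survive: the alternating sum of \<open>(t+1)\<^sup>2\<close> over the subsets of an
  \<open>r\<close>-element set vanishes for \<open>r \<ge> 3\<close>.
\<close>
lemma min_square_sum_top:
  assumes Q: "finite Q" "\<And>q. q \<in> Q \<Longrightarrow> q < p3" and p: "p3 < p2" "p2 < p1"
  shows "min_square_sum J (Q \<union> {p3, p2, p1}) = - of_bool (J p1) + 3 * of_bool (J p2) - 2 * of_bool (J p3)"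
  using Q
proof (induction Q rule: finite_linorder_min_induct)
  case empty
  have "min_square_sum J {p1} = - of_bool (J p1)"
    using min_square_sum_insert[of "{}" p1 J] by (simp add: min_square_sum_empty shifted_square_sum_eq)
  moreover have "min_square_sum J {p2, p1} = min_square_sum J {p1} + 3 * of_bool (J p2)"
    using min_square_sum_insert[of "{p1}" p2 J] p by (simp add: shifted_square_sum_eq)
  moreover have "min_square_sum J {p3, p2, p1} = min_square_sum J {p2, p1} - 2 * of_bool (J p3)"
    by (subst min_square_sum_insert) (use p in \<open>auto simp: shifted_square_sum_eq\<close>)
  ultimately show ?case by simp
next
  case (insert q Q)
  have "card {p3, p2, p1} \<le> card (Q \<union> {p3, p2, p1})" using insert.hyps by (intro card_mono) auto
  then have "card (Q \<union> {p3, p2, p1}) \<ge> 3" using p by simp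
  then have "shifted_square_sum (Q \<union> {p3, p2, p1}) = 0" using insert.hyps by (subst shifted_square_sum_eq) auto
  moreover have "q < p3" using insert.prems by simp
  moreover have "min_square_sum J (insert q (Q \<union> {p3, p2, p1})) = min_square_sum J (Q \<union> {p3, p2, p1}) - of_bool (J q) * shifted_square_sum (Q \<union> {p3, p2, p1})"
    using insert.hyps insert.prems p by (intro min_square_sum_insert) fastforce+
  moreover have "min_square_sum J (Q \<union> {p3, p2, p1}) = - of_bool (J p1) + 3 * of_bool (J p2) - 2 * of_bool (J p3)"
    using insert.prems by (intro insert.IH) auto
  ultimately show ?case unfolding Un_insert_left by simp
qed

text \<open>For integral n the integer part of x / n is \<open>N div n\<close>, the number of
  multiples of n up to N; exchanging the sums collects the divisors of each m.\<close>

lemma sum_least_prime_factor_eq_min_square_sum: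
  fixes x :: real
  assumes x: "x \<ge> 0"
  shows "(\<Sum>n | 2 \<le> n \<and> real n \<le> x \<and> J (least_prime_factor n).
            real_of_int (moebius_mu n) * real (omega n) ^ 2 * real_of_int \<lfloor>x / real n\<rfloor>) =
         (\<Sum>m=1..nat \<lfloor>x\<rfloor>. min_square_sum J (prime_factors m))"
proof -
  define N where "N = nat \<lfloor>x\<rfloor>"
  define h where "h = (\<lambda>n. if 2 \<le> n \<and> J (least_prime_factor n) then real (omega n) ^ 2 else 0)"
  have N: "real n \<le> x \<longleftrightarrow> n \<le> N" for n using x by (simp add: N_def le_nat_iff le_floor_iff)
  have floor: "real_of_int \<lfloor>x / real n\<rfloor> = real (N div n)" for n
  proof -
    have "\<lfloor>x / real n\<rfloor> = \<lfloor>x\<rfloor> div int n" using floor_divide_real_eq_div[of "int n" x] by simp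
    also have "\<lfloor>x\<rfloor> = int N" using x by (simp add: N_def)
    finally show ?thesis by (simp add: zdiv_int[symmetric])
  qed
  have "(\<Sum>n | 2 \<le> n \<and> real n \<le> x \<and> J (least_prime_factor n).
            real_of_int (moebius_mu n) * real (omega n) ^ 2 * real_of_int \<lfloor>x / real n\<rfloor>) =
     (\<Sum>d=1..N. of_int (moebius_mu d) * h d * real (N div d))"
    unfolding floor N by (rule sum.mono_neutral_cong_left) (auto simp: h_def)
  also have "\<dots> = (\<Sum>d=1..N. \<Sum>m=1..N div d. of_int (moebius_mu d) * h d)" by (simp add: mult.commute)
  also have "\<dots> = (\<Sum>m=1..N. \<Sum>d | d dvd m. of_int (moebius_mu d) * h d)" by (rule sum_divisors_swap[symmetric])
  also have "\<dots> = (\<Sum>m=1..N. min_square_sum J (prime_factors m))"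
  proof (intro sum.cong refl)
    fix m assume "m \<in> {1..N}"
    then have "(\<Sum>d | d dvd m. of_int (moebius_mu d) * h d) = (\<Sum>T\<in>Pow (prime_factors m). (-1) ^ card T * h (\<Prod>T))"
      by (intro sum_moebius_divisors) auto
    also have "\<dots> = min_square_sum J (prime_factors m)"
      unfolding min_square_sum_def
    proof (intro sum.cong refl)
      fix T assume "T \<in> Pow (prime_factors m)"
      then have pf: "prime_factors (\<Prod>T) = T" by (intro prime_factors_prod_primes[of _ m]) auto
      have "h (\<Prod>T) = (if T = {} then 0 else real (card T) ^ 2 * of_bool (J (Min T)))"
      proof (cases "T = {}")
        case False
        then have "\<Prod>T \<noteq> 0" "\<Prod>T \<noteq> 1" using pf by auto
        then have "\<Prod>T \<ge> 2" by linarith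
        then show ?thesis using False pf by (simp add: h_def least_prime_factor_def omega_def)
      qed (simp add: h_def)
      then show "(-1) ^ card T * h (\<Prod>T) = (-1) ^ card T * (if T = {} then 0 else real (card T) ^ 2 * of_bool (J (Min T)))" by simp
    qed
    finally show "(\<Sum>d | d dvd m. of_int (moebius_mu d) * h d) = min_square_sum J (prime_factors m)" .
  qed
  finally show ?thesis by (simp only: N_def)
qed

lemma strip_of_bool: "strip (\<lambda>m. of_bool (P m)) = (\<lambda>m. of_bool (m > 1 \<and> P (m div gpf m)))"
  by (rule ext) (simp add: strip_def)

text \<open>Covers the m for which stripping misreads the three largest distinct primes: the first
  or the second is repeated, or there are fewer than three prime factors. The terms may overlap,
  since only a value of at least 1 matters; each of them has small sums.\<close>

definition exceptional :: "nat \<Rightarrow> real" where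
  "exceptional m = of_bool (m > 1 \<and> gpf m ^ 2 dvd m) + strip (\<lambda>m. of_bool (m > 1 \<and> gpf m ^ 2 dvd m)) m +
     of_bool (m = 1) + strip (\<lambda>m. of_bool (m = 1)) m + strip (strip (\<lambda>m. of_bool (m = 1))) m"

lemma abs_strip_le: "(\<And>m. \<bar>g m\<bar> \<le> B) \<Longrightarrow> 0 \<le> B \<Longrightarrow> \<bar>strip g m\<bar> \<le> B"
  by (simp add: strip_def)

text \<open>Off the exceptional set, iterating \<open>strip\<close> reads off the second and third largest \<^emph>\<open>distinct\<close> primes.\<close>
lemma min_square_sum_approx:
  fixes J :: "nat \<Rightarrow> bool"
  assumes \<kappa>: "0 \<le> \<kappa>" "\<kappa> \<le> 1" and m: "m \<ge> 1"
  defines "g \<equiv> \<lambda>m. if m \<le> 1 then 0 else of_bool (J (gpf m)) - \<kappa>"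
  shows "\<bar>min_square_sum J (prime_factors m) - (- g m + 3 * strip g m - 2 * strip (strip g) m)\<bar> \<le> 15 * exceptional m"
proof -
  define b where "b = m div gpf m"
  define b2 where "b2 = b div gpf b"
  have exc: "exceptional m = of_bool (m > 1 \<and> gpf m ^ 2 dvd m) + of_bool (m > 1 \<and> b > 1 \<and> gpf b ^ 2 dvd b) +
     of_bool (m = 1) + of_bool (m > 1 \<and> b = 1) + of_bool (m > 1 \<and> b > 1 \<and> b2 = 1)"
    unfolding exceptional_def strip_of_bool b_def b2_def by simp
  show ?thesis
  proof (cases "exceptional m = 0")
    case True
    then have e: "\<not>(m > 1 \<and> gpf m ^ 2 dvd m)" "\<not>(m > 1 \<and> b > 1 \<and> gpf b ^ 2 dvd b)" "m \<noteq> 1"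
      "\<not>(m > 1 \<and> b = 1)" "\<not>(m > 1 \<and> b > 1 \<and> b2 = 1)"
      unfolding exc by (auto simp: of_bool_def split: if_splits)
    have m1: "m > 1" using m e(3) by simp
    note d1 = gpf_decompose[OF m1, folded b_def]
    have b1: "b > 1" using d1(3) e(4) m1 by linarith
    note d2 = gpf_decompose[OF b1, folded b2_def]
    have b21: "b2 > 1" using d2(3) e(5) m1 b1 by linarith
    note d3 = gpf_decompose[OF b21]
    \<comment> \<open>Equality would make the square of the largest prime divide m, which the first
      term of \<open>exceptional\<close> rules out.\<close>
    have lt1: "gpf b < gpf m"
    proof (rule ccontr)
      assume "\<not>gpf b < gpf m"
      then have "gpf b = gpf m" using d1(4) by simp
      then have "gpf m ^ 2 dvd m" using d1(2) d2(2) by (metis dvd_triv_left mult.assoc power2_eq_square)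
      then show False using e(1) m1 by simp
    qed
    have lt2: "gpf b2 < gpf b"
    proof (rule ccontr)
      assume "\<not>gpf b2 < gpf b"
      then have "gpf b2 = gpf b" using d2(4) by simp
      then have "gpf b ^ 2 dvd b" using d2(2) d3(2) by (metis dvd_triv_left mult.assoc power2_eq_square)
      then show False using e(2) m1 b1 by simp
    qed
    have pf1: "prime_factors m = insert (gpf m) (prime_factors b)"
      by (subst d1(2), subst prime_factors_product) (use d1 in \<open>auto simp: prime_prime_factors\<close>)
    have pf2: "prime_factors b = insert (gpf b) (prime_factors b2)"
      by (subst d2(2), subst prime_factors_product) (use d2 in \<open>auto simp: prime_prime_factors\<close>)
    have pf: "prime_factors m = (prime_factors b2 - {gpf b2}) \<union> {gpf b2, gpf b, gpf m}"
      using gpf_in_prime_factors[OF b21] unfolding pf1 pf2 by auto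
    have "min_square_sum J (prime_factors m) = - of_bool (J (gpf m)) + 3 * of_bool (J (gpf b)) - 2 * of_bool (J (gpf b2))"
      unfolding pf
    proof (rule min_square_sum_top[OF _ _ lt2 lt1])
      fix q assume "q \<in> prime_factors b2 - {gpf b2}"
      then show "q < gpf b2" using gpf_ge[of q b2] by force
    qed auto
    \<comment> \<open>The three \<kappa> cancel because - 1 + 3 - 2 = 0.\<close>
    moreover have "g m = of_bool (J (gpf m)) - \<kappa>" "strip g m = of_bool (J (gpf b)) - \<kappa>"
      "strip (strip g) m = of_bool (J (gpf b2)) - \<kappa>"
      using m1 b1 b21 by (simp_all add: strip_def g_def b_def b2_def)
    ultimately show ?thesis using True by simp
  next
    case False
    \<comment> \<open>15 = 9 + 1 + 3 + 2: the trivial bound for \<open>min_square_sum\<close> and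
      those for the three terms replacing it.\<close>
    then have "exceptional m \<ge> 1" unfolding exc by (auto simp: of_bool_def split: if_splits)
    moreover have "\<bar>min_square_sum J (prime_factors m)\<bar> \<le> 9" by (rule abs_min_square_sum_le) simp
    moreover have "\<bar>g k\<bar> \<le> 1" for k using \<kappa> by (auto simp: g_def)
    moreover from this have "\<bar>strip g k\<bar> \<le> 1" for k by (rule abs_strip_le) simp
    moreover from this have "\<bar>strip (strip g) m\<bar> \<le> 1" by (rule abs_strip_le) simp
    ultimately have "\<bar>g m\<bar> \<le> 1" "\<bar>strip g m\<bar> \<le> 1" "\<bar>strip (strip g) m\<bar> \<le> 1"
      "\<bar>min_square_sum J (prime_factors m)\<bar> \<le> 9" "exceptional m \<ge> 1" by blast+
    then show ?thesis by linarith
  qed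
qed

theorem theorem4p3:
  fixes j l :: nat
  assumes "1 \<le> j" and "j \<le> l" and "coprime j l"
  shows "(\<lambda>x::real. \<Sum>n | 2 \<le> n \<and> real n \<le> x \<and> [least_prime_factor n = j] (mod l).
            real_of_int (moebius_mu n) * real (omega n) ^ 2 * real_of_int \<lfloor>x / real n\<rfloor>)
         \<in> O[at_top](\<lambda>x. x * ln (ln x) ^ 3 / ln x)"
proof -
  have l: "l > 0" using assms by simp
  obtain \<kappa> K where \<kappa>: "0 \<le> \<kappa>" "\<kappa> \<le> 1" and
    K: "\<And>N. \<bar>\<Sum>n=1..N. if prime n then (of_bool [n = j] (mod l) - \<kappa>) * ln (real n) / real n else 0\<bar> \<le> K"
    using mertens_residue_class[OF l assms(3)] by blast
  define J where "J = (\<lambda>p. [p = j] (mod l))"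
  define g where "g = (\<lambda>m. if m \<le> 1 then 0 else of_bool (J (gpf m)) - \<kappa>)"
  have g1: "small_sums 1 g"
    unfolding g_def
  proof (rule small_sums_largest_prime)
    fix N
    show "\<bar>\<Sum>n=1..N. if prime n then (of_bool (J n) - \<kappa>) * ln (real n) / real n else 0\<bar> \<le> K"
      unfolding J_def by (rule K)
  qed (use \<kappa> in auto)
  define sq where "sq = (\<lambda>m. of_bool (m > 1 \<and> gpf m ^ 2 dvd m) :: real)"
  define one where "one = (\<lambda>m. of_bool (m = (1::nat)) :: real)"
  \<comment> \<open>Two strips raise the exponent of \<open>lam\<close> from 1 to 3; the third
    largest prime is thus the source of the cube in the theorem.\<close>
  note g2 = small_sums_strip[OF g1] and g3 = small_sums_strip[OF small_sums_strip[OF g1]]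
  have sq1: "small_sums 1 sq" unfolding sq_def by (rule small_sums_gpf_square_dvd)
  have one0: "small_sums 0 one" unfolding one_def by (rule small_sums_eq_1)
  note sq2 = small_sums_strip[OF sq1] and one1 = small_sums_strip[OF one0] and one2 = small_sums_strip[OF small_sums_strip[OF one0]]
  define M where "M = (\<lambda>N. real N * lam N ^ 3 / ln (real N + 2))"
  obtain K1 where K1: "\<And>N. \<bar>\<Sum>b=1..N. g b\<bar> \<le> K1 * M N" unfolding M_def using small_sums_full[OF g1, of 3] by auto
  obtain K2 where K2: "\<And>N. \<bar>\<Sum>b=1..N. strip g b\<bar> \<le> K2 * M N" unfolding M_def using small_sums_full[OF g2, of 3] by auto
  obtain K3 where K3: "\<And>N. \<bar>\<Sum>b=1..N. strip (strip g) b\<bar> \<le> K3 * M N" unfolding M_def using small_sums_full[OF g3, of 3] by auto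
  obtain K4 where K4: "\<And>N. \<bar>\<Sum>b=1..N. sq b\<bar> \<le> K4 * M N" unfolding M_def using small_sums_full[OF sq1, of 3] by auto
  obtain K5 where K5: "\<And>N. \<bar>\<Sum>b=1..N. strip sq b\<bar> \<le> K5 * M N" unfolding M_def using small_sums_full[OF sq2, of 3] by auto
  obtain K6 where K6: "\<And>N. \<bar>\<Sum>b=1..N. one b\<bar> \<le> K6 * M N" unfolding M_def using small_sums_full[OF one0, of 3] by auto
  obtain K7 where K7: "\<And>N. \<bar>\<Sum>b=1..N. strip one b\<bar> \<le> K7 * M N" unfolding M_def using small_sums_full[OF one1, of 3] by auto
  obtain K8 where K8: "\<And>N. \<bar>\<Sum>b=1..N. strip (strip one) b\<bar> \<le> K8 * M N" unfolding M_def using small_sums_full[OF one2, of 3] by auto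
  define C where "C = K1 + 3 * K2 + 2 * K3 + 15 * (K4 + K5 + K6 + K7 + K8)"
  have main: "\<bar>\<Sum>m=1..N. min_square_sum J (prime_factors m)\<bar> \<le> \<bar>C\<bar> * M N" for N
  proof -
    let ?G = "\<lambda>m. - g m + 3 * strip g m - 2 * strip (strip g) m"
    have "(\<Sum>m=1..N. min_square_sum J (prime_factors m)) = (\<Sum>m=1..N. ?G m) + (\<Sum>m=1..N. min_square_sum J (prime_factors m) - ?G m)"
      unfolding sum.distrib[symmetric] by simp
    then have "\<bar>\<Sum>m=1..N. min_square_sum J (prime_factors m)\<bar> \<le> \<bar>\<Sum>m=1..N. ?G m\<bar> + \<bar>\<Sum>m=1..N. min_square_sum J (prime_factors m) - ?G m\<bar>"
      by (simp only: abs_triangle_ineq)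
    moreover have "\<bar>\<Sum>m=1..N. min_square_sum J (prime_factors m) - ?G m\<bar> \<le> (\<Sum>m=1..N. 15 * exceptional m)"
      by (rule order.trans[OF sum_abs], rule sum_mono, unfold g_def) (rule min_square_sum_approx[OF \<kappa>], simp)
    moreover have "(\<Sum>m=1..N. 15 * exceptional m) \<le> 15 * (K4 * M N) + 15 * (K5 * M N) + 15 * (K6 * M N) + 15 * (K7 * M N) + 15 * (K8 * M N)"
    proof -
      have "(\<Sum>m=1..N. 15 * exceptional m) = 15 * ((\<Sum>m=1..N. sq m) + (\<Sum>m=1..N. strip sq m) + (\<Sum>m=1..N. one m) +
         (\<Sum>m=1..N. strip one m) + (\<Sum>m=1..N. strip (strip one) m))"
        unfolding exceptional_def sum_distrib_left[symmetric] sum.distrib sq_def[symmetric] one_def[symmetric] ..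
      also have "\<dots> \<le> 15 * (K4 * M N + K5 * M N + K6 * M N + K7 * M N + K8 * M N)"
        by (intro mult_left_mono add_mono K4[THEN abs_le_D1] K5[THEN abs_le_D1] K6[THEN abs_le_D1] K7[THEN abs_le_D1] K8[THEN abs_le_D1]) simp
      finally show ?thesis by (simp add: distrib_left)
    qed
    moreover have "\<bar>\<Sum>m=1..N. ?G m\<bar> \<le> K1 * M N + 3 * (K2 * M N) + 2 * (K3 * M N)"
    proof -
      have "(\<Sum>m=1..N. ?G m) = - (\<Sum>m=1..N. g m) + 3 * (\<Sum>m=1..N. strip g m) - 2 * (\<Sum>m=1..N. strip (strip g) m)"
        by (simp only: sum.distrib sum_subtractf sum_negf sum_distrib_left)
      moreover have "\<bar>- a + 3 * b - 2 * c\<bar> \<le> x + 3 * y + 2 * z" if "\<bar>a\<bar> \<le> x" "\<bar>b\<bar> \<le> y" "\<bar>c\<bar> \<le> z" for a b c x y z :: real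
        using that by linarith
      ultimately show ?thesis using K1[of N] K2[of N] K3[of N] by metis
    qed
    moreover have "C * M N = K1 * M N + 3 * (K2 * M N) + 2 * (K3 * M N) +
        15 * (K4 * M N) + 15 * (K5 * M N) + 15 * (K6 * M N) + 15 * (K7 * M N) + 15 * (K8 * M N)"
      by (simp add: C_def algebra_simps)
    ultimately have "\<bar>\<Sum>m=1..N. min_square_sum J (prime_factors m)\<bar> \<le> C * M N" by linarith
    also have "\<dots> \<le> \<bar>C\<bar> * M N"
    proof (intro mult_right_mono)
      show "0 \<le> M N" using lam_ge_1[of N] by (cases "N = 0") (auto simp: M_def)
    qed auto
    finally show ?thesis .
  qed
  \<comment> \<open>Passing from N to real x needs only N <= x <= N + 2 as long as the shifted
    logarithms are kept; they are compared with ln ln x and ln x at the end.\<close>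
  have "(\<lambda>x::real. \<Sum>n | 2 \<le> n \<and> real n \<le> x \<and> [least_prime_factor n = j] (mod l).
            real_of_int (moebius_mu n) * real (omega n) ^ 2 * real_of_int \<lfloor>x / real n\<rfloor>)
      \<in> O[at_top](\<lambda>x. x * (1 + ln (ln (x + 2))) ^ 3 / ln x)"
  proof (rule bigoI[of _ "\<bar>C\<bar>"])
    show "eventually (\<lambda>x::real. norm (\<Sum>n | 2 \<le> n \<and> real n \<le> x \<and> [least_prime_factor n = j] (mod l).
            real_of_int (moebius_mu n) * real (omega n) ^ 2 * real_of_int \<lfloor>x / real n\<rfloor>) \<le>
         \<bar>C\<bar> * norm (x * (1 + ln (ln (x + 2))) ^ 3 / ln x)) at_top"
      using eventually_ge_at_top[of 2]
    proof eventually_elim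
      case (elim x)
      define N where "N = nat \<lfloor>x\<rfloor>"
      have N: "N \<ge> 1" "real N \<le> x" "x \<le> real N + 2" using elim by (auto simp: N_def le_nat_iff le_floor_iff) linarith
      have lx: "ln x > 0" using elim by simp
      have "norm (\<Sum>n | 2 \<le> n \<and> real n \<le> x \<and> [least_prime_factor n = j] (mod l).
            real_of_int (moebius_mu n) * real (omega n) ^ 2 * real_of_int \<lfloor>x / real n\<rfloor>) = \<bar>\<Sum>m=1..N. min_square_sum J (prime_factors m)\<bar>"
        using sum_least_prime_factor_eq_min_square_sum[of x J] elim by (simp add: J_def N_def)
      also have "\<dots> \<le> \<bar>C\<bar> * M N" by (rule main)
      also have "\<dots> \<le> \<bar>C\<bar> * norm (x * (1 + ln (ln (x + 2))) ^ 3 / ln x)"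
      proof (rule mult_left_mono)
        have "M N \<le> x * (1 + ln (ln (x + 2))) ^ 3 / ln x"
          unfolding M_def
        proof (intro frac_le mult_mono power_mono)
          show "0 \<le> lam N" using lam_ge_1[OF N(1)] by simp
          show "lam N \<le> 1 + ln (ln (x + 2))"
            unfolding lam_def using N ln_add_2_gt_1[OF N(1)] by (intro add_left_mono, subst ln_le_cancel_iff) auto
          then show "0 \<le> x * (1 + ln (ln (x + 2))) ^ 3" using elim \<open>0 \<le> lam N\<close> by (intro mult_nonneg_nonneg zero_le_power) auto
          show "ln x \<le> ln (real N + 2)" using N elim by simp
        qed (use N lx elim lam_ge_1[OF N(1)] in auto)
        also have "\<dots> \<le> norm (x * (1 + ln (ln (x + 2))) ^ 3 / ln x)" by (simp only: real_norm_def abs_ge_self)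
        finally show "M N \<le> norm (x * (1 + ln (ln (x + 2))) ^ 3 / ln x)" .
      qed simp
      finally show ?case .
    qed
  qed
  also have "(\<lambda>x::real. x * (1 + ln (ln (x + 2))) ^ 3 / ln x) \<in> O[at_top](\<lambda>x. x * ln (ln x) ^ 3 / ln x)"
    by real_asymp
  finally show ?thesis .
qed

end
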